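(* Let $U:\mathbb{R}^n\to\mathbb{R}$ be of class $C^2$, let $\Omega\subset\mathbb{R}^n$ be a connected component of $\{x\in\mathbb{R}^n:U(x)>0\}$, and assume that $\partial\Omega$ is compact and is the union of $N\geq 1$ distinct nonempty connected components $\Gamma_1,\ldots,\Gamma_N$. Assume: (a) $\Omega$ is bounded, $0\in\Omega$, and $U(-x)=U(x)$ for all $x\in\Omega$; (b) the set $P$ of critical points of $U$ contained in $\partial\Omega$ is finite (possibly empty), each component $\Gamma_j$ consisting of a single point has the form $\{p\}$ with $p\in P$, and whenever $\Gamma\in\{\Gamma_1,\ldots,\Gamma_N\}$ has positive diameter, every $p\in P\cap\Gamma$ is a hyperbolic critical point of $U$. Then there exist $\Gamma_+\in\{\Gamma_1,\ldots,\Gamma_N\}$ and a map $u^*:(0,T_+)\to\Omega$, with $0<T_+\leq+\infty$, such that $$\ddot u^*=\nabla U(u^* ),\qquad \tfrac12|\dot u^*|^2-U(u^* )=0\qquad\text{on }(0,T_+),$$ $$\lim_{t\to 0^+}u^*(t)=0,\qquad \lim_{t\to T_+}d(u^*(t),\Gamma_+)=0.$$ Moreover, $T_+<+\infty$ if and only if $\Gamma_+$ has positive diameter. If $T_+<+\infty$, then $\lim_{t\to T_+}u^*(t)=x_+$ for some $x_+\in\Gamma_+\setminus P$ and $\lim_{t\to T_+}\dot u^*(t)=0$.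
   Context: $d$ denotes Euclidean distance. A critical point $p$ of $U$ is hyperbolic if the Hessian of $U$ at $p$ is nonsingular. *)

theory Defs
  imports "HOL-Analysis.Analysis"
begin

definition grad :: "(real ^ 'n \<Rightarrow> real) \<Rightarrow> real ^ 'n \<Rightarrow> real ^ 'n" where
  "grad U x = (\<chi> i. frechet_derivative U (at x) (axis i 1))"

definition hessian :: "(real ^ 'n \<Rightarrow> real) \<Rightarrow> real ^ 'n \<Rightarrow> real ^ 'n ^ 'n" where
  "hessian U x = jacobian (grad U) (at x)"

text \<open>
  \<^const>\<open>grad\<close> and \<^const>\<open>hessian\<close> are only meaningful where the derivatives exist, so
  class $C^2$ demands differentiability of the function and of its gradient explicitly.
\<close>

definition class_C2 :: "(real ^ 'n \<Rightarrow> real) \<Rightarrow> bool" where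
  "class_C2 U \<longleftrightarrow>
     (\<forall>x. U differentiable (at x)) \<and>
     (\<forall>x. grad U differentiable (at x)) \<and>
     continuous_on UNIV (hessian U)"

definition critical_point :: "(real ^ 'n \<Rightarrow> real) \<Rightarrow> real ^ 'n \<Rightarrow> bool" where
  "critical_point U p \<longleftrightarrow> grad U p = 0"

definition hyperbolic_critical_point :: "(real ^ 'n \<Rightarrow> real) \<Rightarrow> real ^ 'n \<Rightarrow> bool" where
  "hyperbolic_critical_point U p \<longleftrightarrow> critical_point U p \<and> invertible (hessian U p)"

text \<open>
  The limit of \<open>f t\<close> as the real variable \<open>t\<close> increases to \<open>T\<close>, where \<open>T\<close> may be
  \<open>\<infinity>\<close>: for finite \<open>T\<close> this is the limit along \<open>at_left T\<close> on the reals, for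
  \<open>T = \<infinity>\<close> the limit along \<open>at_top\<close>.
\<close>

definition tends_at_endpoint ::
    "(real \<Rightarrow> 'a::topological_space) \<Rightarrow> 'a \<Rightarrow> ereal \<Rightarrow> bool" where
  "tends_at_endpoint f l T \<longleftrightarrow> ((\<lambda>t. f (real_of_ereal t)) \<longlongrightarrow> l) (at_left T)"

lemma tends_at_endpoint_finite:
  "tends_at_endpoint f l (ereal T) \<longleftrightarrow> (f \<longlongrightarrow> l) (at_left T)"
  using ereal_tendsto_simps1(1)[of f l T]
  by (simp add: tends_at_endpoint_def comp_def)

lemma tends_at_endpoint_infinity:
  "tends_at_endpoint f l \<infinity> \<longleftrightarrow> (f \<longlongrightarrow> l) at_top"
  using ereal_tendsto_simps1(3)[of f l]
  by (simp add: tends_at_endpoint_def comp_def)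

end

theory Submission
  imports Defs "HOL-Complex_Analysis.Great_Picard" "HOL-Real_Asymp.Real_Asymp"
begin

text \<open>
  The trajectory is a minimiser of the action \<open>\<integral> \<bar>u'\<bar>\<^sup>2 / 2 + U(u)\<close> among paths from \<open>0\<close> to the complement of
  \<open>\<Omega>\<close> with free travel time. It is obtained by minimising the time-discretised action, a
  finite-dimensional problem: minimisers satisfy a discrete Euler-Lagrange equation, their energy is
  nearly conserved and nearly zero, and as the time step tends to zero they converge, like Euler
  polygons, to a zero-energy solution. Near a regular boundary point a straight path to the boundary
  bounds the remaining action by \<open>C U\<^sup>3\<^sup>/\<^sup>2\<close>, which forces arrival in finite time; a critical point cannot be
  reached in finite time, because the speed \<open>sqrt (2 U)\<close> is at most proportional to the distance from
  it. Hence a trajectory that takes infinite time converges to some \<open>p \<in> P\<close>. A direction of negative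
  curvature of \<open>U\<close> at \<open>p\<close> would contradict minimality by a second variation over a long time
  interval. So if \<open>p\<close> is hyperbolic, the Hessian there is positive definite, and \<open>p\<close> is an isolated
  point of the boundary.
\<close>

section \<open>Discrete action minimisers\<close>

text \<open>Minimality is exploited only for the discrete paths: every competitor is inserted at
  step size \<open>h\<close>, and the resulting inequality is passed to the limit. The limit curve
  itself is not shown to be a minimiser. This shapes two constructions. First, the cost that a
  minimiser still has to pay is carried along as an extra coordinate of the Euler scheme; its limit
  plays the part of a value function along the trajectory. Second, the discrete paths lie in the
  open set \<Omega> before their exit, but the limit is a priori only in its closure, and nothing is
  known about the shape of the frontier; that the limit does not touch the frontier before time
  \<open>T\<close> has to be recovered from the value function and from the repulsion of critical
  points.

  Zero energy expresses stationarity under changes of the travel time. With a fixed step the travel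
  time cannot be varied continuously, so the energy is controlled indirectly: by spending one more
  step on the exit when a spare one exists, and by averaging over a long total time
  otherwise.\<close>

lemma gradient_mean_value:
  fixes f :: "'a::euclidean_space \<Rightarrow> real" and g :: "'a \<Rightarrow> 'a"
  assumes "convex S"
    and d: "\<And>x. x \<in> S \<Longrightarrow> (f has_derivative (\<lambda>w. g x \<bullet> w)) (at x)"
    and B: "\<And>x. x \<in> S \<Longrightarrow> norm (g x) \<le> B"
    and "x \<in> S" "y \<in> S"
  shows "\<bar>f x - f y\<bar> \<le> B * norm (x - y)"
proof -
  have "norm (f x - f y) \<le> B * norm (x - y)"
  proof (rule differentiable_bound[OF \<open>convex S\<close> _ _ \<open>x \<in> S\<close> \<open>y \<in> S\<close>, of f "\<lambda>x w. g x \<bullet> w"])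
    fix z assume z: "z \<in> S"
    show "(f has_derivative (\<lambda>w. g z \<bullet> w)) (at z within S)"
      using d[OF z] by (rule has_derivative_at_withinI)
    show "onorm (\<lambda>w. g z \<bullet> w) \<le> B"
    proof (rule onorm_le)
      fix w
      have "norm (g z \<bullet> w) \<le> norm (g z) * norm w" by (simp add: Cauchy_Schwarz_ineq2)
      also have "\<dots> \<le> B * norm w" by (intro mult_right_mono B z) simp
      finally show "norm (g z \<bullet> w) \<le> B * norm w" .
    qed
  qed
  then show ?thesis by simp
qed

section \<open>The potential well, its extension by zero, and bounds on a ball\<close>

locale potential_well =
  fixes U :: "'a::euclidean_space \<Rightarrow> real" and G :: "'a \<Rightarrow> 'a" and \<Omega> :: "'a set"
    and R K :: real
  assumes dU: "\<And>x. (U has_derivative (\<lambda>w. G x \<bullet> w)) (at x)"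
    and open_dom: "open \<Omega>"
    and pos: "\<And>x. x \<in> \<Omega> \<Longrightarrow> U x > 0"
    and zero_frontier: "\<And>x. x \<in> frontier \<Omega> \<Longrightarrow> U x = 0"
    and closure_sub_ball: "closure \<Omega> \<subseteq> ball 0 R"
    and zero_in: "0 \<in> \<Omega>"
    and G_bound: "\<And>x. x \<in> cball 0 R \<Longrightarrow> norm (G x) \<le> K"
    and G_lipschitz: "\<And>x y. x \<in> cball 0 R \<Longrightarrow> y \<in> cball 0 R \<Longrightarrow> norm (G x - G y) \<le> K * norm (x - y)"
    and K_pos: "K > 0"
begin

text \<open>Extending \<open>U\<close> by zero lets a path wait outside \<open>\<Omega>\<close> for free, so the number of steps only bounds the exit time.\<close>

definition W :: "'a \<Rightarrow> real" where
  "W x = (if x \<in> \<Omega> then U x else 0)"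

lemma W_nonneg: "0 \<le> W x"
  using pos[of x] by (auto simp: W_def)

lemma W_le: "x \<in> \<Omega> \<or> 0 \<le> c \<Longrightarrow> U x \<le> c \<Longrightarrow> W x \<le> c"
  by (auto simp: W_def)

lemma sub_open_ball: "\<Omega> \<subseteq> ball 0 R"
  using closure_sub_ball closure_subset by blast

lemma sub_ball: "\<Omega> \<subseteq> cball 0 R"
  using sub_open_ball ball_subset_cball by blast

lemma R_pos: "R > 0"
  using sub_open_ball zero_in by fastforce

lemma exists_outside: "\<exists>b. norm b = R \<and> b \<notin> \<Omega>"
  using vector_choose_size[of R] R_pos sub_open_ball
  by (metis less_eq_real_def mem_ball_0 order.irrefl subsetD)

lemma U_lipschitz:
  "x \<in> cball 0 R \<Longrightarrow> y \<in> cball 0 R \<Longrightarrow> \<bar>U x - U y\<bar> \<le> K * norm (x - y)"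
  by (rule gradient_mean_value[OF convex_cball dU G_bound])

lemma segment_cball:
  fixes x y :: 'a
  assumes "x \<in> cball 0 R" "y \<in> cball 0 R"
  shows "closed_segment x y \<subseteq> cball 0 R"
  using assms by (meson convex_cball convex_contains_segment)

text \<open>The mean value inequality is applied to \<open>U\<close> minus its linearisation, whose
  gradient is at most \<open>K * norm (y - x)\<close> on the segment. This loses a factor 2 against
  the optimal remainder, which is harmless here.\<close>

lemma U_taylor:
  assumes x: "x \<in> cball 0 R" and y: "y \<in> cball 0 R"
  shows "\<bar>U y - U x - G x \<bullet> (y - x)\<bar> \<le> K * (norm (y - x))\<^sup>2"
proof -
  let ?f = "\<lambda>z. U z - G x \<bullet> z"
  have "\<bar>?f y - ?f x\<bar> \<le> (K * norm (y - x)) * norm (y - x)"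
  proof (rule gradient_mean_value[of "closed_segment x y" _ "\<lambda>z. G z - G x"])
    fix z assume z: "z \<in> closed_segment x y"
    show "(?f has_derivative (\<lambda>w. (G z - G x) \<bullet> w)) (at z)"
      by (auto intro!: derivative_eq_intros dU simp: inner_diff_left)
    have "norm (G z - G x) \<le> K * norm (z - x)"
      using z segment_cball[OF x y] by (intro G_lipschitz x) auto
    also have "\<dots> \<le> K * norm (y - x)"
      using segment_bound1[OF z] K_pos by (simp add: norm_minus_commute)
    finally show "norm (G z - G x) \<le> K * norm (y - x)" .
  qed auto
  then show ?thesis by (simp add: inner_diff_right power2_eq_square algebra_simps)
qed

lemma frontier_point_on_segment:
  assumes "x \<in> \<Omega>" "y \<notin> \<Omega>"
  obtains z where "z \<in> closed_segment x y" "z \<in> frontier \<Omega>"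
proof -
  have "closed_segment x y \<inter> frontier \<Omega> \<noteq> {}"
    using assms by (intro connected_Int_frontier) auto
  then show ?thesis using that by blast
qed

lemma W_lipschitz:
  assumes x: "x \<in> cball 0 R" and y: "y \<in> cball 0 R"
  shows "\<bar>W x - W y\<bar> \<le> K * norm (x - y)"
proof -
  \<comment> \<open>The segment crosses the frontier, where \<open>U\<close> vanishes, so passing
    from \<open>U\<close> to \<open>0\<close> obeys the Lipschitz bound up to the crossing
    point.\<close>
  have mixed: "W x \<le> K * norm (x - y)"
    if xy: "x \<in> \<Omega>" "y \<notin> \<Omega>" "x \<in> cball 0 R" "y \<in> cball 0 R" for x y
  proof -
    obtain z where z: "z \<in> closed_segment x y" "z \<in> frontier \<Omega>"
      by (rule frontier_point_on_segment[OF xy(1,2)])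
    have "W x = \<bar>U x - U z\<bar>" using that pos[of x] zero_frontier[OF z(2)] by (simp add: W_def)
    also have "\<dots> \<le> K * norm (x - z)"
      using z segment_cball[OF xy(3,4)] xy(3) by (intro U_lipschitz) auto
    also have "\<dots> \<le> K * norm (x - y)"
      using segment_bound1[OF z(1)] K_pos by (simp add: norm_minus_commute)
    finally show ?thesis .
  qed
  consider "x \<in> \<Omega>" "y \<in> \<Omega>" | "x \<in> \<Omega>" "y \<notin> \<Omega>" | "x \<notin> \<Omega>" "y \<in> \<Omega>" | "x \<notin> \<Omega>" "y \<notin> \<Omega>" by blast
  then show ?thesis
  proof cases
    case 1 then show ?thesis using U_lipschitz[OF x y] by (simp add: W_def)
  next
    case 2 then show ?thesis using mixed[OF 2 x y] W_nonneg[of x] by (simp add: W_def)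
  next
    case 3 then show ?thesis using mixed[OF 3(2,1) y x] W_nonneg[of y]
      by (simp add: W_def norm_minus_commute)
  next
    case 4 then show ?thesis using K_pos by (simp add: W_def)
  qed
qed

lemma W_bound:
  assumes "x \<in> cball 0 R" shows "W x \<le> 2 * K * R"
proof -
  obtain b where b: "norm b = R" "b \<notin> \<Omega>" using exists_outside by blast
  have "\<bar>W x - W b\<bar> \<le> K * norm (x - b)" using assms b by (intro W_lipschitz) auto
  also have "\<dots> \<le> K * (norm x + norm b)" using K_pos norm_triangle_ineq4 by auto
  also have "\<dots> \<le> K * (R + R)" using assms b K_pos by auto
  finally show ?thesis using b by (simp add: W_def)
qed

lemma U_cont: "continuous_on S U"
  using dU has_derivative_continuous by (metis continuous_at_imp_continuous_on)

section \<open>The discretised action: existence of minimisers and comparison on a stretch\<close>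

definition cost :: "real \<Rightarrow> (nat \<Rightarrow> 'a) \<Rightarrow> nat \<Rightarrow> nat \<Rightarrow> real" where
  "cost h x a b = (\<Sum>k=a..<b. (norm (x (Suc k) - x k))\<^sup>2 / (2 * h) + h * W (x k))"

text \<open>Only the last position is required to be outside \<Omega>; earlier exits and returns are
  allowed. This keeps the constraints closed, which a first-exit condition would not be. The ball
  provides compactness.\<close>

definition admissible :: "nat \<Rightarrow> (nat \<Rightarrow> 'a) \<Rightarrow> bool" where
  "admissible N x \<longleftrightarrow> x 0 = 0 \<and> x N \<notin> \<Omega> \<and> (\<forall>k\<le>N. x k \<in> cball 0 R)"

definition minimizer :: "real \<Rightarrow> nat \<Rightarrow> (nat \<Rightarrow> 'a) \<Rightarrow> bool" where
  "minimizer h N x \<longleftrightarrow> 0 < h \<and> admissible N x \<and> (\<forall>y. admissible N y \<longrightarrow> cost h x 0 N \<le> cost h y 0 N)"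

lemma W_continuous: "continuous_on (cball 0 R) W"
  by (rule lipschitz_on_continuous_on[OF lipschitz_onI[of "cball 0 R" W K]])
    (use W_lipschitz K_pos in \<open>auto simp: dist_norm\<close>)

lemma cost_nonneg: "0 < h \<Longrightarrow> 0 \<le> cost h x a b"
  unfolding cost_def by (intro sum_nonneg) (use W_nonneg in auto)

lemma minimizer_exists:
  assumes "0 < h" "0 < N"
  obtains x where "minimizer h N x"
proof -
  obtain b where b: "norm b = R" "b \<notin> \<Omega>" using exists_outside by blast
  have adm0: "admissible N (\<lambda>k. if k = 0 then 0 else b)"
    using b R_pos \<open>0 < N\<close> by (auto simp: admissible_def)
  define I where "I = (INF x\<in>Collect (admissible N). cost h x 0 N)"
  have bdd: "bdd_below ((\<lambda>x. cost h x 0 N) ` Collect (admissible N))"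
    using cost_nonneg[OF \<open>0 < h\<close>] by (intro bdd_belowI[of _ 0]) auto
  have "\<exists>x. admissible N x \<and> cost h x 0 N < I + inverse (Suc i)" for i
  proof -
    have "I < I + inverse (real (Suc i))" by simp
    then show ?thesis using cINF_less_iff[OF _ bdd, of "I + inverse (real (Suc i))"] adm0
      unfolding I_def by auto
  qed
  then obtain X where X: "\<And>i. admissible N (X i)" "\<And>i. cost h (X i) 0 N < I + inverse (Suc i)"
    by metis
  have XR: "norm (X i k) \<le> R" if "k \<in> {..N}" for i k
    using X(1)[of i] that by (auto simp: admissible_def)
  \<comment> \<open>Only finitely many positions matter, each confined to a ball, so one subsequence
    converges at all of them.\<close>
  obtain r where r: "strict_mono r" "\<And>k. k \<in> {..N} \<Longrightarrow> \<exists>l. (\<lambda>i. X (r i) k) \<longlonglongrightarrow> l"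
  proof (rule function_convergent_subsequence[of "{..N}" X R])
    show "countable {..N}" by simp
  qed (use XR in blast)+
  then obtain x where x: "\<And>k. k \<le> N \<Longrightarrow> (\<lambda>i. X (r i) k) \<longlonglongrightarrow> x k"
    by (metis atMost_iff)
  have inball: "x k \<in> cball 0 R" if "k \<le> N" for k
    by (rule closed_sequentially[OF closed_cball _ x[OF that]])
      (use X(1) that in \<open>auto simp: admissible_def\<close>)
  have "x 0 = 0"
    using LIMSEQ_unique[OF x[of 0]] X(1) by (auto simp: admissible_def)
  moreover have "x N \<notin> \<Omega>"
    using closed_sequentially[OF closed_Compl[OF open_dom] _ x[of N]] X(1) by (auto simp: admissible_def)
  ultimately have adm: "admissible N x" using inball by (auto simp: admissible_def)
  have Wlim: "(\<lambda>i. W (X (r i) k)) \<longlonglongrightarrow> W (x k)" if "k \<le> N" for k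
    by (rule continuous_on_tendsto_compose[OF W_continuous x[OF that]])
      (use inball that X(1) in \<open>auto simp: admissible_def\<close>)
  have "(\<lambda>i. cost h (X (r i)) 0 N) \<longlonglongrightarrow> cost h x 0 N"
    unfolding cost_def by (intro tendsto_intros x Wlim) (use \<open>0 < h\<close> in auto)
  moreover have "(\<lambda>i. I + inverse (Suc (r i))) \<longlonglongrightarrow> I + 0"
    using LIMSEQ_subseq_LIMSEQ[OF LIMSEQ_inverse_real_of_nat r(1)]
    by (intro tendsto_intros) (simp add: o_def)
  ultimately have "cost h x 0 N \<le> I + 0"
    by (rule LIMSEQ_le) (use X(2) less_imp_le in blast)
  moreover have "I \<le> cost h y 0 N" if "admissible N y" for y
    unfolding I_def by (rule cINF_lower[OF bdd]) (use that in auto)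
  ultimately have "minimizer h N x"
    using adm \<open>0 < h\<close> by (force simp: minimizer_def)
  then show ?thesis by (rule that)
qed

lemma cost_split: "a \<le> b \<Longrightarrow> b \<le> c \<Longrightarrow> cost h x a c = cost h x a b + cost h x b c"
  unfolding cost_def by (simp add: sum.atLeastLessThan_concat)

lemma cost_cong: "(\<And>k. a \<le> k \<Longrightarrow> k \<le> b \<Longrightarrow> x k = y k) \<Longrightarrow> cost h x a b = cost h y a b"
  unfolding cost_def by (intro sum.cong) auto

lemma cost_Suc: "cost h x a (Suc a) = (norm (x (Suc a) - x a))\<^sup>2 / (2 * h) + h * W (x a)"
  by (simp add: cost_def)

text \<open>Changing a path on one stretch leaves the rest of the cost untouched. The right end of
  the stretch is kept, unless it is the final position, which may move freely outside
  \<Omega>.\<close>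

lemma minimizer_splice:
  assumes min: "minimizer h N x" and "a \<le> b" "b \<le> N"
    and "y a = x a" "y b = x b \<or> b = N \<and> y N \<notin> \<Omega>"
    and "\<And>k. a \<le> k \<Longrightarrow> k \<le> b \<Longrightarrow> y k \<in> cball 0 R"
  shows "cost h x a b \<le> cost h y a b"
proof -
  define w where "w k = (if a \<le> k \<and> k \<le> b then y k else x k)" for k
  have adm: "admissible N w"
    using min assms unfolding minimizer_def admissible_def w_def by auto
  have "cost h x 0 N \<le> cost h w 0 N" using min adm by (auto simp: minimizer_def)
  moreover have "cost h z 0 N = cost h z 0 a + cost h z a b + cost h z b N" for z
    using assms cost_split[of 0 a N h z] cost_split[of a b N h z] by simp
  moreover have "cost h w 0 a = cost h x 0 a"
    by (rule cost_cong) (use assms in \<open>auto simp: w_def\<close>)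
  moreover have "cost h w a b = cost h y a b"
    by (rule cost_cong) (use assms in \<open>auto simp: w_def\<close>)
  moreover have "cost h w b N = cost h x b N"
  proof (cases "b = N")
    case False
    then have "y b = x b" using assms by auto
    then show ?thesis by (intro cost_cong) (auto simp: w_def)
  qed (simp add: cost_def)
  ultimately show ?thesis by simp
qed

lemma minimizer_tail:
  assumes "minimizer h N x" "k \<le> N" "y k = x k" "y N \<notin> \<Omega>"
    and "\<And>i. k \<le> i \<Longrightarrow> i \<le> N \<Longrightarrow> y i \<in> cball 0 R"
  shows "cost h x k N \<le> cost h y k N"
  using minimizer_splice[OF assms(1,2) order_refl, of y] assms by auto

lemma minimizer_h_pos: "minimizer h N x \<Longrightarrow> 0 < h"
  by (simp add: minimizer_def)

lemma minimizer_ball: "minimizer h N x \<Longrightarrow> k \<le> N \<Longrightarrow> x k \<in> cball 0 R"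
  by (auto simp: minimizer_def admissible_def)

lemma minimizer_zero: "minimizer h N x \<Longrightarrow> x 0 = 0"
  by (auto simp: minimizer_def admissible_def)

lemma minimizer_end: "minimizer h N x \<Longrightarrow> x N \<notin> \<Omega>"
  by (auto simp: minimizer_def admissible_def)

definition exit_at :: "nat \<Rightarrow> (nat \<Rightarrow> 'a) \<Rightarrow> nat \<Rightarrow> bool" where
  "exit_at N x m \<longleftrightarrow> m \<le> N \<and> (\<forall>k<m. x k \<in> \<Omega>) \<and> x m \<notin> \<Omega>"

lemma exit_exists:
  assumes "minimizer h N x"
  obtains m where "exit_at N x m" "0 < m"
proof -
  define m where "m = (LEAST k. x k \<notin> \<Omega>)"
  have "x m \<notin> \<Omega>" unfolding m_def by (rule LeastI, rule minimizer_end[OF assms])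
  moreover have "m \<le> N" unfolding m_def by (rule Least_le, rule minimizer_end[OF assms])
  moreover have "x k \<in> \<Omega>" if "k < m" for k using not_less_Least that unfolding m_def by blast
  moreover have "0 < m" using \<open>x m \<notin> \<Omega>\<close> minimizer_zero[OF assms] zero_in by (cases m) auto
  ultimately show ?thesis using that unfolding exit_at_def by blast
qed

section \<open>Discrete Euler-Lagrange equation and energy\<close>

definition vel :: "real \<Rightarrow> (nat \<Rightarrow> 'a) \<Rightarrow> nat \<Rightarrow> 'a" where
  "vel h x k = (x (Suc k) - x k) /\<^sub>R h"

lemma vel_step: "0 < h \<Longrightarrow> x (Suc k) = x k + h *\<^sub>R vel h x k"
  by (simp add: vel_def)

lemma norm_vel: "0 < h \<Longrightarrow> norm (vel h x k) = norm (x (Suc k) - x k) / h"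
  by (simp add: vel_def divide_inverse mult.commute)

lemma kinetic_vel: "0 < h \<Longrightarrow> (norm (x (Suc k) - x k))\<^sup>2 / (2 * h) = h * (norm (vel h x k))\<^sup>2 / 2"
  unfolding norm_vel by (simp add: power_divide power2_eq_square)

text \<open>As \<Omega> is open, \<open>x (Suc k)\<close> can be varied inside it; only two kinetic
  terms and one potential term depend on it. The action contains \<open>+ U\<close>, so the force is
  \<open>+ G\<close> and the nearly conserved quantity is kinetic energy minus
  \<open>U\<close>.\<close>

lemma euler_lagrange:
  assumes min: "minimizer h N x" and k: "Suc k < N" and dom: "x (Suc k) \<in> \<Omega>"
  shows "vel h x (Suc k) = vel h x k + h *\<^sub>R G (x (Suc k))"
proof -
  note h = minimizer_h_pos[OF min]
  define a b c where "a = x k" and "b = x (Suc k)" and "c = x (Suc (Suc k))"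
  define f where "f y = (norm (y - a))\<^sup>2 / (2 * h) + (norm (c - y))\<^sup>2 / (2 * h) + h * U y" for y
  have le: "f b \<le> f y" if y: "y \<in> \<Omega>" for y
  proof -
    have "cost h x k (Suc (Suc k)) \<le> cost h (x(Suc k := y)) k (Suc (Suc k))"
      using min k y sub_ball minimizer_ball[OF min]
      by (intro minimizer_splice) auto
    then show ?thesis using dom y
      unfolding f_def a_def b_def c_def by (simp add: cost_def W_def[of y] W_def[of "x (Suc k)"])
  qed
  have "(f has_derivative (\<lambda>w. (b - a) \<bullet> w / h - (c - b) \<bullet> w / h + h * (G b \<bullet> w))) (at b)"
    unfolding f_def power2_norm_eq_inner using h
    by (auto intro!: derivative_eq_intros dU simp: inner_commute field_simps)
  then have "(\<lambda>w. (b - a) \<bullet> w / h - (c - b) \<bullet> w / h + h * (G b \<bullet> w)) = (\<lambda>w. 0)"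
    using le dom open_dom by (intro differential_zero_maxmin[of b \<Omega> f]) (auto simp: b_def)
  then have "(vel h x k - vel h x (Suc k) + h *\<^sub>R G b) \<bullet> w = 0" for w
    using fun_cong[of _ _ w] h
    unfolding a_def b_def c_def vel_def by (fastforce simp: inner_add_left inner_diff_left field_simps)
  then have "vel h x k - vel h x (Suc k) + h *\<^sub>R G b = 0"
    using inner_eq_zero_iff by blast
  then show ?thesis unfolding b_def by (simp add: algebra_simps)
qed

definition energy :: "real \<Rightarrow> (nat \<Rightarrow> 'a) \<Rightarrow> nat \<Rightarrow> real" where
  "energy h x k = (norm (vel h x k))\<^sup>2 / 2 - U (x k)"

text \<open>The Euler-Lagrange equation raises the kinetic energy by
  \<open>h * (g \<bullet> v)\<close> to first order, and Taylor expansion at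
  \<open>x (Suc k)\<close> raises \<open>U\<close> by the same amount. Only terms of order
  \<open>h\<^sup>2\<close> survive.\<close>

lemma energy_step:
  assumes min: "minimizer h N x" and k: "Suc k < N" and dom: "x (Suc k) \<in> \<Omega>"
  shows "\<bar>energy h x (Suc k) - energy h x k\<bar> \<le> h\<^sup>2 * (K\<^sup>2 / 2 + K * (norm (vel h x k))\<^sup>2)"
proof -
  note h = minimizer_h_pos[OF min]
  define g v where "g = G (x (Suc k))" and "v = vel h x k"
  have v': "vel h x (Suc k) = v + h *\<^sub>R g"
    using euler_lagrange[OF assms] by (simp add: g_def v_def)
  have x': "x k - x (Suc k) = - (h *\<^sub>R v)" using vel_step[OF h, of x k] by (simp add: v_def)
  have "\<bar>U (x k) - U (x (Suc k)) - g \<bullet> (x k - x (Suc k))\<bar> \<le> K * (norm (x k - x (Suc k)))\<^sup>2"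
    unfolding g_def using minimizer_ball[OF min] k by (intro U_taylor) auto
  then have T: "\<bar>U (x k) - U (x (Suc k)) + h * (g \<bullet> v)\<bar> \<le> K * h\<^sup>2 * (norm v)\<^sup>2"
    using h unfolding x' by (simp add: power_mult_distrib mult.assoc)
  have "(norm g)\<^sup>2 \<le> K\<^sup>2"
    unfolding g_def using G_bound minimizer_ball[OF min, of "Suc k"] k by (intro power_mono) auto
  then have g2: "h\<^sup>2 * (norm g)\<^sup>2 \<le> h\<^sup>2 * K\<^sup>2" "0 \<le> h\<^sup>2 * (norm g)\<^sup>2" by (auto intro: mult_left_mono)
  have n2: "(norm (v + h *\<^sub>R g))\<^sup>2 = (norm v)\<^sup>2 + 2 * h * (g \<bullet> v) + h\<^sup>2 * (norm g)\<^sup>2"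
    unfolding power2_norm_eq_inner
    by (simp add: inner_add_left inner_add_right inner_commute power2_eq_square algebra_simps)
  have 1: "\<bar>h\<^sup>2 * (norm g)\<^sup>2 / 2\<bar> \<le> h\<^sup>2 * (K\<^sup>2 / 2)" using g2 by simp
  have 2: "\<bar>U (x k) - U (x (Suc k)) + h * (g \<bullet> v)\<bar> \<le> h\<^sup>2 * (K * (norm v)\<^sup>2)"
    using T by (simp add: mult_ac)
  have "energy h x (Suc k) - energy h x k =
      h\<^sup>2 * (norm g)\<^sup>2 / 2 + (U (x k) - U (x (Suc k)) + h * (g \<bullet> v))"
    unfolding energy_def v' n2 v_def[symmetric] by (simp add: field_simps)
  then show ?thesis using 1 2 unfolding v_def[symmetric] distrib_left by linarith
qed

lemma kinetic_le_cost:
  assumes min: "minimizer h N x"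
  shows "(\<Sum>i<N. h * (norm (vel h x i))\<^sup>2 / 2) \<le> cost h x 0 N"
proof -
  note h = minimizer_h_pos[OF min]
  have "(\<Sum>i<N. h * (norm (vel h x i))\<^sup>2 / 2) \<le>
      (\<Sum>k = 0..<N. (norm (x (Suc k) - x k))\<^sup>2 / (2 * h) + h * W (x k))"
    unfolding kinetic_vel[OF h] atLeast0LessThan using h W_nonneg by (intro sum_mono) auto
  then show ?thesis unfolding cost_def .
qed

lemma energy_drift:
  assumes min: "minimizer h N x" and m: "exit_at N x m" and C: "cost h x 0 N \<le> C"
    and jk: "j \<le> k" "k < m"
  shows "\<bar>energy h x k - energy h x j\<bar> \<le> h * (K\<^sup>2 / 2 * (h * N) + 2 * K * C)"
proof -
  note h = minimizer_h_pos[OF min]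
  let ?d = "\<lambda>i. h\<^sup>2 * (K\<^sup>2 / 2 + K * (norm (vel h x i))\<^sup>2)"
  have d0: "0 \<le> ?d i" for i using K_pos by simp
  have "\<bar>energy h x k - energy h x j\<bar> \<le> (\<Sum>i=j..<k. ?d i)"
    using jk
  proof (induction k rule: dec_induct)
    case (step k)
    have "\<bar>energy h x (Suc k) - energy h x k\<bar> \<le> ?d k"
      using m step by (intro energy_step[OF min]) (auto simp: exit_at_def)
    then show ?case using step by (auto simp del: power_mult_distrib)
  qed simp
  also have "\<dots> \<le> (\<Sum>i<N. ?d i)"
    using jk m d0 by (intro sum_mono2) (auto simp: exit_at_def)
  \<comment> \<open>One factor \<open>h\<close> is split off; what remains of the velocity terms
    adds up to a multiple of the total kinetic cost, which \<open>C\<close> bounds.\<close>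
  also have "\<dots> = N * (h\<^sup>2 * (K\<^sup>2 / 2)) + 2 * h * K * (\<Sum>i<N. h * (norm (vel h x i))\<^sup>2 / 2)"
    by (simp add: sum.distrib distrib_left sum_distrib_left power2_eq_square algebra_simps)
  also have "\<dots> \<le> N * (h\<^sup>2 * (K\<^sup>2 / 2)) + 2 * h * K * C"
    using kinetic_le_cost[OF min] C h K_pos by (intro add_left_mono mult_left_mono) auto
  finally show ?thesis by (simp add: power2_eq_square algebra_simps)
qed

lemma cost_outside_const:
  "(\<And>k. a \<le> k \<Longrightarrow> k \<le> b \<Longrightarrow> x k = y) \<Longrightarrow> y \<notin> \<Omega> \<Longrightarrow> cost h x a b = 0"
  unfolding cost_def by (intro sum.neutral) (auto simp: W_def)

text \<open>Inserting the midpoint into the last segment would be cheaper if the last step were long.\<close>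

lemma exit_step:
  assumes min: "minimizer h N x" and m: "exit_at N x (Suc k)" and "Suc k < N"
  shows "norm (x (Suc k) - x k) \<le> 2 * K * h\<^sup>2"
proof -
  note h = minimizer_h_pos[OF min]
  define D where "D = norm (x (Suc k) - x k)"
  define c where "c = midpoint (x k) (x (Suc k))"
  \<comment> \<open>The competitor makes a stop at the midpoint, reaches the exit point one step
    later and then waits there for free; \<open>Suc k < N\<close> guarantees the spare step. Halving
    a step halves the kinetic cost of that stretch in total.\<close>
  define y where "y i = (if i \<le> k then x i else if i = Suc k then c else x (Suc k))" for i
  have ball: "x k \<in> cball 0 R" "x (Suc k) \<in> cball 0 R" using minimizer_ball[OF min] assms by auto
  have c: "c \<in> cball 0 R"
    using segment_cball[OF ball] midpoint_in_closed_segment[of "x k" "x (Suc k)"] unfolding c_def by blast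
  have out: "x (Suc k) \<notin> \<Omega>" using m by (simp add: exit_at_def)
  have d1: "norm (c - x k) = D / 2" "norm (x (Suc k) - c) = D / 2"
    using dist_midpoint[of "x k" "x (Suc k)"] unfolding c_def D_def dist_norm
    by (auto simp: norm_minus_commute)
  have "W (x (Suc k)) = 0" using out by (simp add: W_def)
  moreover have "norm (c - x (Suc k)) = D / 2" using d1(2) by (simp add: norm_minus_commute)
  ultimately have "W c \<le> K * (D / 2)" using W_lipschitz[OF c ball(2)] by fastforce
  then have Wc: "h * W c \<le> h * (K * (D / 2))" using h by (intro mult_left_mono) auto
  have "cost h x k N \<le> cost h y k N"
    by (rule minimizer_tail[OF min]) (use assms out c minimizer_ball[OF min] in \<open>auto simp: y_def\<close>)
  moreover have "cost h x k N = cost h x k (Suc k) + cost h x (Suc k) N"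
    using assms by (intro cost_split) auto
  moreover have "cost h y k N = cost h y k (Suc k) + (cost h y (Suc k) (Suc (Suc k)) + cost h y (Suc (Suc k)) N)"
    using assms cost_split[of k "Suc k" N h y] cost_split[of "Suc k" "Suc (Suc k)" N h y] by auto
  moreover have "cost h y (Suc (Suc k)) N = 0"
    by (rule cost_outside_const[OF _ out]) (auto simp: y_def)
  moreover have "0 \<le> cost h x (Suc k) N" by (rule cost_nonneg[OF h])
  ultimately have "D\<^sup>2 / (2 * h) \<le> (D/2)\<^sup>2 / (2 * h) + ((D/2)\<^sup>2 / (2 * h) + h * W c)"
    unfolding cost_Suc D_def[symmetric] by (simp add: y_def d1)
  then have "D\<^sup>2 / (4 * h) \<le> h * (K * (D / 2))"
    using Wc by (simp add: power2_eq_square field_simps)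
  then have "D * D \<le> D * (2 * K * h\<^sup>2)" using h by (simp add: power2_eq_square field_simps)
  moreover have "0 \<le> D" by (simp add: D_def)
  ultimately show ?thesis unfolding D_def[symmetric] using K_pos
    by (cases "D = 0") auto
qed

text \<open>
  The energy varies little along a minimiser and is small somewhere: just before an early exit by
  \<open>exit_step\<close>, and otherwise because the cost is bounded while the total time \<open>h N\<close> is long.
\<close>

lemma energy_small:
  assumes min: "minimizer h N x" and m: "exit_at N x m" and C: "cost h x 0 N \<le> C" and k: "k < m"
  shows "\<bar>energy h x k\<bar> \<le> h * (K\<^sup>2 / 2 * (h * N) + 2 * K * C) + C / (h * N) + 4 * K\<^sup>2 * h\<^sup>2"
proof -
  note h = minimizer_h_pos[OF min]
  have "0 < N" using k m by (auto simp: exit_at_def)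
  then have C0: "0 \<le> C / (h * N)" using order_trans[OF cost_nonneg[OF h] C] h by simp
  have drift: "\<bar>energy h x k - energy h x j\<bar> \<le> h * (K\<^sup>2 / 2 * (h * N) + 2 * K * C)" if "j < m" for j
    using energy_drift[OF min m C, of j k] energy_drift[OF min m C, of k j] that k
    by (cases "j \<le> k") auto
  have "\<exists>j<m. \<bar>energy h x j\<bar> \<le> C / (h * N) + 4 * K\<^sup>2 * h\<^sup>2"
  proof (cases "m = N")
    case True
    show ?thesis
    proof (rule ccontr)
      assume "\<not> ?thesis"
      then have *: "C / (h * N) < \<bar>energy h x j\<bar>" if "j < N" for j
        using True that by (smt (verit) zero_le_mult_iff zero_le_power2)
      have "C = (\<Sum>j<N. h * (C / (h * N)))" using h \<open>0 < N\<close> by simp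
      also have "\<dots> < (\<Sum>j = 0..<N. (norm (x (Suc j) - x j))\<^sup>2 / (2 * h) + h * W (x j))"
        unfolding kinetic_vel[OF h] atLeast0LessThan
      proof (rule sum_strict_mono)
        fix j assume "j \<in> {..<N}"
        then have j: "j < N" "x j \<in> \<Omega>" using m True by (auto simp: exit_at_def)
        \<comment> \<open>The Lagrangian dominates the absolute value of the energy, so an energy
          above \<open>C / (h * N)\<close> at all \<open>N\<close> steps would push the cost above
          \<open>C\<close>.\<close>
        have "\<bar>energy h x j\<bar> \<le> (norm (vel h x j))\<^sup>2 / 2 + W (x j)"
          using pos[OF j(2)] j(2) by (auto simp: energy_def W_def abs_le_iff)
        then have "h * (C / (h * N)) < h * ((norm (vel h x j))\<^sup>2 / 2 + W (x j))"
          using *[OF j(1)] h by (intro mult_strict_left_mono) auto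
        then show "h * (C / (h * N)) < h * (norm (vel h x j))\<^sup>2 / 2 + h * W (x j)"
          by (simp add: distrib_left)
      qed (use \<open>0 < N\<close> in auto)
      finally show False using C by (simp add: cost_def)
    qed
  next
    case False
    obtain j where j: "m = Suc j" using k by (cases m) auto
    have jN: "Suc j < N" using False m j by (auto simp: exit_at_def)
    have step: "norm (x (Suc j) - x j) \<le> 2 * K * h\<^sup>2"
      using exit_step[OF min _ jN] m j by simp
    have "norm (vel h x j) \<le> 2 * K * h"
      using step h by (simp add: norm_vel power2_eq_square field_simps)
    then have "(norm (vel h x j))\<^sup>2 \<le> (2 * K * h)\<^sup>2" by (intro power_mono) auto
    then have 1: "(norm (vel h x j))\<^sup>2 / 2 \<le> 2 * K\<^sup>2 * h\<^sup>2" by (simp add: power_mult_distrib)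
    have dom: "x j \<in> \<Omega>" "x (Suc j) \<notin> \<Omega>" using m j by (auto simp: exit_at_def)
    have "U (x j) = \<bar>W (x j) - W (x (Suc j))\<bar>" using dom pos[of "x j"] by (simp add: W_def)
    also have "\<dots> \<le> K * norm (x j - x (Suc j))"
      using minimizer_ball[OF min] jN by (intro W_lipschitz) auto
    also have "\<dots> \<le> K * (2 * K * h\<^sup>2)"
      using step K_pos by (intro mult_left_mono) (auto simp: norm_minus_commute)
    finally have 2: "U (x j) \<le> 2 * K\<^sup>2 * h\<^sup>2" by (simp add: power2_eq_square)
    have "\<bar>energy h x j\<bar> \<le> 4 * K\<^sup>2 * h\<^sup>2"
      using 1 2 pos[OF dom(1)] zero_le_power2[of "norm (vel h x j)"] unfolding energy_def by linarith
    then show ?thesis using C0 j by (intro exI[of _ j]) auto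
  qed
  then show ?thesis using drift by fastforce
qed

section \<open>Straight competitors, descent to the boundary, and the second variation\<close>

lemma line_competitor:
  assumes min: "minimizer h N x" and M: "0 < M" "k + M \<le> N" and y: "y \<in> cball 0 R" "y \<notin> \<Omega>"
    and B: "\<And>z. z \<in> closed_segment (x k) y \<Longrightarrow> W z \<le> B"
  shows "cost h x k N \<le> (norm (y - x k))\<^sup>2 / (2 * (h * M)) + h * M * B"
proof -
  note h = minimizer_h_pos[OF min]
  \<comment> \<open>Uniform motion along the segment during time \<open>h * M\<close>, then rest at
    \<open>y\<close>, where waiting is free; clipping at \<open>1\<close> encodes both
    phases.\<close>
  define c where "c i = min 1 ((real i - real k) / M)" for i
  define w where "w i = x k + c i *\<^sub>R (y - x k)" for i
  have seg: "w i \<in> closed_segment (x k) y" if "k \<le> i" for i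
    unfolding in_segment w_def using that M by (intro exI[of _ "c i"]) (auto simp: c_def algebra_simps)
  have late: "w i = y" if "k + M \<le> i" for i
    using that M by (auto simp: w_def c_def min_def field_simps)
  have "cost h x k N \<le> cost h w k N"
  proof (rule minimizer_tail[OF min])
    show "w i \<in> cball 0 R" if "k \<le> i" for i
      using seg[OF that] segment_cball[OF minimizer_ball[OF min] y(1), of k] M by auto
  qed (use M y late in \<open>auto simp: w_def c_def\<close>)
  also have "\<dots> = cost h w k (k + M) + cost h w (k + M) N"
    using M by (intro cost_split) auto
  also have "cost h w (k + M) N = 0"
    by (rule cost_outside_const[OF _ y(2)]) (use late in auto)
  also have "cost h w k (k + M) + 0 \<le> (\<Sum>i=k..<k+M. (norm (y - x k))\<^sup>2 / (2 * h * M\<^sup>2) + h * B)"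
    unfolding cost_def add_0_right
  proof (intro sum_mono add_mono mult_left_mono)
    fix i assume i: "i \<in> {k..<k+M}"
    show "W (w i) \<le> B" using seg B i by auto
    have "c (Suc i) - c i = 1 / M"
      using i M by (auto simp: c_def min_def field_simps)
    then have "w (Suc i) - w i = (1 / M) *\<^sub>R (y - x k)"
      by (simp add: w_def flip: scaleR_diff_left)
    then have "(norm (w (Suc i) - w i))\<^sup>2 = (norm (y - x k))\<^sup>2 / M\<^sup>2"
      by (simp add: power_divide)
    then show "(norm (w (Suc i) - w i))\<^sup>2 / (2 * h) \<le> (norm (y - x k))\<^sup>2 / (2 * h * M\<^sup>2)"
      by (simp add: field_simps)
  qed (use h in auto)
  also have "\<dots> = (norm (y - x k))\<^sup>2 / (2 * (h * M)) + h * M * B"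
    using M h by (simp add: power2_eq_square field_simps)
  finally show ?thesis .
qed

text \<open>Going straight to a point of the sphere of radius \<open>R\<close> in unit time bounds
  the minimal cost independently of \<open>h\<close> and \<open>N\<close>.\<close>

lemma cost_bound:
  assumes min: "minimizer h N x" and M: "h * real M = 1" "M \<le> N"
  shows "cost h x 0 N \<le> R\<^sup>2 / 2 + 2 * K * R"
proof -
  obtain b where b: "norm b = R" "b \<notin> \<Omega>" using exists_outside by blast
  have x0: "x 0 = 0" by (rule minimizer_zero[OF min])
  have "0 < M" using M by (cases M) auto
  have "cost h x 0 N \<le> (norm (b - x 0))\<^sup>2 / (2 * (h * M)) + h * M * (2 * K * R)"
  proof (rule line_competitor[OF min \<open>0 < M\<close>])
    fix z assume "z \<in> closed_segment (x 0) b"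
    then show "W z \<le> 2 * K * R"
      using segment_cball[of "x 0" b] x0 b R_pos by (intro W_bound) auto
  qed (use b M in auto)
  then show ?thesis unfolding M by (simp add: x0 b)
qed

text \<open>The fixed direction \<open>- G q\<close> serves as descent direction: near
  \<open>q\<close> the potential falls along it at rate at least \<open>g\<^sup>2 / 2\<close>, so it
  becomes nonpositive after a length proportional to \<open>U x\<close> and never exceeds its
  initial value on the way.\<close>

lemma regular_descent:
  assumes q: "q \<in> frontier \<Omega>" and Gq: "G q \<noteq> 0"
  obtains r C where "0 < r" "0 < C"
    "\<And>x. x \<in> \<Omega> \<Longrightarrow> x \<in> ball q r \<Longrightarrow> \<exists>y. y \<in> cball 0 R \<and> y \<notin> \<Omega> \<and>
        norm (y - x) \<le> C * U x \<and> (\<forall>z\<in>closed_segment x y. W z \<le> U x)"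
proof -
  define g where "g = norm (G q)"
  have g: "0 < g" using Gq by (simp add: g_def)
  have qR: "q \<in> ball 0 R" using q closure_sub_ball by (auto simp: frontier_def)
  obtain \<rho>1 where \<rho>1: "0 < \<rho>1" "ball q \<rho>1 \<subseteq> ball 0 R"
    using openE[OF open_ball qR] by blast
  \<comment> \<open>Within this radius \<open>G\<close> differs from \<open>G q\<close> by at most
    \<open>g / 2\<close>.\<close>
  define \<rho> where "\<rho> = min \<rho>1 (g / (2 * K))"
  have \<rho>: "0 < \<rho>" using \<rho>1 g K_pos by (simp add: \<rho>_def)
  have \<rho>R: "y \<in> cball 0 R" if "y \<in> ball q \<rho>" for y using that \<rho>1(2) by (force simp: \<rho>_def)
  have low: "g\<^sup>2 / 2 \<le> G y \<bullet> G q" if y: "y \<in> ball q \<rho>" for y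
  proof -
    have "norm (G y - G q) \<le> K * norm (y - q)"
      using \<rho>R[OF y] qR by (intro G_lipschitz) auto
    also have "\<dots> \<le> K * (g / (2 * K))"
      using y K_pos by (intro mult_left_mono) (auto simp: \<rho>_def dist_norm norm_minus_commute)
    finally have "norm (G y - G q) \<le> g / 2" using K_pos by simp
    then have "norm (G y - G q) * norm (G q) \<le> g / 2 * g"
      unfolding g_def by (intro mult_right_mono) auto
    then have "\<bar>(G y - G q) \<bullet> G q\<bar> \<le> g / 2 * g"
      using Cauchy_Schwarz_ineq2[of "G y - G q" "G q"] by linarith
    moreover have "(G y - G q) \<bullet> G q = G y \<bullet> G q - g\<^sup>2"
      by (simp add: inner_diff_left g_def power2_norm_eq_inner)
    ultimately show ?thesis unfolding power2_eq_square by linarith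
  qed
  have Uq: "U q = 0" by (rule zero_frontier[OF q])
  \<comment> \<open>The second bound gives \<open>U x \<le> \<rho> * g / 8\<close>; the descent then
    has length at most \<open>\<rho> / 4\<close> and stays in the ball of radius \<rho> around
    \<open>q\<close>.\<close>
  define r where "r = min (\<rho> / 2) (\<rho> * g / (8 * K))"
  have r: "0 < r" using \<rho> g K_pos by (simp add: r_def)
  show ?thesis
  proof (rule that[OF r, of "2 / g"])
    show "0 < 2 / g" using g by simp
    fix x assume x: "x \<in> \<Omega>" "x \<in> ball q r"
    then have xq: "norm (x - q) < r" by (simp add: dist_norm norm_minus_commute)
    have Ux: "0 < U x" by (rule pos[OF x(1)])
    have "U x \<le> K * norm (x - q)"
      using U_lipschitz[of x q] x(1) sub_ball qR Uq by auto
    also have "\<dots> \<le> K * (\<rho> * g / (8 * K))"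
      using xq K_pos by (intro mult_left_mono) (auto simp: r_def)
    finally have Ux': "U x \<le> \<rho> * g / 8" using K_pos by simp
    \<comment> \<open>The parameter at which the linear upper bound for \<open>U\<close> along the
      descent reaches zero.\<close>
    define s1 where "s1 = 2 * U x / g\<^sup>2"
    have s1: "0 < s1" using Ux g by (simp add: s1_def)
    have s1g: "s1 * g = 2 / g * U x" using g by (simp add: s1_def power2_eq_square)
    have s1le: "s1 * g \<le> \<rho> / 4" unfolding s1g using Ux' g by (simp add: field_simps)
    define p where "p s = x - s *\<^sub>R G q" for s
    have pin: "p s \<in> ball q \<rho>" if "0 \<le> s" "s \<le> s1" for s
    proof -
      have "norm (p s - q) \<le> norm (x - q) + norm (s *\<^sub>R G q)"
        using norm_triangle_ineq4[of "x - q" "s *\<^sub>R G q"] by (simp add: p_def algebra_simps)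
      also have "\<dots> \<le> norm (x - q) + s1 * g"
        using that g by (auto simp: g_def intro!: mult_right_mono)
      also have "\<dots> < \<rho> / 2 + \<rho> / 4" using xq s1le by (simp add: r_def)
      finally show ?thesis using \<rho> by (simp add: dist_norm norm_minus_commute)
    qed
    have dec: "U (p s) \<le> U x - s * g\<^sup>2 / 2" if s: "0 \<le> s" "s \<le> s1" for s
    proof -
      have "U (p s) + s * g\<^sup>2 / 2 \<le> U (p 0) + 0 * g\<^sup>2 / 2"
      proof (rule DERIV_nonpos_imp_nonincreasing[OF s(1)])
        fix t assume t: "0 \<le> t" "t \<le> s"
        have "((\<lambda>t. U (p t) + t * g\<^sup>2 / 2) has_real_derivative (- (G (p t) \<bullet> G q) + g\<^sup>2 / 2)) (at t)"
          unfolding has_field_derivative_def p_def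
          by (rule derivative_eq_intros has_derivative_compose[OF _ dU] refl)+
             (auto simp: algebra_simps)
        then show "\<exists>y. ((\<lambda>t. U (p t) + t * g\<^sup>2 / 2) has_real_derivative y) (at t) \<and> y \<le> 0"
          using low[OF pin[of t]] t s by (intro exI conjI) auto
      qed
      then show ?thesis by (simp add: p_def)
    qed
    have "U (p s1) \<le> 0" using dec[of s1] s1 g by (simp add: s1_def)
    then have out: "p s1 \<notin> \<Omega>" using pos[of "p s1"] by auto
    have "norm (p s1 - x) \<le> 2 / g * U x" using s1 s1g by (simp add: p_def g_def)
    moreover have "W z \<le> U x" if "z \<in> closed_segment x (p s1)" for z
    proof -
      obtain u where u: "0 \<le> u" "u \<le> 1" "z = (1 - u) *\<^sub>R x + u *\<^sub>R p s1"
        using \<open>z \<in> closed_segment x (p s1)\<close> by (auto simp: in_segment)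
      then have "z = p (u * s1)" by (simp add: p_def algebra_simps)
      moreover have "U (p (u * s1)) \<le> U x - u * s1 * g\<^sup>2 / 2"
        using u s1 by (intro dec) (auto simp: mult_left_le_one_le)
      moreover have "0 \<le> u * s1 * g\<^sup>2 / 2" using u s1 by simp
      ultimately show ?thesis using Ux by (intro W_le) auto
    qed
    moreover have "p s1 \<in> cball 0 R" using \<rho>R[OF pin[of s1]] s1 by simp
    ultimately show "\<exists>y. y \<in> cball 0 R \<and> y \<notin> \<Omega> \<and> norm (y - x) \<le> 2 / g * U x \<and>
        (\<forall>z\<in>closed_segment x y. W z \<le> U x)"
      using out by blast
  qed
qed

text \<open>
  Second variation: a tent of width \<open>4 M h\<close> in a direction of negative curvature lowers the cost
  once \<open>(h M)\<^sup>2\<close> exceeds \<open>1 / \<mu>\<close>.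
\<close>

lemma tent_variation:
  assumes min: "minimizer h N x" and m: "exit_at N x m"
    and M: "0 < M" "a + 4 * M < m" and e: "norm e = 1" and \<epsilon>: "0 < \<epsilon>"
    and concave: "\<And>k s. a \<le> k \<Longrightarrow> k \<le> a + 4 * M \<Longrightarrow> 0 \<le> s \<Longrightarrow> s \<le> 2 * \<epsilon> * (h * M) \<Longrightarrow>
        x k + s *\<^sub>R e \<in> \<Omega> \<and> U (x k + s *\<^sub>R e) \<le> U (x k) + s * (G (x k) \<bullet> e) - \<mu> * s\<^sup>2"
    and \<mu>: "0 < \<mu>"
  shows "\<mu> * (h * M)\<^sup>2 \<le> 1"
proof -
  note h = minimizer_h_pos[OF min]
  define b where "b = a + 4 * M"
  \<comment> \<open>A tent of slope \<epsilon> in time, with peak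
    \<open>2 * \<epsilon> * (h * M)\<close> at index \<open>a + 2 * M\<close>.\<close>
  define s where "s k = \<epsilon> * h * min (real k - real a) (real b - real k)" for k
  define c where "c k = vel h x k \<bullet> e" for k
  define g where "g k = G (x k) \<bullet> e" for k
  define y where "y k = x k + s k *\<^sub>R e" for k
  have bN: "b < N" "b < m" using M m by (auto simp: b_def exit_at_def)
  have ab: "a \<le> b" by (simp add: b_def)
  have sa: "s a = 0" and sb: "s b = 0" by (auto simp: s_def b_def)
  have s0: "0 \<le> s k" if "a \<le> k" "k \<le> b" for k using that h \<epsilon> by (simp add: s_def)
  have s1: "s k \<le> 2 * \<epsilon> * (h * M)" if "a \<le> k" "k \<le> b" for k
  proof -
    have "min (real k - real a) (real b - real k) \<le> 2 * real M" by (auto simp: b_def)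
    then have "\<epsilon> * h * min (real k - real a) (real b - real k) \<le> \<epsilon> * h * (2 * real M)"
      using \<epsilon> h by (intro mult_left_mono) auto
    then show ?thesis by (simp add: s_def mult_ac)
  qed
  have dom: "x k \<in> \<Omega>" if "k \<le> b" for k using that bN m by (auto simp: exit_at_def)
  have conc: "y k \<in> \<Omega>" "U (y k) \<le> U (x k) + s k * g k - \<mu> * (s k)\<^sup>2" if "a \<le> k" "k \<le> b" for k
    using concave[OF that(1) _ s0[OF that] s1[OF that]] that by (auto simp: y_def b_def g_def)
  have "cost h x a b \<le> cost h y a b"
  proof (rule minimizer_splice[OF min])
    show "y k \<in> cball 0 R" if "a \<le> k" "k \<le> b" for k using conc[OF that] sub_ball by blast
  qed (use bN ab in \<open>auto simp: y_def sa sb\<close>)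
  moreover have "cost h y a b - cost h x a b \<le>
      (\<Sum>k=a..<b. ((s (Suc k) - s k) * c k + h * (s k * g k)) + ((s (Suc k) - s k)\<^sup>2 / (2 * h) - h * \<mu> * (s k)\<^sup>2))"
    unfolding cost_def sum_subtractf[symmetric]
  proof (rule sum_mono)
    fix k assume k: "k \<in> {a..<b}"
    have dy: "y (Suc k) - y k = (x (Suc k) - x k) + (s (Suc k) - s k) *\<^sub>R e"
      by (simp add: y_def algebra_simps)
    have ck: "(x (Suc k) - x k) \<bullet> e = h * c k"
      using h by (simp add: c_def vel_def)
    have "(norm (y (Suc k) - y k))\<^sup>2 =
        (norm (x (Suc k) - x k))\<^sup>2 + 2 * (s (Suc k) - s k) * ((x (Suc k) - x k) \<bullet> e) + (s (Suc k) - s k)\<^sup>2 * (norm e)\<^sup>2"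
      unfolding dy power2_norm_eq_inner
      by (simp only: inner_add_left inner_add_right inner_scaleR_left inner_scaleR_right
          inner_commute[of e "x (Suc k) - x k"]) (simp add: power2_eq_square algebra_simps)
    then have kin: "(norm (y (Suc k) - y k))\<^sup>2 / (2 * h) =
        (norm (x (Suc k) - x k))\<^sup>2 / (2 * h) + (s (Suc k) - s k) * c k + (s (Suc k) - s k)\<^sup>2 / (2 * h)"
      using h unfolding ck e by (simp add: field_simps)
    have "W (y k) \<le> W (x k) + s k * g k - \<mu> * (s k)\<^sup>2"
      using conc[of k] dom[of k] k by (simp add: W_def)
    then have "h * W (y k) \<le> h * (W (x k) + s k * g k - \<mu> * (s k)\<^sup>2)"
      using h by (intro mult_left_mono) auto
    then show "(norm (y (Suc k) - y k))\<^sup>2 / (2 * h) + h * W (y k) -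
        ((norm (x (Suc k) - x k))\<^sup>2 / (2 * h) + h * W (x k))
        \<le> ((s (Suc k) - s k) * c k + h * (s k * g k)) + ((s (Suc k) - s k)\<^sup>2 / (2 * h) - h * \<mu> * (s k)\<^sup>2)"
      unfolding kin by (simp add: algebra_simps)
  qed
  \<comment> \<open>Summation by parts: the first variation vanishes by the Euler-Lagrange equation,
    because the tent is zero at both ends.\<close>
  moreover have "(\<Sum>k=a..<b. (s (Suc k) - s k) * c k + h * (s k * g k)) = 0"
  proof -
    have parts: "(\<Sum>k=a..<j. (s (Suc k) - s k) * c k + h * (s k * g k)) = s j * c j - h * (s j * g j)"
      if "a \<le> j" "j \<le> b" for j
      using that
    proof (induction j rule: dec_induct)
      case base
      then show ?case by (simp add: sa)
    next
      case (step j)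
      have "c (Suc j) = c j + h * g (Suc j)"
        using euler_lagrange[OF min, of j] dom[of "Suc j"] step bN
        by (simp add: c_def g_def inner_add_left)
      then show ?case using step by (simp add: algebra_simps)
    qed
    show ?thesis using parts[OF ab] by (simp add: sb)
  qed
  ultimately have le: "0 \<le> (\<Sum>k=a..<b. (s (Suc k) - s k)\<^sup>2 / (2 * h) - h * \<mu> * (s k)\<^sup>2)"
    by (simp add: sum.distrib)
  have "(\<Sum>k=a..<b. (s (Suc k) - s k)\<^sup>2 / (2 * h)) \<le> (\<Sum>k=a..<b. \<epsilon>\<^sup>2 * h / 2)"
  proof (rule sum_mono)
    fix k assume k: "k \<in> {a..<b}"
    have "min (real (Suc k) - real a) (real b - real (Suc k)) - min (real k - real a) (real b - real k) \<in> {-1..1}"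
      by auto
    then have "\<bar>min (real (Suc k) - real a) (real b - real (Suc k)) - min (real k - real a) (real b - real k)\<bar> \<le> 1"
      by (simp only: atLeastAtMost_iff abs_le_iff) auto
    then have "\<bar>s (Suc k) - s k\<bar> \<le> \<epsilon> * h"
      unfolding s_def right_diff_distrib[symmetric] abs_mult using h \<epsilon> by (simp add: mult_left_le)
    then have "(s (Suc k) - s k)\<^sup>2 \<le> (\<epsilon> * h)\<^sup>2" by (rule power2_le_iff_abs_le[THEN iffD2, rotated]) (use h \<epsilon> in auto)
    then show "(s (Suc k) - s k)\<^sup>2 / (2 * h) \<le> \<epsilon>\<^sup>2 * h / 2"
      using h by (simp add: power2_eq_square field_simps)
  qed
  also have "\<dots> = 2 * M * \<epsilon>\<^sup>2 * h" by (simp add: b_def)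
  finally have le1: "(\<Sum>k=a..<b. (s (Suc k) - s k)\<^sup>2 / (2 * h)) \<le> 2 * M * \<epsilon>\<^sup>2 * h" .
  \<comment> \<open>On the middle \<open>2 * M\<close> indices the tent has at least half its peak
    height. Both this gain and the kinetic price \<open>2 * M * \<epsilon>\<^sup>2 * h\<close> are
    quadratic in \<epsilon>, which therefore cancels.\<close>
  have "2 * M * (h * \<mu> * (\<epsilon> * h * M)\<^sup>2) = (\<Sum>k=a+M..<a+3*M. h * \<mu> * (\<epsilon> * h * M)\<^sup>2)"
    by simp
  also have "\<dots> \<le> (\<Sum>k=a+M..<a+3*M. h * \<mu> * (s k)\<^sup>2)"
  proof (rule sum_mono)
    fix k assume k: "k \<in> {a+M..<a+3*M}"
    have "\<epsilon> * h * M \<le> s k"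
      unfolding s_def using k h \<epsilon> by (intro mult_left_mono) (auto simp: b_def)
    then show "h * \<mu> * (\<epsilon> * h * M)\<^sup>2 \<le> h * \<mu> * (s k)\<^sup>2"
      using h \<epsilon> \<mu> by (intro mult_left_mono power_mono) auto
  qed
  also have "\<dots> \<le> (\<Sum>k=a..<b. h * \<mu> * (s k)\<^sup>2)"
    using h \<mu> by (intro sum_mono2) (auto simp: b_def)
  finally have "2 * M * (h * \<mu> * (\<epsilon> * h * M)\<^sup>2) \<le> 2 * M * \<epsilon>\<^sup>2 * h"
    using le le1 by (simp add: sum_subtractf)
  then have "(2 * M * \<epsilon>\<^sup>2 * h) * (\<mu> * (h * M)\<^sup>2) \<le> (2 * M * \<epsilon>\<^sup>2 * h) * 1"
    by (simp add: power_mult_distrib mult_ac)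
  moreover have "0 < 2 * M * \<epsilon>\<^sup>2 * h" using M \<epsilon> h by simp
  ultimately show ?thesis by (simp only: mult_le_cancel_left_pos)
qed

end

section \<open>Limits of Euler polygons\<close>

lemma grid_le:
  fixes h t :: real
  assumes "0 < h" "0 \<le> t"
  shows "h * real (nat \<lfloor>t / h\<rfloor>) \<le> t" "t - h \<le> h * real (nat \<lfloor>t / h\<rfloor>)"
proof -
  have "real (nat \<lfloor>t / h\<rfloor>) = of_int \<lfloor>t / h\<rfloor>" using assms by simp
  then have "real (nat \<lfloor>t / h\<rfloor>) \<le> t / h" "t / h - 1 \<le> real (nat \<lfloor>t / h\<rfloor>)" by linarith+
  then show "h * real (nat \<lfloor>t / h\<rfloor>) \<le> t" "t - h \<le> h * real (nat \<lfloor>t / h\<rfloor>)"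
    using assms(1) by (simp_all add: field_simps)
qed

lemma grid_tendsto:
  fixes h :: "nat \<Rightarrow> real"
  assumes "\<And>n. 0 < h n" "h \<longlonglongrightarrow> 0" "0 \<le> t"
  shows "(\<lambda>n. h n * real (nat \<lfloor>t / h n\<rfloor>)) \<longlonglongrightarrow> t"
proof (rule tendsto_sandwich[of "\<lambda>n. t - h n" _ _ "\<lambda>n. t"])
  show "(\<lambda>n. t - h n) \<longlonglongrightarrow> t" using tendsto_diff[OF tendsto_const assms(2), of t] by simp
qed (use grid_le[OF assms(1,3)] in auto)

text \<open>An Arzela-Ascoli argument: convergence at rational times by a diagonal subsequence,
  extended to all times by the uniform Lipschitz bound. The polygons are controlled only up to index
  \<open>m n\<close>, hence only for times below \<open>T\<close>. The differential equation is
  recorded as a quadratic estimate, a form that passes to pointwise limits.\<close>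

lemma euler_polygon_limit:
  fixes z :: "nat \<Rightarrow> nat \<Rightarrow> 'b::euclidean_space" and F :: "'b \<Rightarrow> 'b"
  assumes h: "\<And>n. 0 < h n" "h \<longlonglongrightarrow> 0"
    and m: "(\<lambda>n. ereal (h n * real (m n))) \<longlonglongrightarrow> T"
    and Z: "closed Z" "\<And>w. w \<in> Z \<Longrightarrow> norm w \<le> B" "\<And>n k. k < m n \<Longrightarrow> z n k \<in> Z"
    and F: "\<And>w. w \<in> Z \<Longrightarrow> norm (F w) \<le> A"
      "\<And>w w'. w \<in> Z \<Longrightarrow> w' \<in> Z \<Longrightarrow> norm (F w - F w') \<le> L * norm (w - w')" "0 \<le> L"
    and euler: "\<And>n k. Suc k < m n \<Longrightarrow> norm (z n (Suc k) - z n k - h n *\<^sub>R F (z n k)) \<le> h n * \<eta> n"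
    and \<eta>: "\<eta> \<longlonglongrightarrow> 0"
  obtains r \<zeta> M where "strict_mono (r :: nat \<Rightarrow> nat)" "0 < M"
    "\<And>t k. 0 \<le> t \<Longrightarrow> ereal t < T \<Longrightarrow> (\<lambda>n. h (r n) * real (k n)) \<longlonglongrightarrow> t \<Longrightarrow> (\<lambda>n. z (r n) (k n)) \<longlonglongrightarrow> \<zeta> t"
    "\<And>t. 0 \<le> t \<Longrightarrow> ereal t < T \<Longrightarrow> \<zeta> t \<in> Z"
    "\<And>s t. 0 \<le> s \<Longrightarrow> s \<le> t \<Longrightarrow> ereal t < T \<Longrightarrow> norm (\<zeta> t - \<zeta> s) \<le> M * (t - s)"
    "\<And>s t. 0 \<le> s \<Longrightarrow> s \<le> t \<Longrightarrow> ereal t < T \<Longrightarrow>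
        norm (\<zeta> t - \<zeta> s - (t - s) *\<^sub>R F (\<zeta> s)) \<le> L * M * (t - s)\<^sup>2"
proof -
  obtain H0 where H0: "\<And>n. norm (\<eta> n) \<le> H0"
    using convergent_imp_Bseq[OF convergentI[OF \<eta>]] by (auto simp: Bseq_def)
  \<comment> \<open>A bound for the speed of the polygons: the bound of the field plus that of the
    errors, with \<open>1\<close> added for positivity.\<close>
  define M where "M = 1 + \<bar>A\<bar> + H0"
  have M: "0 < M" using H0[of 0] norm_ge_zero[of "\<eta> 0"] unfolding M_def by linarith
  have lip_up: "norm (z n k - z n j) \<le> M * (h n * (real k - real j))" if "j \<le> k" "k < m n" for n j k
    using that
  proof (induction k rule: dec_induct)
    case (step k)
    have "norm (z n (Suc k) - z n k) \<le> norm (z n (Suc k) - z n k - h n *\<^sub>R F (z n k)) + norm (h n *\<^sub>R F (z n k))"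
      using norm_triangle_ineq[of "z n (Suc k) - z n k - h n *\<^sub>R F (z n k)" "h n *\<^sub>R F (z n k)"] by simp
    also have "\<dots> \<le> h n * \<eta> n + h n * A"
      using euler[of k n] F(1)[OF Z(3), of k n] h(1)[of n] step by (intro add_mono) auto
    also have "\<dots> \<le> h n * M"
      unfolding distrib_left[symmetric] M_def using h(1)[of n] H0[of n]
      by (intro mult_left_mono) auto
    finally have "norm (z n (Suc k) - z n k) \<le> h n * M" .
    moreover have "norm (z n (Suc k) - z n j) \<le> norm (z n (Suc k) - z n k) + norm (z n k - z n j)"
      using norm_triangle_ineq[of "z n (Suc k) - z n k" "z n k - z n j"] by simp
    ultimately show ?case using step by (simp add: algebra_simps)
  qed simp
  have lip: "norm (z n k - z n j) \<le> M * \<bar>h n * real k - h n * real j\<bar>" if "j < m n" "k < m n" for n j k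
  proof -
    have "\<bar>h n * real k - h n * real j\<bar> = h n * \<bar>real k - real j\<bar>"
      using h(1)[of n] by (simp add: abs_mult flip: right_diff_distrib)
    then show ?thesis
      using lip_up[of j k n] lip_up[of k j n] that by (cases "j \<le> k") (auto simp: norm_minus_commute)
  qed
  \<comment> \<open>The field is frozen at the starting index \<open>j\<close>; up to index
    \<open>k\<close> it changes by at most \<open>L * M\<close> times the elapsed time.\<close>
  have quad: "norm (z n k - z n j - (h n * (real k - real j)) *\<^sub>R F (z n j)) \<le>
      h n * (real k - real j) * (L * M * (h n * (real k - real j)) + \<eta> n)" if "j \<le> k" "k < m n" for n j k
    using that
  proof (induction k rule: dec_induct)
    case (step k)
    let ?d = "h n * (real k - real j)"
    have hd: "0 < h n" "0 \<le> ?d" using h(1)[of n] step by auto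
    have "norm (h n *\<^sub>R F (z n k) - h n *\<^sub>R F (z n j)) \<le> h n * (L * norm (z n k - z n j))"
      using F(2)[of "z n k" "z n j"] Z(3)[of _ n] step hd
      by (simp flip: scaleR_diff_right)
    also have "\<dots> \<le> h n * (L * (M * ?d))"
      using lip_up[of j k n] step hd F(3) by (intro mult_left_mono) auto
    finally have 1: "norm (h n *\<^sub>R F (z n k) - h n *\<^sub>R F (z n j)) \<le> h n * (L * (M * ?d))" .
    have 2: "norm (z n (Suc k) - z n k - h n *\<^sub>R F (z n k)) \<le> h n * \<eta> n"
      using euler step by auto
    have 3: "norm (z n k - z n j - ?d *\<^sub>R F (z n j)) \<le> ?d * (L * M * ?d + \<eta> n)"
      using step by auto
    have "z n (Suc k) - z n j - (h n * (real (Suc k) - real j)) *\<^sub>R F (z n j) =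
        (z n k - z n j - ?d *\<^sub>R F (z n j)) + ((z n (Suc k) - z n k - h n *\<^sub>R F (z n k)) +
        (h n *\<^sub>R F (z n k) - h n *\<^sub>R F (z n j)))" by (simp add: algebra_simps)
    also have "norm \<dots> \<le> ?d * (L * M * ?d + \<eta> n) + (h n * \<eta> n + h n * (L * (M * ?d)))"
      by (intro norm_triangle_le add_mono 1 2 3)
    also have "\<dots> \<le> (?d + h n) * (L * M * (?d + h n) + \<eta> n)"
    proof -
      have "0 \<le> L * M * (h n * (?d + h n))" using hd F(3) M by simp
      moreover have "(d + h n) * (L * M * (d + h n) + \<eta> n) =
          d * (L * M * d + \<eta> n) + (h n * \<eta> n + h n * (L * (M * d))) + L * M * (h n * (d + h n))" for d
        by (simp add: algebra_simps)
      ultimately show ?thesis by simp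
    qed
    finally show ?case by (simp add: algebra_simps)
  qed simp
  define \<kappa> where "\<kappa> n t = nat \<lfloor>t / h n\<rfloor>" for n t
  have \<kappa>_lim: "(\<lambda>n. h n * \<kappa> n t) \<longlonglongrightarrow> t" if "0 \<le> t" for t
    unfolding \<kappa>_def by (rule grid_tendsto[OF h that])
  have sub: "\<forall>\<^sub>F n in sequentially. k n < m (r n)"
    if r: "strict_mono r" and k: "(\<lambda>n. h (r n) * real (k n)) \<longlonglongrightarrow> t" and t: "ereal t < T" for r k t
  proof -
    obtain c where c: "ereal t < c" "c < T" using dense t by blast
    have "(\<lambda>n. ereal (h (r n) * real (m (r n)))) \<longlonglongrightarrow> T"
      using LIMSEQ_subseq_LIMSEQ[OF m r] by (simp add: o_def)
    then have "\<forall>\<^sub>F n in sequentially. c < ereal (h (r n) * real (m (r n)))"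
      using c by (rule_tac order_tendstoD(1)) auto
    moreover have "\<forall>\<^sub>F n in sequentially. ereal (h (r n) * real (k n)) < c"
      using c k by (intro order_tendstoD(2)[of _ "ereal t"]) auto
    ultimately show ?thesis
    proof eventually_elim
      case (elim n)
      then have "ereal (h (r n) * real (k n)) < ereal (h (r n) * real (m (r n)))" by order
      then show ?case using h(1)[of "r n"] by simp
    qed
  qed
  \<comment> \<open>The default \<open>0\<close> past the exit keeps a uniform bound; for
    nonnegative \<open>q\<close> below \<open>T\<close> it occurs for finitely many \<open>n\<close>
    only.\<close>
  define f where "f n q = (if \<kappa> n q < m n then z n (\<kappa> n q) else 0)" for n q
  have fB: "norm (f n q) \<le> \<bar>B\<bar>" for n q
    using Z(2)[OF Z(3), of "\<kappa> n q" n] by (auto simp: f_def)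
  obtain r where r: "strict_mono (r :: nat \<Rightarrow> nat)" "\<And>q. q \<in> \<rat> \<Longrightarrow> \<exists>l. (\<lambda>n. f (r n) q) \<longlonglongrightarrow> l"
  proof (rule function_convergent_subsequence[of \<rat> f "\<bar>B\<bar>"])
    show "countable (\<rat> :: real set)" by (rule countable_rat)
  qed (use fB in blast)+
  have hr: "(\<lambda>n. h (r n)) \<longlonglongrightarrow> 0" using LIMSEQ_subseq_LIMSEQ[OF h(2) r(1)] by (simp add: o_def)
  have \<kappa>r: "(\<lambda>n. h (r n) * \<kappa> (r n) t) \<longlonglongrightarrow> t" if "0 \<le> t" for t
    using LIMSEQ_subseq_LIMSEQ[OF \<kappa>_lim[OF that] r(1)] by (simp add: o_def)
  have conv: "convergent (\<lambda>n. z (r n) (\<kappa> (r n) t))" if t: "0 \<le> t" "ereal t < T" for t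
  proof (rule Cauchy_convergent, rule metric_CauchyI)
    fix e :: real assume e: "0 < e"
    obtain t' where t': "t < t'" "ereal t' < T"
      using ereal_dense2[OF t(2)] by auto
    \<comment> \<open>A rational time below \<open>t''\<close> transfers convergence to
      \<open>t\<close>: by the Lipschitz bound the gap costs less than \<open>e / 4\<close>.\<close>
    define t'' where "t'' = min t' (t + e / (4 * M))"
    have "t < t''" using t' e M by (simp add: t''_def)
    then obtain q where q: "q \<in> \<rat>" "t < q" "q < t''" using Rats_dense_in_real by blast
    have qT: "ereal q < T"
      by (rule less_trans[OF _ t'(2)]) (use q(3) in \<open>simp add: t''_def\<close>)
    have q0: "0 \<le> q" using q t by simp
    have qe: "M * (q - t) < e / 4"
      using q M unfolding t''_def by (simp add: field_simps)
    obtain l where l: "(\<lambda>n. f (r n) q) \<longlonglongrightarrow> l" using r(2) q(1) by blast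
    have "(\<lambda>n. M * \<bar>h (r n) * \<kappa> (r n) t - h (r n) * \<kappa> (r n) q\<bar>) \<longlonglongrightarrow> M * \<bar>t - q\<bar>"
      using t q0 by (intro tendsto_intros \<kappa>r) auto
    then have "\<forall>\<^sub>F n in sequentially. M * \<bar>h (r n) * \<kappa> (r n) t - h (r n) * \<kappa> (r n) q\<bar> < e / 4"
      by (rule order_tendstoD(2)) (use qe q in auto)
    moreover have "\<forall>\<^sub>F n in sequentially. \<kappa> (r n) t < m (r n)"
      by (rule sub[OF r(1) \<kappa>r[OF t(1)] t(2)])
    moreover have "\<forall>\<^sub>F n in sequentially. \<kappa> (r n) q < m (r n)"
      by (rule sub[OF r(1) \<kappa>r[OF q0] qT])
    moreover have "\<forall>\<^sub>F n in sequentially. dist (f (r n) q) l < e / 4"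
      using e by (intro tendstoD[OF l]) auto
    ultimately have "\<forall>\<^sub>F n in sequentially. dist (z (r n) (\<kappa> (r n) t)) l < e / 2"
    proof eventually_elim
      case (elim n)
      have "dist (z (r n) (\<kappa> (r n) t)) (z (r n) (\<kappa> (r n) q)) < e / 4"
        using lip[OF elim(3,2)] elim(1) by (simp add: dist_norm)
      then show ?case using elim dist_triangle[of "z (r n) (\<kappa> (r n) t)" l "z (r n) (\<kappa> (r n) q)"]
        by (simp add: f_def)
    qed
    then obtain n0 where n0: "\<And>n. n0 \<le> n \<Longrightarrow> dist (z (r n) (\<kappa> (r n) t)) l < e / 2"
      by (auto simp: eventually_sequentially)
    show "\<exists>N. \<forall>n\<ge>N. \<forall>n'\<ge>N. dist (z (r n) (\<kappa> (r n) t)) (z (r n') (\<kappa> (r n') t)) < e"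
      using n0 dist_triangle_half_l by blast
  qed
  define \<zeta> where "\<zeta> t = lim (\<lambda>n. z (r n) (\<kappa> (r n) t))" for t
  have \<zeta>0: "(\<lambda>n. z (r n) (\<kappa> (r n) t)) \<longlonglongrightarrow> \<zeta> t" if "0 \<le> t" "ereal t < T" for t
    using conv[OF that] unfolding \<zeta>_def by (simp add: convergent_LIMSEQ_iff)
  have \<zeta>Z: "\<zeta> t \<in> Z" if t: "0 \<le> t" "ereal t < T" for t
  proof (rule Lim_in_closed_set[OF Z(1) _ _ \<zeta>0[OF t]])
    show "\<forall>\<^sub>F n in sequentially. z (r n) (\<kappa> (r n) t) \<in> Z"
      using sub[OF r(1) \<kappa>r[OF t(1)] t(2)] by eventually_elim (rule Z(3))
  qed simp
  have mono: "\<kappa> n s \<le> \<kappa> n t" if "s \<le> t" for n s t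
    unfolding \<kappa>_def using that h(1)[of n] by (intro nat_mono floor_mono divide_right_mono) auto
  have F_lim: "(\<lambda>n. F (z (r n) (\<kappa> (r n) t))) \<longlonglongrightarrow> F (\<zeta> t)" if t: "0 \<le> t" "ereal t < T" for t
  proof (rule continuous_on_tendsto_compose[of Z F])
    show "continuous_on Z F"
      by (rule lipschitz_on_continuous_on[OF lipschitz_onI[of Z F L]]) (use F in \<open>auto simp: dist_norm\<close>)
    show "\<forall>\<^sub>F n in sequentially. z (r n) (\<kappa> (r n) t) \<in> Z"
      using sub[OF r(1) \<kappa>r[OF t(1)] t(2)] by eventually_elim (rule Z(3))
  qed (use \<zeta>0 \<zeta>Z t in auto)
  show ?thesis
  proof (rule that[OF r(1) M])
    fix t k assume t: "0 \<le> t" "ereal t < T" and k: "(\<lambda>n. h (r n) * real (k n)) \<longlonglongrightarrow> t"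
    have "(\<lambda>n. M * \<bar>h (r n) * real (k n) - h (r n) * \<kappa> (r n) t\<bar>) \<longlonglongrightarrow> M * \<bar>t - t\<bar>"
      using t by (intro tendsto_intros \<kappa>r k) auto
    then have "(\<lambda>n. M * \<bar>h (r n) * real (k n) - h (r n) * \<kappa> (r n) t\<bar>) \<longlonglongrightarrow> 0" by simp
    moreover have "\<forall>\<^sub>F n in sequentially. norm (z (r n) (k n) - z (r n) (\<kappa> (r n) t)) \<le>
        M * \<bar>h (r n) * real (k n) - h (r n) * \<kappa> (r n) t\<bar>"
      using sub[OF r(1) \<kappa>r[OF t(1)] t(2)] sub[OF r(1) k t(2)]
      by eventually_elim (rule lip)
    ultimately have "(\<lambda>n. z (r n) (k n) - z (r n) (\<kappa> (r n) t)) \<longlonglongrightarrow> 0"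
      by (rule Lim_null_comparison[rotated])
    from tendsto_add[OF this \<zeta>0[OF t]] show "(\<lambda>n. z (r n) (k n)) \<longlonglongrightarrow> \<zeta> t" by simp
  next
    fix s t assume st: "0 \<le> s" "s \<le> t" "ereal t < T"
    have t: "0 \<le> t" using st by simp
    have s: "ereal s < T" by (rule order_le_less_trans[OF _ st(3)]) (use st in simp)
    have ev: "\<forall>\<^sub>F n in sequentially. \<kappa> (r n) t < m (r n)"
      by (rule sub[OF r(1) \<kappa>r[OF t] st(3)])
    show "norm (\<zeta> t - \<zeta> s) \<le> M * (t - s)"
    proof (rule tendsto_le[OF sequentially_bot])
      show "(\<lambda>n. M * (h (r n) * \<kappa> (r n) t - h (r n) * \<kappa> (r n) s)) \<longlonglongrightarrow> M * (t - s)"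
        using st t by (intro tendsto_intros \<kappa>r)
      show "(\<lambda>n. norm (z (r n) (\<kappa> (r n) t) - z (r n) (\<kappa> (r n) s))) \<longlonglongrightarrow> norm (\<zeta> t - \<zeta> s)"
        using st t s by (intro tendsto_intros \<zeta>0)
      show "\<forall>\<^sub>F n in sequentially. norm (z (r n) (\<kappa> (r n) t) - z (r n) (\<kappa> (r n) s)) \<le>
          M * (h (r n) * \<kappa> (r n) t - h (r n) * \<kappa> (r n) s)"
        using ev by eventually_elim (use lip_up mono[OF st(2)] in \<open>auto simp: right_diff_distrib\<close>)
    qed
    have \<eta>r: "(\<lambda>n. \<eta> (r n)) \<longlonglongrightarrow> 0" using LIMSEQ_subseq_LIMSEQ[OF \<eta> r(1)] by (simp add: o_def)
    have "norm (\<zeta> t - \<zeta> s - (t - s) *\<^sub>R F (\<zeta> s)) \<le> (t - s) * (L * M * (t - s) + 0)"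
    proof (rule tendsto_le[OF sequentially_bot])
      let ?d = "\<lambda>n. h (r n) * \<kappa> (r n) t - h (r n) * \<kappa> (r n) s"
      show "(\<lambda>n. ?d n * (L * M * ?d n + \<eta> (r n))) \<longlonglongrightarrow> (t - s) * (L * M * (t - s) + 0)"
        using st t by (intro tendsto_intros \<kappa>r \<eta>r)
      show "(\<lambda>n. norm (z (r n) (\<kappa> (r n) t) - z (r n) (\<kappa> (r n) s) - ?d n *\<^sub>R F (z (r n) (\<kappa> (r n) s))))
          \<longlonglongrightarrow> norm (\<zeta> t - \<zeta> s - (t - s) *\<^sub>R F (\<zeta> s))"
        using st t s by (intro tendsto_intros \<zeta>0 F_lim \<kappa>r)
      show "\<forall>\<^sub>F n in sequentially. norm (z (r n) (\<kappa> (r n) t) - z (r n) (\<kappa> (r n) s) - ?d n *\<^sub>R F (z (r n) (\<kappa> (r n) s)))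
          \<le> ?d n * (L * M * ?d n + \<eta> (r n))"
        using ev by eventually_elim (use quad[OF mono[OF st(2)]] in \<open>auto simp: right_diff_distrib\<close>)
    qed
    then show "norm (\<zeta> t - \<zeta> s - (t - s) *\<^sub>R F (\<zeta> s)) \<le> L * M * (t - s)\<^sup>2"
      by (simp add: power2_eq_square mult_ac)
  qed (rule \<zeta>Z)
qed

lemma has_vector_derivative_quadratic:
  fixes \<zeta> :: "real \<Rightarrow> 'b::euclidean_space"
  assumes t: "a < t" "t < b"
    and q: "\<And>s. a < s \<Longrightarrow> s < b \<Longrightarrow> norm (\<zeta> s - \<zeta> t - (s - t) *\<^sub>R D) \<le> C * (s - t)\<^sup>2"
  shows "(\<zeta> has_vector_derivative D) (at t)"
  unfolding has_vector_derivative_def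
proof (rule has_derivativeI_sandwich[of "min (t - a) (b - t)" _ _ _ _ "\<lambda>s. C * \<bar>s - t\<bar>"])
  show "0 < min (t - a) (b - t)" using t by simp
  show "bounded_linear (\<lambda>x. x *\<^sub>R D)" by (rule bounded_linear_scaleR_left)
  have "((\<lambda>s. C * \<bar>s - t\<bar>) \<longlongrightarrow> C * \<bar>t - t\<bar>) (at t)" by (intro tendsto_intros)
  then show "((\<lambda>s. C * \<bar>s - t\<bar>) \<longlongrightarrow> 0) (at t)" by simp
  fix s assume s: "s \<noteq> t" "dist s t < min (t - a) (b - t)"
  then have "norm (\<zeta> s - \<zeta> t - (s - t) *\<^sub>R D) \<le> C * (\<bar>s - t\<bar> * \<bar>s - t\<bar>)"
    using q[of s] by (auto simp: dist_real_def power2_eq_square abs_less_iff)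
  then show "norm (\<zeta> s - \<zeta> t - (s - t) *\<^sub>R D) / norm (s - t) \<le> C * \<bar>s - t\<bar>"
    using s by (simp add: field_simps)
qed

text \<open>For \<open>s < t\<close> the estimate is based at \<open>s\<close>; the Lipschitz bound moves the base point to \<open>t\<close>.\<close>

lemma quadratic_estimate_derivative:
  fixes \<zeta> :: "real \<Rightarrow> 'b::euclidean_space" and F :: "'b \<Rightarrow> 'b"
  assumes t: "0 < t" "ereal t < T" and LM: "0 \<le> L" "0 \<le> M"
    and lip: "\<And>s t. 0 \<le> s \<Longrightarrow> s \<le> t \<Longrightarrow> ereal t < T \<Longrightarrow> norm (\<zeta> t - \<zeta> s) \<le> M * (t - s)"
    and quad: "\<And>s t. 0 \<le> s \<Longrightarrow> s \<le> t \<Longrightarrow> ereal t < T \<Longrightarrow>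
        norm (\<zeta> t - \<zeta> s - (t - s) *\<^sub>R F (\<zeta> s)) \<le> L * M * (t - s)\<^sup>2"
    and F: "\<And>s t. 0 \<le> s \<Longrightarrow> s \<le> t \<Longrightarrow> ereal t < T \<Longrightarrow> norm (F (\<zeta> t) - F (\<zeta> s)) \<le> L * norm (\<zeta> t - \<zeta> s)"
  shows "(\<zeta> has_vector_derivative F (\<zeta> t)) (at t)"
proof -
  obtain b where b: "t < b" "ereal b < T" using ereal_dense2[OF t(2)] by auto
  show ?thesis
  proof (rule has_vector_derivative_quadratic[OF t(1) b(1), of _ _ "2 * (L * M)"])
    fix s assume s: "0 < s" "s < b"
    have sT: "ereal s < T" by (rule less_trans[OF _ b(2)]) (use s in simp)
    show "norm (\<zeta> s - \<zeta> t - (s - t) *\<^sub>R F (\<zeta> t)) \<le> 2 * (L * M) * (s - t)\<^sup>2"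
    proof (cases "t \<le> s")
      case True
      have "0 \<le> L * M * (s - t)\<^sup>2" using LM by simp
      then show ?thesis using quad[OF _ True sT] t(1) by simp
    next
      case False
      have "norm (F (\<zeta> t) - F (\<zeta> s)) \<le> L * (M * (t - s))"
        using F[of s t] lip[of s t] False s t LM(1) by (force intro: order_trans mult_left_mono)
      then have "norm ((t - s) *\<^sub>R (F (\<zeta> t) - F (\<zeta> s))) \<le> (t - s) * (L * (M * (t - s)))"
        using False by (simp add: mult_left_mono)
      moreover have "norm (\<zeta> t - \<zeta> s - (t - s) *\<^sub>R F (\<zeta> s)) \<le> L * M * (t - s)\<^sup>2"
        using quad[of s t] s t False by simp
      moreover have "\<zeta> s - \<zeta> t - (s - t) *\<^sub>R F (\<zeta> t) =
          (t - s) *\<^sub>R (F (\<zeta> t) - F (\<zeta> s)) - (\<zeta> t - \<zeta> s - (t - s) *\<^sub>R F (\<zeta> s))"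
        by (simp add: algebra_simps)
      moreover have "norm \<dots> \<le> norm ((t - s) *\<^sub>R (F (\<zeta> t) - F (\<zeta> s))) + norm (\<zeta> t - \<zeta> s - (t - s) *\<^sub>R F (\<zeta> s))"
        by (rule norm_triangle_ineq4)
      ultimately show ?thesis by (simp add: power2_eq_square algebra_simps)
    qed
  qed
qed

section \<open>The limit trajectory\<close>

context potential_well
begin

section \<open>Minimisers as approximate Euler polygons\<close>

lemma W_closure: "x \<in> closure \<Omega> \<Longrightarrow> W x = U x"
  using zero_frontier[of x] open_dom by (auto simp: W_def frontier_def interior_open)

lemma U_closure_nonneg: "x \<in> closure \<Omega> \<Longrightarrow> 0 \<le> U x"
  using W_closure W_nonneg by metis

lemma U_closure_bound: "x \<in> closure \<Omega> \<Longrightarrow> U x \<le> 2 * K * R"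
  using W_closure[of x] W_bound[of x] closure_sub_ball by (auto simp: subset_iff)

text \<open>The remaining cost is a coordinate of its own, so that it converges along with position
  and velocity.\<close>

definition state :: "real \<Rightarrow> nat \<Rightarrow> (nat \<Rightarrow> 'a) \<Rightarrow> nat \<Rightarrow> 'a \<times> 'a \<times> real" where
  "state h N x k = (x k, vel h x k, cost h x k N)"

text \<open>At zero energy the Lagrangian \<open>|v|^2 / 2 + U\<close> equals \<open>2 * U\<close>,
  the rate at which the remaining cost is used up.\<close>

definition field :: "'a \<times> 'a \<times> real \<Rightarrow> 'a \<times> 'a \<times> real" where
  "field = (\<lambda>(x, v, p). (v, G x, - 2 * U x))"

lemma field_lipschitz:
  assumes "fst w \<in> closure \<Omega>" "fst w' \<in> closure \<Omega>"
  shows "norm (field w - field w') \<le> (1 + 3 * K) * norm (w - w')"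
proof -
  obtain x v p where w: "w = (x, v, p)" by (cases w) auto
  obtain x' v' p' where w': "w' = (x', v', p')" by (cases w') auto
  have ball: "x \<in> cball 0 R" "x' \<in> cball 0 R"
    using assms closure_sub_ball ball_subset_cball by (auto simp: w w' subset_iff)
  define D where "D = norm (w - w')"
  have x: "norm (x - x') \<le> D" using norm_fst_le[of "x - x'" "(v - v', p - p')"] by (simp add: w w' D_def)
  have v: "norm (v - v') \<le> D"
    using norm_fst_le[of "v - v'" "p - p'"] norm_snd_le[of "(v - v', p - p')" "x - x'"]
    by (simp add: w w' D_def)
  have "norm (G x - G x') \<le> K * D"
    using G_lipschitz[OF ball] mult_left_mono[OF x, of K] K_pos by linarith
  moreover have "norm (- 2 * U x - - 2 * U x') \<le> 2 * (K * D)"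
    using U_lipschitz[OF ball] mult_left_mono[OF x, of K] K_pos unfolding real_norm_def by linarith
  ultimately have "norm (v - v', G x - G x', - 2 * U x - - 2 * U x') \<le> D + (K * D + 2 * (K * D))"
    using v by (intro order_trans[OF norm_Pair_le] add_mono) auto
  then show ?thesis by (simp add: w w' field_def D_def[unfolded w w'] algebra_simps)
qed

text \<open>The position obeys the Euler step exactly. The velocity errs because the Euler-Lagrange
  equation evaluates \<open>G\<close> at the next position, and the error of the cost coordinate is
  exactly \<open>h\<close> times the energy.\<close>

lemma state_step:
  assumes min: "minimizer h N x" and k: "Suc k < N" "x k \<in> \<Omega>" "x (Suc k) \<in> \<Omega>"
    and V: "norm (vel h x k) \<le> V"
  shows "norm (state h N x (Suc k) - state h N x k - h *\<^sub>R field (state h N x k)) \<le>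
      h * (K * V * h + \<bar>energy h x k\<bar>)"
proof -
  note h = minimizer_h_pos[OF min]
  have dx: "x (Suc k) - x k - h *\<^sub>R vel h x k = 0" using vel_step[OF h, of x k] by simp
  have dv: "vel h x (Suc k) - vel h x k - h *\<^sub>R G (x k) = h *\<^sub>R (G (x (Suc k)) - G (x k))"
    using euler_lagrange[OF min k(1,3)] by (simp add: algebra_simps)
  have "norm (G (x (Suc k)) - G (x k)) \<le> K * norm (x (Suc k) - x k)"
    using k sub_ball by (intro G_lipschitz) auto
  also have "\<dots> \<le> K * (h * V)"
    using V h K_pos by (simp add: vel_step[OF h, of x k])
  finally have 1: "norm (vel h x (Suc k) - vel h x k - h *\<^sub>R G (x k)) \<le> h * (K * (h * V))"
    using h unfolding dv by simp
  have "cost h x k N = cost h x k (Suc k) + cost h x (Suc k) N"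
    using k by (intro cost_split) auto
  then have "cost h x (Suc k) N - cost h x k N - h * (- 2 * U (x k)) = - (h * energy h x k)"
    unfolding cost_Suc kinetic_vel[OF h] energy_def using k by (simp add: W_def algebra_simps)
  then have 2: "norm (cost h x (Suc k) N - cost h x k N - h * (- 2 * U (x k))) \<le> h * \<bar>energy h x k\<bar>"
    using h by (simp add: abs_mult)
  have "norm (0::'a, vel h x (Suc k) - vel h x k - h *\<^sub>R G (x k), cost h x (Suc k) N - cost h x k N - h * (- 2 * U (x k)))
      \<le> 0 + (h * (K * (h * V)) + h * \<bar>energy h x k\<bar>)"
    by (intro order_trans[OF norm_Pair_le] add_mono 1 2) auto
  also have "\<dots> = h * (K * V * h + \<bar>energy h x k\<bar>)" by (simp add: algebra_simps)
  finally show ?thesis by (simp add: state_def field_def dx)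
qed

end

text \<open>\<open>\<Phi> t\<close> is the limit of the cost that remains to be paid by the minimisers at time \<open>t\<close>.\<close>

locale limit_trajectory = potential_well U G \<Omega> R K
  for U :: "'a::euclidean_space \<Rightarrow> real" and G :: "'a \<Rightarrow> 'a" and \<Omega> :: "'a set" and R K :: real +
  fixes h :: "nat \<Rightarrow> real" and N :: "nat \<Rightarrow> nat" and x :: "nat \<Rightarrow> nat \<Rightarrow> 'a" and m :: "nat \<Rightarrow> nat"
    and T :: ereal and u v :: "real \<Rightarrow> 'a" and \<Phi> :: "real \<Rightarrow> real" and M :: real
  assumes min: "\<And>n. minimizer (h n) (N n) (x n)"
    and exit: "\<And>n. exit_at (N n) (x n) (m n)"
    and h_lim: "h \<longlonglongrightarrow> 0"
    and hN: "filterlim (\<lambda>n. h n * real (N n)) at_top sequentially"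
    and hm: "(\<lambda>n. ereal (h n * real (m n))) \<longlonglongrightarrow> T"
    and vel_bound: "\<And>n k. k < m n \<Longrightarrow> norm (vel (h n) (x n) k) \<le> M"
    and conv: "\<And>t k. 0 \<le> t \<Longrightarrow> ereal t < T \<Longrightarrow> (\<lambda>n. h n * real (k n)) \<longlonglongrightarrow> t \<Longrightarrow>
        (\<lambda>n. state (h n) (N n) (x n) (k n)) \<longlonglongrightarrow> (u t, v t, \<Phi> t)"
    and T_pos: "0 < T"
    and u0: "u 0 = 0"
    and u_closure: "\<And>t. 0 \<le> t \<Longrightarrow> ereal t < T \<Longrightarrow> u t \<in> closure \<Omega>"
    and energy0: "\<And>t. 0 \<le> t \<Longrightarrow> ereal t < T \<Longrightarrow> (norm (v t))\<^sup>2 / 2 = U (u t)"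
    and \<Phi>_nonneg: "\<And>t. 0 \<le> t \<Longrightarrow> ereal t < T \<Longrightarrow> 0 \<le> \<Phi> t"
    and lip: "\<And>s t. 0 \<le> s \<Longrightarrow> s \<le> t \<Longrightarrow> ereal t < T \<Longrightarrow> norm (u t - u s) \<le> M * (t - s)"
    and du: "\<And>t. 0 < t \<Longrightarrow> ereal t < T \<Longrightarrow> (u has_vector_derivative v t) (at t)"
    and dv: "\<And>t. 0 < t \<Longrightarrow> ereal t < T \<Longrightarrow> (v has_vector_derivative G (u t)) (at t)"
    and d\<Phi>: "\<And>t. 0 < t \<Longrightarrow> ereal t < T \<Longrightarrow> (\<Phi> has_vector_derivative (- 2 * U (u t))) (at t)"

context potential_well
begin

lemma limit_trajectory_exists:
  obtains h N x m T u v \<Phi> M where "limit_trajectory U G \<Omega> R K h N x m T u v \<Phi> M"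
proof -
  \<comment> \<open>The total time \<open>h n * N n = n + 1\<close> tends to infinity, but slowly enough that the energy drift, of order \<open>h n * (h n * N n)\<close>, vanishes.\<close>
  define h where "h n = 1 / (real n + 1)\<^sup>2" for n
  define N where "N n = (n + 1) ^ 3" for n :: nat
  have h: "0 < h n" for n by (simp add: h_def)
  have hN: "h n * real (N n) = real n + 1" for n
  proof -
    have "real (N n) = (real n + 1) ^ 3" by (simp add: N_def add.commute)
    moreover have "1 / c\<^sup>2 * c ^ 3 = c" if "0 < c" for c :: real
      using that by (simp add: power2_eq_square power3_eq_cube)
    ultimately show ?thesis by (simp only: h_def)
  qed
  have N: "0 < N n" for n by (simp add: N_def)
  have h0: "h \<longlonglongrightarrow> 0" unfolding h_def by real_asymp
  define C where "C = R\<^sup>2 / 2 + 2 * K * R"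
  define \<omega> where "\<omega> n = h n * (K\<^sup>2 / 2 * (h n * N n) + 2 * K * C) + C / (h n * N n) + 4 * K\<^sup>2 * (h n)\<^sup>2" for n
  have \<omega>0: "\<omega> \<longlonglongrightarrow> 0" unfolding \<omega>_def hN unfolding h_def by real_asymp
  obtain w where w: "\<And>n. norm (\<omega> n) \<le> w"
    using convergent_imp_Bseq[OF convergentI[OF \<omega>0]] by (auto simp: Bseq_def)
  have "\<exists>y. minimizer (h n) (N n) y" for n
    using minimizer_exists[OF h[of n] N[of n]] by blast
  then obtain x where x: "\<And>n. minimizer (h n) (N n) (x n)" by metis
  have "\<exists>m. exit_at (N n) (x n) m \<and> 0 < m" for n
    using exit_exists[OF x[of n]] by blast
  then obtain m where m: "\<And>n. exit_at (N n) (x n) (m n)" "\<And>n. 0 < m n" by metis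
  have C: "cost (h n) (x n) 0 (N n) \<le> C" for n
    unfolding C_def
  \<comment> \<open>This many steps of length \<open>h n\<close> take unit time.\<close>
  proof (rule cost_bound[OF x, of _ "(n + 1)\<^sup>2"])
    show "h n * real ((n + 1)\<^sup>2) = 1" by (simp add: h_def add.commute)
    show "(n + 1)\<^sup>2 \<le> N n" unfolding N_def by (rule power_increasing) auto
  qed
  have E: "\<bar>energy (h n) (x n) k\<bar> \<le> \<omega> n" if "k < m n" for n k
    unfolding \<omega>_def by (rule energy_small[OF x m(1) C that])
  have dom: "x n k \<in> \<Omega>" if "k < m n" for n k using m(1)[of n] that by (auto simp: exit_at_def)
  define V where "V = 1 + 2 * (w + 2 * K * R)"
  have V: "norm (vel (h n) (x n) k) \<le> V" if "k < m n" for n k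
  proof -
    have "U (x n k) \<le> 2 * K * R" using dom[OF that] closure_subset by (intro U_closure_bound) auto
    then have "(norm (vel (h n) (x n) k))\<^sup>2 \<le> 2 * (w + 2 * K * R)"
      using E[OF that] w[of n] unfolding energy_def by (simp add: abs_le_iff)
    moreover have "a \<le> 1 + a\<^sup>2" for a :: real
      using zero_le_power2[of "a - 1/2"] by (simp add: power2_eq_square algebra_simps)
    ultimately show ?thesis unfolding V_def by (meson add_left_mono order_trans)
  qed
  have V0: "0 \<le> V" using order_trans[OF norm_ge_zero V[OF m(2)[of 0]]] .
  define Z :: "('a \<times> 'a \<times> real) set" where "Z = closure \<Omega> \<times> cball 0 V \<times> {0..C}"
  have inZ: "state (h n) (N n) (x n) k \<in> Z" if "k < m n" for n k
  proof -
    have "k \<le> N n" using that m(1)[of n] by (auto simp: exit_at_def)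
    then have "cost (h n) (x n) 0 (N n) = cost (h n) (x n) 0 k + cost (h n) (x n) k (N n)"
      by (intro cost_split) auto
    then have "cost (h n) (x n) k (N n) \<le> C"
      using C[of n] cost_nonneg[OF h, of n "x n" 0 k] by linarith
    moreover have "x n k \<in> closure \<Omega>" using dom[OF that] closure_subset by blast
    ultimately show ?thesis
      using V[OF that] cost_nonneg[OF h, of n] by (simp add: Z_def state_def)
  qed
  define \<eta> where "\<eta> n = K * V * h n + \<omega> n" for n
  have euler: "norm (state (h n) (N n) (x n) (Suc k) - state (h n) (N n) (x n) k
      - h n *\<^sub>R field (state (h n) (N n) (x n) k)) \<le> h n * \<eta> n" if k: "Suc k < m n" for n k
  proof -
    have "Suc k < N n" using k m(1)[of n] by (auto simp: exit_at_def)
    then have "norm (state (h n) (N n) (x n) (Suc k) - state (h n) (N n) (x n) k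
        - h n *\<^sub>R field (state (h n) (N n) (x n) k)) \<le> h n * (K * V * h n + \<bar>energy (h n) (x n) k\<bar>)"
      using k by (intro state_step x dom V) auto
    also have "\<dots> \<le> h n * \<eta> n"
      unfolding \<eta>_def using h[of n] E[of k n] k by (intro mult_left_mono) auto
    finally show ?thesis .
  qed
  \<comment> \<open>\<open>T\<close> is a limit of the exit times, taken in the compact extended
    reals so that it may be infinite.\<close>
  obtain T r0 where r0: "strict_mono r0" "((\<lambda>n. ereal (h n * real (m n))) \<circ> r0) \<longlonglongrightarrow> T"
    using compact_complete_linorder by blast
  have subseq: "(\<lambda>n. f (r (n::nat))) \<longlonglongrightarrow> (l::real)" if "f \<longlonglongrightarrow> l" "strict_mono r" for f r l
    using LIMSEQ_subseq_LIMSEQ[OF that] by (simp add: o_def)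
  have Z_closed: "closed Z" unfolding Z_def by (intro closed_Times) auto
  have Z_bound: "norm w \<le> R + (V + C)" if "w \<in> Z" for w
  proof -
    obtain a b c where w: "w = (a, b, c)" by (cases w) auto
    have "norm a \<le> R" "norm b \<le> V" "norm c \<le> C"
      using that closure_sub_ball by (force simp: w Z_def subset_iff)+
    then show ?thesis unfolding w by (intro order_trans[OF norm_Pair_le] add_mono)
  qed
  have F_bound: "norm (field w) \<le> V + (K + 4 * K * R)" if "w \<in> Z" for w
  proof -
    obtain a b c where w: "w = (a, b, c)" by (cases w) auto
    have a: "a \<in> closure \<Omega>" using that by (simp add: w Z_def)
    have "norm (- 2 * U a) \<le> 4 * K * R" using U_closure_bound[OF a] U_closure_nonneg[OF a] by simp
    moreover have "norm (G a) \<le> K"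
      using a closure_sub_ball ball_subset_cball by (intro G_bound) blast
    moreover have "norm b \<le> V" using that by (simp add: w Z_def)
    ultimately show ?thesis unfolding w field_def prod.case
      by (intro order_trans[OF norm_Pair_le] add_mono)
  qed
  have FL: "norm (field w - field w') \<le> (1 + 3 * K) * norm (w - w')" if "w \<in> Z" "w' \<in> Z" for w w'
    using that by (intro field_lipschitz) (auto simp: Z_def)
  have \<eta>0: "\<eta> \<longlonglongrightarrow> 0"
  proof -
    have "(\<lambda>n. K * V * h n + \<omega> n) \<longlonglongrightarrow> K * V * 0 + 0" by (intro tendsto_intros h0 \<omega>0)
    then show ?thesis unfolding \<eta>_def by simp
  qed
  obtain r \<zeta> M where r: "strict_mono (r :: nat \<Rightarrow> nat)" and M: "0 < M"
    and lim: "\<And>t k. 0 \<le> t \<Longrightarrow> ereal t < T \<Longrightarrow> (\<lambda>n. h (r0 (r n)) * real (k n)) \<longlonglongrightarrow> t \<Longrightarrow>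
        (\<lambda>n. state (h (r0 (r n))) (N (r0 (r n))) (x (r0 (r n))) (k n)) \<longlonglongrightarrow> \<zeta> t"
    and \<zeta>Z: "\<And>t. 0 \<le> t \<Longrightarrow> ereal t < T \<Longrightarrow> \<zeta> t \<in> Z"
    and lip: "\<And>s t. 0 \<le> s \<Longrightarrow> s \<le> t \<Longrightarrow> ereal t < T \<Longrightarrow> norm (\<zeta> t - \<zeta> s) \<le> M * (t - s)"
    and quad: "\<And>s t. 0 \<le> s \<Longrightarrow> s \<le> t \<Longrightarrow> ereal t < T \<Longrightarrow>
        norm (\<zeta> t - \<zeta> s - (t - s) *\<^sub>R field (\<zeta> s)) \<le> (1 + 3 * K) * M * (t - s)\<^sup>2"
  proof (rule euler_polygon_limit[of "\<lambda>n. h (r0 n)" "\<lambda>n. m (r0 n)" T Z "R + (V + C)"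
        "\<lambda>n. state (h (r0 n)) (N (r0 n)) (x (r0 n))" field "V + (K + 4 * K * R)" "1 + 3 * K" "\<lambda>n. \<eta> (r0 n)"])
    show "(\<lambda>n. ereal (h (r0 n) * real (m (r0 n)))) \<longlonglongrightarrow> T" using r0(2) by (simp add: o_def)
    show "norm (field w) \<le> V + (K + 4 * K * R)" if "w \<in> Z" for w by (rule F_bound[OF that])
  qed (use h inZ euler subseq[OF h0 r0(1)] subseq[OF \<eta>0 r0(1)] K_pos Z_closed Z_bound FL in \<open>blast | simp\<close>)+
  define \<rho> where "\<rho> = r0 \<circ> r"
  have \<rho>: "strict_mono \<rho>" unfolding \<rho>_def by (rule strict_mono_o[OF r0(1) r])
  have d\<zeta>: "(\<zeta> has_vector_derivative field (\<zeta> t)) (at t)" if "0 < t" "ereal t < T" for t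
  proof (rule quadratic_estimate_derivative[OF that, of "1 + 3 * K" M])
    fix s t assume st: "0 \<le> s" "s \<le> t" "ereal t < T"
    then have "ereal s < T" by (intro order_le_less_trans[OF _ st(3)]) simp
    then show "norm (field (\<zeta> t) - field (\<zeta> s)) \<le> (1 + 3 * K) * norm (\<zeta> t - \<zeta> s)"
      using st by (intro FL \<zeta>Z) auto
  qed (use K_pos M lip quad in auto)
  define u v \<Phi> where "u t = fst (\<zeta> t)" and "v t = fst (snd (\<zeta> t))" and "\<Phi> t = snd (snd (\<zeta> t))" for t
  have \<zeta>: "\<zeta> t = (u t, v t, \<Phi> t)" for t by (simp add: u_def v_def \<Phi>_def)
  have hm: "(\<lambda>n. ereal (h (\<rho> n) * real (m (\<rho> n)))) \<longlonglongrightarrow> T"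
    using LIMSEQ_subseq_LIMSEQ[OF r0(2) r] by (simp add: o_def \<rho>_def)
  have T_pos: "0 < T"
  proof -
    \<comment> \<open>A path of speed at most \<open>V\<close> needs a positive time to leave a ball
      around \<open>0\<close> contained in \<Omega>; \<open>V + 1\<close> avoids a division by
      zero.\<close>
    obtain d where d: "0 < d" "ball 0 d \<subseteq> \<Omega>" using openE[OF open_dom zero_in] by blast
    have lb: "d \<le> (V + 1) * (h n * real (m n))" for n
    proof -
      have "norm (x n k) \<le> V * (h n * k)" if "k \<le> m n" for k
        using that
      proof (induction k)
        case 0
        then show ?case using minimizer_zero[OF x] by simp
      next
        case (Suc k)
        have "norm (x n (Suc k)) \<le> norm (x n k) + h n * norm (vel (h n) (x n) k)"
          unfolding vel_step[OF h, of "x n" k n] using h[of n] by (intro norm_triangle_le) simp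
        also have "\<dots> \<le> V * (h n * k) + h n * V"
          using Suc V[of k n] h[of n] by (intro add_mono mult_left_mono) auto
        finally show ?case by (simp add: algebra_simps)
      qed
      then have "norm (x n (m n)) \<le> V * (h n * m n)" by simp
      also have "\<dots> \<le> (V + 1) * (h n * m n)" using h[of n] by (intro mult_right_mono) auto
      finally show ?thesis using d m(1)[of n] by (force simp: exit_at_def)
    qed
    have "ereal (d / (V + 1)) \<le> T"
      by (rule LIMSEQ_le_const[OF hm]) (use lb V0 in \<open>auto simp: field_simps\<close>)
    moreover have "0 < ereal (d / (V + 1))" using d V0 by simp
    ultimately show ?thesis by order
  qed
  have lim': "(\<lambda>n. state (h (\<rho> n)) (N (\<rho> n)) (x (\<rho> n)) (k n)) \<longlonglongrightarrow> (u t, v t, \<Phi> t)"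
    if "0 \<le> t" "ereal t < T" "(\<lambda>n. h (\<rho> n) * real (k n)) \<longlonglongrightarrow> t" for t k
    using lim[OF that(1,2), of k] that(3) by (simp add: \<rho>_def \<zeta>)
  \<comment> \<open>One constant has to serve both as Lipschitz bound of \<open>u\<close> and as
    bound of the discrete velocities.\<close>
  have "limit_trajectory U G \<Omega> R K (\<lambda>n. h (\<rho> n)) (\<lambda>n. N (\<rho> n)) (\<lambda>n. x (\<rho> n)) (\<lambda>n. m (\<rho> n)) T u v \<Phi> (max M V)"
  proof unfold_locales
    show "minimizer (h (\<rho> n)) (N (\<rho> n)) (x (\<rho> n))" for n by (rule x)
    show "exit_at (N (\<rho> n)) (x (\<rho> n)) (m (\<rho> n))" for n by (rule m)
    show "(\<lambda>n. h (\<rho> n)) \<longlonglongrightarrow> 0" by (rule subseq[OF h0 \<rho>])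
    have "filterlim (\<lambda>n. h n * real (N n)) at_top sequentially" unfolding hN by real_asymp
    from filterlim_compose[OF this filterlim_subseq[OF \<rho>]]
    show "filterlim (\<lambda>n. h (\<rho> n) * real (N (\<rho> n))) at_top sequentially" .
    show "norm (vel (h (\<rho> n)) (x (\<rho> n)) k) \<le> max M V" if "k < m (\<rho> n)" for n k
      using V[OF that] by simp
    show "0 < T" by (rule T_pos)
    show "u 0 = 0"
    proof -
      have "(\<lambda>n. state (h (\<rho> n)) (N (\<rho> n)) (x (\<rho> n)) 0) \<longlonglongrightarrow> (u 0, v 0, \<Phi> 0)"
        using T_pos by (intro lim') (auto simp: zero_ereal_def)
      from tendsto_fst[OF this] show ?thesis
        using minimizer_zero[OF x] by (simp add: state_def LIMSEQ_const_iff)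
    qed
    show "u t \<in> closure \<Omega>" "0 \<le> \<Phi> t" if "0 \<le> t" "ereal t < T" for t
      using \<zeta>Z[OF that] by (auto simp: \<zeta> Z_def)
    show "norm (u t - u s) \<le> max M V * (t - s)" if "0 \<le> s" "s \<le> t" "ereal t < T" for s t
    proof -
      have "norm (u t - u s) \<le> norm (\<zeta> t - \<zeta> s)"
        using norm_fst_le[of "u t - u s"] by (simp add: \<zeta>)
      also have "\<dots> \<le> max M V * (t - s)"
        using that by (intro order_trans[OF lip[OF that]] mult_right_mono) auto
      finally show ?thesis .
    qed
    fix t assume t: "0 < t" "ereal t < T"
    have D: "((\<lambda>t. (u t, v t, \<Phi> t)) has_vector_derivative (v t, G (u t), - 2 * U (u t))) (at t)"
      using d\<zeta>[OF t] unfolding \<zeta>[abs_def] field_def prod.case by (simp add: \<zeta>)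
    show "(u has_vector_derivative v t) (at t)"
      using bounded_linear.has_vector_derivative[OF bounded_linear_fst D] by simp
    show "(v has_vector_derivative G (u t)) (at t)"
      using bounded_linear.has_vector_derivative[OF bounded_linear_fst
          bounded_linear.has_vector_derivative[OF bounded_linear_snd D]] by simp
    show "(\<Phi> has_vector_derivative - 2 * U (u t)) (at t)"
      using bounded_linear.has_vector_derivative[OF bounded_linear_snd
          bounded_linear.has_vector_derivative[OF bounded_linear_snd D]] by simp
  next
    fix t assume t: "0 \<le> t" "ereal t < T"
    define k where "k n = nat \<lfloor>t / h (\<rho> n)\<rfloor>" for n
    have k: "(\<lambda>n. h (\<rho> n) * k n) \<longlonglongrightarrow> t"
      unfolding k_def by (rule grid_tendsto[OF h subseq[OF h0 \<rho>] t(1)])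
    note L = lim'[OF t k, unfolded state_def]
    have xl: "(\<lambda>n. x (\<rho> n) (k n)) \<longlonglongrightarrow> u t" using tendsto_fst[OF L] by simp
    have vl: "(\<lambda>n. vel (h (\<rho> n)) (x (\<rho> n)) (k n)) \<longlonglongrightarrow> v t" using tendsto_fst[OF tendsto_snd[OF L]] by simp
    have "(\<lambda>n. energy (h (\<rho> n)) (x (\<rho> n)) (k n)) \<longlonglongrightarrow> (norm (v t))\<^sup>2 / 2 - U (u t)"
      unfolding energy_def
      by (intro tendsto_intros vl continuous_on_tendsto_compose[OF U_cont[of UNIV] xl]) auto
    moreover have "(\<lambda>n. energy (h (\<rho> n)) (x (\<rho> n)) (k n)) \<longlonglongrightarrow> 0"
    proof (rule Lim_null_comparison[OF _ subseq[OF \<omega>0 \<rho>]])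
      have "\<forall>\<^sub>F n in sequentially. ereal t < ereal (h (\<rho> n) * real (m (\<rho> n)))"
        by (rule order_tendstoD(1)[OF hm t(2)])
      then show "\<forall>\<^sub>F n in sequentially. norm (energy (h (\<rho> n)) (x (\<rho> n)) (k n)) \<le> \<omega> (\<rho> n)"
      proof eventually_elim
        case (elim n)
        then have "h (\<rho> n) * real (k n) < h (\<rho> n) * real (m (\<rho> n))" using grid_le(1)[OF h[of "\<rho> n"] t(1)] by (simp add: k_def)
        then show ?case using h[of "\<rho> n"] by (simp add: E)
      qed
    qed
    ultimately have "(norm (v t))\<^sup>2 / 2 - U (u t) = 0" by (rule LIMSEQ_unique)
    then show "(norm (v t))\<^sup>2 / 2 = U (u t)" by simp
  qed (use hm lim' in auto)
  then show ?thesis by (rule that)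
qed

end

context limit_trajectory
begin

section \<open>Passing from minimisers to the trajectory, and the remaining cost near regular
  points\<close>

lemma h_pos: "0 < h n"
  by (rule minimizer_h_pos[OF min])

lemma before_exit:
  assumes "ereal t < T" "(\<lambda>n. h n * real (k n)) \<longlonglongrightarrow> t"
  shows "\<forall>\<^sub>F n in sequentially. k n < m n"
proof -
  obtain c where c: "ereal t < c" "c < T" using dense assms(1) by blast
  have "\<forall>\<^sub>F n in sequentially. c < ereal (h n * real (m n))"
    by (rule order_tendstoD(1)[OF hm c(2)])
  moreover have "\<forall>\<^sub>F n in sequentially. ereal (h n * real (k n)) < c"
    using c assms by (intro order_tendstoD(2)[of _ "ereal t"]) auto
  ultimately show ?thesis
  proof eventually_elim
    case (elim n)
    then have "ereal (h n * real (k n)) < ereal (h n * real (m n))" by order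
    then show ?case using h_pos[of n] by simp
  qed
qed

lemma conv_x:
  assumes "0 \<le> t" "ereal t < T" "(\<lambda>n. h n * real (k n)) \<longlonglongrightarrow> t"
  shows "(\<lambda>n. x n (k n)) \<longlonglongrightarrow> u t"
  using tendsto_fst[OF conv[OF assms]] by (simp add: state_def)

lemma conv_cost:
  assumes "0 \<le> t" "ereal t < T" "(\<lambda>n. h n * real (k n)) \<longlonglongrightarrow> t"
  shows "(\<lambda>n. cost (h n) (x n) (k n) (N n)) \<longlonglongrightarrow> \<Phi> t"
  using tendsto_snd[OF tendsto_snd[OF conv[OF assms]]] by (simp add: state_def)

lemma x_dom: "k < m n \<Longrightarrow> x n k \<in> \<Omega>"
  using exit[of n] by (auto simp: exit_at_def)

lemma M_nonneg: "0 \<le> M"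
proof -
  have "0 < m 0" using exit[of 0] minimizer_zero[OF min, of 0] zero_in by (auto simp: exit_at_def intro: gr0I)
  then show ?thesis using order_trans[OF norm_ge_zero vel_bound] by blast
qed

lemma x_lipschitz:
  assumes "j \<le> k" "k \<le> m n"
  shows "norm (x n k - x n j) \<le> M * (h n * (real k - real j))"
  using assms
proof (induction k rule: dec_induct)
  case (step k)
  have "x n (Suc k) - x n j = (x n k - x n j) + h n *\<^sub>R vel (h n) (x n) k"
    using vel_step[OF h_pos, of "x n" k n] by simp
  also have "norm \<dots> \<le> M * (h n * (real k - real j)) + h n * M"
    using step vel_bound[of k n] h_pos[of n] by (intro norm_triangle_le add_mono) auto
  finally show ?case by (simp add: algebra_simps)
qed simp

text \<open>The locale provides convergence for full index sequences only, whereas compactness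
  yields converging times along a subsequence. The Lipschitz bound compares such indices with the
  canonical grid indices for \<open>t\<close>.\<close>

lemma conv_x_subseq:
  assumes \<rho>: "strict_mono \<rho>" and t: "0 \<le> t" "ereal t < T"
    and k: "(\<lambda>n. h (\<rho> n) * real (k n)) \<longlonglongrightarrow> t" and km: "\<And>n. k n < m (\<rho> n)"
  shows "(\<lambda>n. x (\<rho> n) (k n)) \<longlonglongrightarrow> u t"
proof -
  define j where "j n = nat \<lfloor>t / h n\<rfloor>" for n
  have j: "(\<lambda>n. h n * real (j n)) \<longlonglongrightarrow> t" unfolding j_def by (rule grid_tendsto[OF h_pos h_lim t(1)])
  have j\<rho>: "(\<lambda>n. h (\<rho> n) * real (j (\<rho> n))) \<longlonglongrightarrow> t"
    using LIMSEQ_subseq_LIMSEQ[OF j \<rho>] by (simp add: o_def)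
  have "(\<lambda>n. M * \<bar>h (\<rho> n) * real (k n) - h (\<rho> n) * real (j (\<rho> n))\<bar>) \<longlonglongrightarrow> M * \<bar>t - t\<bar>"
    by (intro tendsto_intros k j\<rho>)
  then have "(\<lambda>n. M * \<bar>h (\<rho> n) * real (k n) - h (\<rho> n) * real (j (\<rho> n))\<bar>) \<longlonglongrightarrow> 0" by simp
  moreover have "\<forall>\<^sub>F n in sequentially. norm (x (\<rho> n) (k n) - x (\<rho> n) (j (\<rho> n))) \<le>
      M * \<bar>h (\<rho> n) * real (k n) - h (\<rho> n) * real (j (\<rho> n))\<bar>"
    using eventually_subseq[OF \<rho> before_exit[OF t(2) j]]
  proof eventually_elim
    case (elim n)
    have "\<bar>h (\<rho> n) * real (k n) - h (\<rho> n) * real (j (\<rho> n))\<bar> = h (\<rho> n) * \<bar>real (k n) - real (j (\<rho> n))\<bar>"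
      using h_pos[of "\<rho> n"] by (simp add: abs_mult flip: right_diff_distrib)
    then show ?case
      using x_lipschitz[of "k n" "j (\<rho> n)" "\<rho> n"] x_lipschitz[of "j (\<rho> n)" "k n" "\<rho> n"] elim km[of n]
      by (cases "k n \<le> j (\<rho> n)") (auto simp: norm_minus_commute)
  qed
  ultimately have "(\<lambda>n. x (\<rho> n) (k n) - x (\<rho> n) (j (\<rho> n))) \<longlonglongrightarrow> 0"
    by (rule Lim_null_comparison[rotated])
  moreover have "(\<lambda>n. x (\<rho> n) (j (\<rho> n))) \<longlonglongrightarrow> u t"
    using LIMSEQ_subseq_LIMSEQ[OF conv_x[OF t j] \<rho>] by (simp add: o_def)
  ultimately show ?thesis using tendsto_add by fastforce
qed

text \<open>The descent path has length at most \<open>C * U\<close>. Travelling it in time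
  \<open>sqrt U\<close> balances the kinetic part, \<open>(C * U)\<^sup>2 / (2 * sqrt U)\<close>,
  with the potential part, \<open>sqrt U * U\<close>: both are of order
  \<open>U * sqrt U\<close>.\<close>

lemma remaining_near_regular:
  assumes q: "q \<in> frontier \<Omega>" and Gq: "G q \<noteq> 0"
  obtains r C where "0 < r" "0 < C"
    "\<And>t. 0 \<le> t \<Longrightarrow> ereal t < T \<Longrightarrow> u t \<in> ball q r \<Longrightarrow> \<Phi> t \<le> C * (U (u t) * sqrt (U (u t)))"
proof -
  obtain r C where r: "0 < r" "0 < C"
    and desc: "\<And>y. y \<in> \<Omega> \<Longrightarrow> y \<in> ball q r \<Longrightarrow> \<exists>z. z \<in> cball 0 R \<and> z \<notin> \<Omega> \<and>
        norm (z - y) \<le> C * U y \<and> (\<forall>w\<in>closed_segment y z. W w \<le> U y)"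
    using regular_descent[OF q Gq] by blast
  show ?thesis
  proof (rule that[OF r(1), of "C\<^sup>2 / 2 + 1"])
    show "0 < C\<^sup>2 / 2 + 1" using zero_le_power2[of C] by linarith
    fix t assume t: "0 \<le> t" "ereal t < T" "u t \<in> ball q r"
    define k where "k n = nat \<lfloor>t / h n\<rfloor>" for n
    have k: "(\<lambda>n. h n * real (k n)) \<longlonglongrightarrow> t" unfolding k_def by (rule grid_tendsto[OF h_pos h_lim t(1)])
    have xl: "(\<lambda>n. x n (k n)) \<longlonglongrightarrow> u t" by (rule conv_x[OF t(1,2) k])
    define w where "w n = U (x n (k n))" for n
    have wl: "w \<longlonglongrightarrow> U (u t)"
      unfolding w_def by (rule continuous_on_tendsto_compose[OF U_cont[of UNIV] xl]) auto
    have "(\<lambda>n. h n * real (k n) + (sqrt (w n) + h n)) \<longlonglongrightarrow> t + (sqrt (U (u t)) + 0)"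
      by (intro tendsto_intros k wl h_lim)
    then have "\<forall>\<^sub>F n in sequentially. h n * real (k n) + (sqrt (w n) + h n) < t + sqrt (U (u t)) + 1"
      by (rule order_tendstoD(2)) simp
    \<comment> \<open>Since the total time \<open>h n * N n\<close> tends to infinity, enough steps
      are left for the competitor.\<close>
    moreover have "\<forall>\<^sub>F n in sequentially. t + sqrt (U (u t)) + 1 < h n * real (N n)"
      using hN by (simp add: filterlim_at_top_dense)
    moreover have "\<forall>\<^sub>F n in sequentially. x n (k n) \<in> ball q r"
      using topological_tendstoD[OF xl open_ball t(3)] .
    moreover have "\<forall>\<^sub>F n in sequentially. k n < m n" by (rule before_exit[OF t(2) k])
    ultimately have "\<forall>\<^sub>F n in sequentially. cost (h n) (x n) (k n) (N n) \<le>
        C\<^sup>2 / 2 * (w n * sqrt (w n)) + (sqrt (w n) + h n) * w n"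
    proof eventually_elim
      case (elim n)
      have dom: "x n (k n) \<in> \<Omega>" by (rule x_dom[OF elim(4)])
      have w0: "0 < w n" unfolding w_def by (rule pos[OF dom])
      obtain y where y: "y \<in> cball 0 R" "y \<notin> \<Omega>" "norm (y - x n (k n)) \<le> C * w n"
          "\<And>z. z \<in> closed_segment (x n (k n)) y \<Longrightarrow> W z \<le> w n"
        using desc[OF dom elim(3)] unfolding w_def by blast
      \<comment> \<open>Rounding up makes the travel time at least \<open>sqrt (w n)\<close> and
        exceeds it by at most \<open>h n\<close>.\<close>
      define j where "j = nat \<lceil>sqrt (w n) / h n\<rceil>"
      have s: "0 < sqrt (w n) / h n" using w0 h_pos[of n] by simp
      have j0: "0 < j" using s by (simp add: j_def)
      have "real j = of_int \<lceil>sqrt (w n) / h n\<rceil>" using s by (simp add: j_def)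
      then have "sqrt (w n) / h n \<le> real j" "real j \<le> sqrt (w n) / h n + 1" by linarith+
      then have j: "sqrt (w n) \<le> h n * j" "h n * j \<le> sqrt (w n) + h n"
        using h_pos[of n] by (simp_all add: field_simps)
      have "h n * real (k n + j) < h n * real (N n)" using j(2) elim(1,2) by (simp add: distrib_left)
      then have "k n + j \<le> N n" using h_pos[of n] by simp
      then have "cost (h n) (x n) (k n) (N n) \<le>
          (norm (y - x n (k n)))\<^sup>2 / (2 * (h n * j)) + h n * j * w n"
        by (rule line_competitor[OF min j0 _ y(1,2,4)])
      also have "\<dots> \<le> (C * w n)\<^sup>2 / (2 * sqrt (w n)) + (sqrt (w n) + h n) * w n"
        using y(3) j w0 by (intro add_mono frac_le power_mono mult_right_mono mult_left_mono) auto
      also have "(C * w n)\<^sup>2 / (2 * sqrt (w n)) = C\<^sup>2 / 2 * (w n * sqrt (w n))"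
      proof -
        have "w n = sqrt (w n) * sqrt (w n)" using w0 by simp
        moreover have "(C * (a * a))\<^sup>2 / (2 * a) = C\<^sup>2 / 2 * (a * a * a)" for a :: real
          by (simp add: power2_eq_square)
        ultimately show ?thesis by metis
      qed
      finally show ?case .
    qed
    moreover have "(\<lambda>n. C\<^sup>2 / 2 * (w n * sqrt (w n)) + (sqrt (w n) + h n) * w n) \<longlonglongrightarrow>
        C\<^sup>2 / 2 * (U (u t) * sqrt (U (u t))) + (sqrt (U (u t)) + 0) * U (u t)"
      by (intro tendsto_intros wl h_lim)
    ultimately have "\<Phi> t \<le> C\<^sup>2 / 2 * (U (u t) * sqrt (U (u t))) + (sqrt (U (u t)) + 0) * U (u t)"
      by (intro tendsto_le[OF sequentially_bot _ conv_cost[OF t(1,2) k]])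
    then show "\<Phi> t \<le> (C\<^sup>2 / 2 + 1) * (U (u t) * sqrt (U (u t)))" by (simp add: algebra_simps)
  qed
qed

section \<open>The trajectory stays in the open set before time \<open>T\<close>\<close>

lemma u_continuous:
  assumes "ereal b < T"
  shows "continuous_on {0..b} u"
proof (rule lipschitz_on_continuous_on[OF lipschitz_onI[of "{0..b}" u M]])
  fix s t assume st: "s \<in> {0..b}" "t \<in> {0..b}"
  have le: "dist (u s) (u t) \<le> M * dist s t" if "s \<le> t" "s \<in> {0..b}" "t \<in> {0..b}" for s t
  proof -
    have "ereal t < T" by (rule order_le_less_trans[OF _ assms]) (use that in simp)
    then show ?thesis using lip[of s t] that by (simp add: dist_norm norm_minus_commute)
  qed
  show "dist (u s) (u t) \<le> M * dist s t"
    using le[of s t] le[of t s] st by (cases "s \<le> t") (auto simp: dist_commute)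
qed (rule M_nonneg)

lemma critical_distance:
  assumes q: "q \<in> frontier \<Omega>" and Gq: "G q = 0" and t: "0 \<le> t" "ereal t < T"
  shows "exp (- (sqrt (2 * K) * t)) * norm q \<le> norm (u t - q)"
proof -
  \<comment> \<open>Taylor expansion at the critical point gives
    \<open>U \<le> K * |u - q|^2\<close>, so zero energy bounds the speed by \<open>c\<close> times
    the distance to \<open>q\<close>. The exponential weight in \<open>f\<close> turns this into a
    Gronwall argument.\<close>
  define c where "c = sqrt (2 * K)"
  define f where "f s = ((u s - q) \<bullet> (u s - q)) * exp (2 * c * s)" for s
  have "f 0 \<le> f t"
  proof (rule DERIV_nonneg_imp_increasing_open[OF t(1)])
    fix s assume s: "0 < s" "s < t"
    have sT: "ereal s < T" by (rule less_trans[OF _ t(2)]) (use s in simp)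
    have du': "((\<lambda>s. u s - q) has_vector_derivative v s) (at s)"
      using du[OF s(1) sT] by (auto intro!: derivative_eq_intros)
    have "((\<lambda>s. (u s - q) \<bullet> (u s - q)) has_real_derivative (2 * ((u s - q) \<bullet> v s))) (at s)"
      unfolding has_real_derivative_iff_has_vector_derivative
      using bounded_bilinear.has_vector_derivative[OF bounded_bilinear_inner du' du']
      by (simp add: inner_commute)
    then have D: "(f has_real_derivative
        (2 * ((u s - q) \<bullet> v s) * exp (2 * c * s) + ((u s - q) \<bullet> (u s - q)) * (exp (2 * c * s) * (2 * c)))) (at s)"
      unfolding f_def by (auto intro!: derivative_eq_intros)
    have ball: "u s \<in> cball 0 R" "q \<in> cball 0 R"
      using u_closure[of s] s sT q closure_sub_ball ball_subset_cball by (auto simp: frontier_def subset_iff)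
    have "U (u s) \<le> K * (norm (u s - q))\<^sup>2"
      using U_taylor[OF ball(2,1)] zero_frontier[OF q] Gq by (simp add: abs_le_iff)
    then have "(norm (v s))\<^sup>2 \<le> (c * norm (u s - q))\<^sup>2"
      using energy0[of s] s sT K_pos by (simp add: c_def power_mult_distrib)
    then have "norm (v s) \<le> c * norm (u s - q)"
      by (rule power2_le_imp_le) (use K_pos in \<open>simp add: c_def\<close>)
    then have "norm (u s - q) * norm (v s) \<le> norm (u s - q) * (c * norm (u s - q))"
      by (intro mult_left_mono) auto
    moreover have "- (norm (u s - q) * norm (v s)) \<le> (u s - q) \<bullet> v s"
      using Cauchy_Schwarz_ineq2[of "u s - q" "v s"] by linarith
    ultimately have "0 \<le> 2 * ((u s - q) \<bullet> v s) + ((u s - q) \<bullet> (u s - q)) * (2 * c)"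
      by (simp add: power2_norm_eq_inner[symmetric] power2_eq_square algebra_simps)
    then have "0 \<le> (2 * ((u s - q) \<bullet> v s) + ((u s - q) \<bullet> (u s - q)) * (2 * c)) * exp (2 * c * s)"
      by simp
    then show "\<exists>y. (f has_real_derivative y) (at s) \<and> 0 \<le> y"
      using D by (intro exI conjI) (auto simp: algebra_simps)
  next
    show "continuous_on {0..t} f"
      unfolding f_def by (intro continuous_intros u_continuous t)
  qed
  then have "(norm q)\<^sup>2 \<le> (norm (u t - q) * exp (c * t))\<^sup>2"
    by (simp add: f_def u0 power2_norm_eq_inner power_mult_distrib exp_double[symmetric] mult_ac)
  then have "norm q \<le> norm (u t - q) * exp (c * t)"
    by (rule power2_le_imp_le) simp
  then show ?thesis unfolding c_def[symmetric] by (simp add: exp_minus field_simps)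
qed

lemma frontier_nonzero: "q \<in> frontier \<Omega> \<Longrightarrow> q \<noteq> 0"
  using zero_in open_dom by (auto simp: frontier_def interior_open)

lemma critical_not_reached:
  assumes "q \<in> frontier \<Omega>" "G q = 0" "0 \<le> t" "ereal t < T"
  shows "u t \<noteq> q"
  using critical_distance[OF assms] frontier_nonzero[OF assms(1)]
  by (metis exp_gt_zero diff_self leD mult_pos_pos norm_zero zero_less_norm_iff)

lemma \<Phi>_drop:
  assumes st: "0 < s" "s \<le> t" "ereal t < T" and c: "\<And>w. s \<le> w \<Longrightarrow> w \<le> t \<Longrightarrow> c \<le> U (u w)"
  shows "\<Phi> t \<le> \<Phi> s - 2 * c * (t - s)"
proof -
  have "\<Phi> t + 2 * c * t \<le> \<Phi> s + 2 * c * s"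
  proof (rule DERIV_nonpos_imp_nonincreasing[OF st(2)])
    fix w assume w: "s \<le> w" "w \<le> t"
    have wT: "ereal w < T" by (rule order_le_less_trans[OF _ st(3)]) (use w in simp)
    have "(\<Phi> has_real_derivative (- 2 * U (u w))) (at w)"
      unfolding has_real_derivative_iff_has_vector_derivative using d\<Phi>[OF _ wT] w st by simp
    then have "((\<lambda>w. \<Phi> w + 2 * c * w) has_real_derivative (- 2 * U (u w) + 2 * c)) (at w)"
      by (auto intro!: derivative_eq_intros)
    then show "\<exists>y. ((\<lambda>w. \<Phi> w + 2 * c * w) has_real_derivative y) (at w) \<and> y \<le> 0"
      using c[OF w] by (intro exI conjI) auto
  qed
  then show ?thesis by (simp add: algebra_simps)
qed

lemma U_u_nonneg: "0 \<le> t \<Longrightarrow> ereal t < T \<Longrightarrow> 0 \<le> U (u t)"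
  by (intro U_closure_nonneg u_closure)

lemma \<Phi>_antimono:
  assumes "0 < s" "s \<le> t" "ereal t < T"
  shows "\<Phi> t \<le> \<Phi> s"
proof -
  have "0 \<le> U (u w)" if "s \<le> w" "w \<le> t" for w
    by (rule U_u_nonneg, use that assms in simp, rule order_le_less_trans[OF _ assms(3)]) (use that in simp)
  from \<Phi>_drop[OF assms, of 0, OF this] show ?thesis by simp
qed

text \<open>
  A regular boundary point at time \<open>t\<close> would exhaust the remaining cost, so \<open>U \<circ> u\<close> and with it
  the velocity and the force would vanish after \<open>t\<close>.
\<close>

lemma u_in_dom:
  assumes t: "0 \<le> t" "ereal t < T"
  shows "u t \<in> \<Omega>"
proof (rule ccontr)
  assume out: "u t \<notin> \<Omega>"
  have q: "u t \<in> frontier \<Omega>"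
    using u_closure[OF t] out open_dom by (auto simp: frontier_def interior_open)
  have t0: "0 < t" using out u0 zero_in t(1) by (cases "t = 0") auto
  show False
  proof (cases "G (u t) = 0")
    case True
    then show False using critical_not_reached[OF q True t] by simp
  next
    case False
    obtain r C where "0 < r" "0 < C" and B: "\<And>s. 0 \<le> s \<Longrightarrow> ereal s < T \<Longrightarrow> u s \<in> ball (u t) r \<Longrightarrow> \<Phi> s \<le> C * (U (u s) * sqrt (U (u s)))"
      using remaining_near_regular[OF q False] by blast
    then have "\<Phi> t \<le> 0" using B[OF t] zero_frontier[OF q] by simp
    then have \<Phi>0: "\<Phi> s = 0" if "t \<le> s" "ereal s < T" for s
      using \<Phi>_antimono[OF t0 that] \<Phi>_nonneg[of s] that t0 by simp
    obtain b where b: "t < b" "ereal b < T" using ereal_dense2[OF t(2)] by auto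
    have bT: "ereal s < T" if "s < b" for s by (rule less_trans[OF _ b(2)]) (use that in simp)
    have U0: "U (u s) = 0" if "t < s" "s < b" for s
    proof -
      have "(\<Phi> has_vector_derivative (- 2 * U (u s))) (at s)"
        using d\<Phi>[OF _ bT] that t0 by simp
      moreover have "(\<Phi> has_vector_derivative 0) (at s)"
      proof (rule has_vector_derivative_transform_within_open[of "\<lambda>_. 0" _ _ "{t<..<b}"])
        show "((\<lambda>_. 0) has_vector_derivative 0) (at s)" by simp
      qed (use that \<Phi>0 bT in auto)
      ultimately have "- 2 * U (u s) = 0" by (rule vector_derivative_unique_at)
      then show ?thesis by simp
    qed
    define s where "s = (t + b) / 2"
    have s: "t < s" "s < b" using b by (auto simp: s_def)
    have "(v has_vector_derivative G (u s)) (at s)" using dv[OF _ bT] s t0 by simp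
    moreover have "(v has_vector_derivative 0) (at s)"
    proof (rule has_vector_derivative_transform_within_open[of "\<lambda>_. 0" _ _ "{t<..<b}"])
      fix w assume w: "w \<in> {t<..<b}"
      show "0 = v w" using energy0[OF _ bT, of w] U0[of w] w t0 by simp
    qed (use s in auto)
    ultimately have G0: "G (u s) = 0" by (rule vector_derivative_unique_at)
    have "u s \<in> closure \<Omega>" using u_closure[OF _ bT] s t0 by simp
    moreover have "u s \<notin> \<Omega>" using pos[of "u s"] U0[OF s] by auto
    ultimately have "u s \<in> frontier \<Omega>" using open_dom by (auto simp: frontier_def interior_open)
    \<comment> \<open>Vanishing velocity has turned the regular case into the critical one: at time
      \<open>s < T\<close> the trajectory sits at a critical frontier point.\<close>
    then show False using critical_not_reached[OF _ G0 _ bT[OF s(2)]] s t0 by auto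
  qed
qed

section \<open>Finite travel time\<close>

lemma finite_time_limit:
  assumes T: "T = ereal \<tau>"
  obtains l where "(u \<longlongrightarrow> l) (at_left \<tau>)" "l \<in> frontier \<Omega>" "G l \<noteq> 0" "(v \<longlongrightarrow> 0) (at_left \<tau>)"
proof -
  have \<tau>: "0 < \<tau>" using T_pos by (simp add: T)
  have "uniformly_continuous_on {0..<\<tau>} u"
  proof (rule lipschitz_on_uniformly_continuous[OF lipschitz_onI])
    fix s t assume st: "s \<in> {0..<\<tau>}" "t \<in> {0..<\<tau>}"
    show "dist (u s) (u t) \<le> M * dist s t"
      using lip[of s t] lip[of t s] st T
      by (cases "s \<le> t") (auto simp: dist_norm norm_minus_commute abs_if)
  qed (rule M_nonneg)
  moreover have "\<tau> \<in> closure {0..<\<tau>}" using \<tau> by (simp add: closure_atLeastLessThan)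
  ultimately obtain l where "(u \<longlongrightarrow> l) (at \<tau> within {0..<\<tau>})"
    by (rule uniformly_continuous_on_extension_at_closure)
  moreover have "at \<tau> within {0..<\<tau>} = at_left \<tau>"
    using \<tau> by (intro at_within_nhd[of _ "{0<..}"]) auto
  ultimately have l: "(u \<longlongrightarrow> l) (at_left \<tau>)" by simp
  have near: "\<forall>\<^sub>F t in at_left \<tau>. 0 < t \<and> t < \<tau>"
    using \<tau> eventually_at_left_real[of 0 \<tau>] by simp
  have lc: "l \<in> closure \<Omega>"
    by (rule Lim_in_closed_set[OF closed_closure _ _ l])
      (use near in \<open>auto elim!: eventually_mono intro!: u_closure simp: T\<close>)
  \<comment> \<open>The minimisers leave \<Omega> at times tending to \<tau> with speed at most
    \<open>M\<close>. Just before \<tau> they are close to \<open>u t\<close>, hence to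
    \<open>l\<close>, and so are their exit points; a ball around \<open>l\<close> inside \<Omega>
    is therefore impossible.\<close>
  have "l \<notin> \<Omega>"
  proof
    assume "l \<in> \<Omega>"
    then obtain d where d: "0 < d" "ball l d \<subseteq> \<Omega>" using openE[OF open_dom] by blast
    have "\<forall>\<^sub>F t in at_left \<tau>. dist (u t) l < d / 3" using d by (intro tendstoD[OF l]) simp
    moreover have "((\<lambda>t. M * (\<tau> - t)) \<longlongrightarrow> M * (\<tau> - \<tau>)) (at_left \<tau>)" by (intro tendsto_intros)
    then have "\<forall>\<^sub>F t in at_left \<tau>. M * (\<tau> - t) < d / 3" using d by (intro order_tendstoD(2)) auto
    ultimately have "\<forall>\<^sub>F t in at_left \<tau>. 0 < t \<and> t < \<tau> \<and> dist (u t) l < d / 3 \<and> M * (\<tau> - t) < d / 3"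
      using near by eventually_elim auto
    then obtain t where t: "0 < t" "t < \<tau>" "dist (u t) l < d / 3" "M * (\<tau> - t) < d / 3"
      using eventually_happens' trivial_limit_at_left_real by blast
    have tT: "ereal t < T" using t by (simp add: T)
    define k where "k n = nat \<lfloor>t / h n\<rfloor>" for n
    have k: "(\<lambda>n. h n * real (k n)) \<longlonglongrightarrow> t"
      unfolding k_def using t by (intro grid_tendsto[OF h_pos h_lim]) simp
    have xl: "(\<lambda>n. x n (k n)) \<longlonglongrightarrow> u t" using t by (intro conv_x[OF _ tT k]) simp
    have "(\<lambda>n. M * (h n * real (m n) - h n * real (k n))) \<longlonglongrightarrow> M * (\<tau> - t)"
      using hm unfolding T by (intro tendsto_intros k) (simp add: lim_ereal)
    then have "\<forall>\<^sub>F n in sequentially. M * (h n * real (m n) - h n * real (k n)) < d / 3"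
      by (rule order_tendstoD(2)) (rule t)
    moreover have "\<forall>\<^sub>F n in sequentially. dist (x n (k n)) (u t) < d / 3" using d by (intro tendstoD[OF xl]) simp
    moreover have "\<forall>\<^sub>F n in sequentially. k n < m n" by (rule before_exit[OF tT k])
    ultimately have "\<forall>\<^sub>F n in sequentially. False"
    proof eventually_elim
      case (elim n)
      have "dist (x n (m n)) (x n (k n)) < d / 3"
        using x_lipschitz[of "k n" "m n" n] elim by (simp add: dist_norm right_diff_distrib)
      then have "dist (x n (m n)) l < d"
        using elim(2) t(3) dist_triangle[of "x n (m n)" l "x n (k n)"] dist_triangle[of "x n (k n)" l "u t"]
        by linarith
      then show False using d exit[of n] by (auto simp: exit_at_def dist_commute)
    qed
    then show False by simp
  qed
  then have lf: "l \<in> frontier \<Omega>" using lc open_dom by (simp add: frontier_def interior_open)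
  \<comment> \<open>The exponential lower bound for the distance to a critical point stays positive
    in the limit because \<tau> is finite.\<close>
  have "G l \<noteq> 0"
  proof
    assume Gl: "G l = 0"
    have "exp (- (sqrt (2 * K) * \<tau>)) * norm l \<le> norm (l - l)"
    proof (rule tendsto_le[OF trivial_limit_at_left_real])
      show "((\<lambda>t. norm (u t - l)) \<longlongrightarrow> norm (l - l)) (at_left \<tau>)" by (intro tendsto_intros l)
      show "((\<lambda>t. exp (- (sqrt (2 * K) * t)) * norm l) \<longlongrightarrow> exp (- (sqrt (2 * K) * \<tau>)) * norm l) (at_left \<tau>)"
        by (intro tendsto_intros)
      show "\<forall>\<^sub>F t in at_left \<tau>. exp (- (sqrt (2 * K) * t)) * norm l \<le> norm (u t - l)"
        using near by eventually_elim (rule critical_distance[OF lf Gl], auto simp: T)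
    qed
    then show False using frontier_nonzero[OF lf] by (simp add: mult_le_0_iff)
  qed
  moreover have "(v \<longlongrightarrow> 0) (at_left \<tau>)"
  proof -
    have "((\<lambda>t. sqrt (2 * U (u t))) \<longlongrightarrow> sqrt (2 * U l)) (at_left \<tau>)"
      by (intro tendsto_intros continuous_on_tendsto_compose[OF U_cont[of UNIV] l]) auto
    then have "((\<lambda>t. sqrt (2 * U (u t))) \<longlongrightarrow> 0) (at_left \<tau>)" using zero_frontier[OF lf] by simp
    moreover have "\<forall>\<^sub>F t in at_left \<tau>. norm (v t) \<le> sqrt (2 * U (u t))"
      using near
    proof eventually_elim
      case (elim t)
      then have "2 * U (u t) = (norm (v t))\<^sup>2" using energy0[of t] by (simp add: T)
      then show ?case by simp
    qed
    ultimately show ?thesis by (rule Lim_null_comparison[rotated])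
  qed
  ultimately show ?thesis using l lf that by blast
qed

section \<open>Infinite travel time\<close>

lemma U_tends_0:
  assumes T: "T = \<infinity>"
  shows "((\<lambda>t. U (u t)) \<longlongrightarrow> 0) at_top"
proof (rule order_tendstoI)
  fix a :: real assume "a < 0"
  moreover have "0 \<le> U (u t)" if "0 \<le> t" for t using U_u_nonneg[OF that] by (simp add: T)
  ultimately show "\<forall>\<^sub>F t in at_top. a < U (u t)"
    by (intro eventually_mono[OF eventually_ge_at_top[of 0]]) (force intro: less_le_trans)
next
  fix a :: real assume a: "0 < a"
  define L where "L = K * (M + 1)"
  have L: "0 < L" using K_pos M_nonneg by (simp add: L_def)
  define d where "d = a / (2 * L)"
  have d: "0 < d" "L * d = a / 2" using a L by (simp_all add: d_def)
  \<comment> \<open>Only a vanishing amount of cost above \<open>I\<close> is left at late times,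
    but \<open>U \<ge> a\<close> at one time forces \<open>U \<ge> a / 2\<close> for a further time
    \<open>d\<close>, which uses up \<open>a * d\<close>. The infimum starts at time
    \<open>1\<close> because monotonicity of \<open>\<Phi>\<close> is available from positive times
    on.\<close>
  define I where "I = Inf (\<Phi> ` {1..})"
  have \<Phi>0: "0 \<le> \<Phi> t" if "0 \<le> t" for t using \<Phi>_nonneg[OF that] by (simp add: T)
  have bdd: "bdd_below (\<Phi> ` {1..})" by (intro bdd_belowI2[of _ 0] \<Phi>0) simp
  have "Inf (\<Phi> ` {1..}) < I + a * d" using a d by (simp add: I_def)
  from cInf_lessD[OF _ this] obtain s where s: "1 \<le> s" "\<Phi> s < I + a * d" by blast
  have "U (u t) < a" if t: "s \<le> t" for t
  proof (rule ccontr)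
    assume "\<not> U (u t) < a"
    then have Ut: "a \<le> U (u t)" by simp
    have "a / 2 \<le> U (u w)" if w: "t \<le> w" "w \<le> t + d" for w
    proof -
      have ball: "u w \<in> cball 0 R" "u t \<in> cball 0 R"
        using u_in_dom[of w] u_in_dom[of t] sub_ball s t w by (auto simp: T subset_iff)
      have "\<bar>U (u w) - U (u t)\<bar> \<le> K * norm (u w - u t)" by (rule U_lipschitz[OF ball])
      also have "\<dots> \<le> K * (M * (w - t))" using lip[of t w] s t w K_pos by (simp add: T)
      also have "\<dots> \<le> L * d"
        unfolding L_def mult.assoc using K_pos M_nonneg w d by (intro mult_left_mono mult_mono) auto
      finally show ?thesis using Ut d by linarith
    qed
    then have "\<Phi> (t + d) \<le> \<Phi> t - 2 * (a / 2) * ((t + d) - t)"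
      using s t d by (intro \<Phi>_drop) (auto simp: T)
    moreover have "\<Phi> t \<le> \<Phi> s" using s t by (intro \<Phi>_antimono) (auto simp: T)
    moreover have "I \<le> \<Phi> (t + d)" unfolding I_def using s t d by (intro cInf_lower bdd) auto
    ultimately show False using s by simp
  qed
  then show "\<forall>\<^sub>F t in at_top. U (u t) < a" by (auto simp: eventually_at_top_linorder)
qed

text \<open>
  With \<open>A = root 3 \<Phi>\<close> the bound \<open>\<Phi> \<le> C U sqrt U\<close> gives \<open>A' \<le> - const\<close> and \<open>\<bar>v\<bar> \<le> - const (A\<^sup>2)'\<close>: once \<open>\<Phi>\<close>
  is small the trajectory cannot leave a neighbourhood of \<open>q\<close>, and \<open>\<Phi>\<close> is used up in finite time.
\<close>

lemma regular_not_limit: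
  assumes T: "T = \<infinity>" and q: "q \<in> frontier \<Omega>" and Gq: "G q \<noteq> 0"
  obtains r where "0 < r" "\<forall>\<^sub>F t in at_top. u t \<notin> ball q r"
proof -
  obtain r C where r: "0 < r" and C: "0 < C"
    and B: "\<And>t. 0 \<le> t \<Longrightarrow> ereal t < T \<Longrightarrow> u t \<in> ball q r \<Longrightarrow> \<Phi> t \<le> C * (U (u t) * sqrt (U (u t)))"
    using remaining_near_regular[OF q Gq] by blast
  \<comment> \<open>With \<open>w = sqrt U\<close> the bound on \<open>\<Phi>\<close> reads
    \<open>A ^ 3 \<le> (c * w) ^ 3\<close>, that is, \<open>A \<le> c * w\<close>.\<close>
  define c where "c = root 3 C"
  have c: "0 < c" "c ^ 3 = C" using C by (simp_all add: c_def odd_real_root_pow)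
  define A where "A t = root 3 (\<Phi> t)" for t
  define w where "w t = sqrt (U (u t))" for t
  have Upos: "0 < U (u t)" if "0 \<le> t" for t using u_in_dom[of t] that pos by (simp add: T)
  have w: "0 < w t" "(w t)\<^sup>2 = U (u t)" if "0 \<le> t" for t
    using Upos[OF that] by (simp_all add: w_def)
  have d\<Phi>': "(\<Phi> has_real_derivative (- 2 * (w t)\<^sup>2)) (at t)" if "0 < t" for t
    unfolding has_real_derivative_iff_has_vector_derivative using d\<Phi>[OF that] that w(2)[of t] by (simp add: T)
  \<comment> \<open>\<open>\<Phi>\<close> is nonnegative and strictly decreasing, since
    \<open>U\<close> is positive along the trajectory. Positivity makes the cube root differentiable
    and is what exhaustion of \<open>\<Phi>\<close> will contradict.\<close>
  have \<Phi>pos: "0 < \<Phi> t" if t: "0 < t" for t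
  proof -
    have "\<Phi> (t + 1) < \<Phi> t"
    proof (rule DERIV_neg_imp_decreasing[of t "t + 1" \<Phi>])
      fix s assume s: "t \<le> s" "s \<le> t + 1"
      show "\<exists>y. (\<Phi> has_real_derivative y) (at s) \<and> y < 0"
        using d\<Phi>'[of s] w(1)[of s] s t by (intro exI conjI) auto
    qed simp
    then show ?thesis using \<Phi>_nonneg[of "t + 1"] t by (simp add: T)
  qed
  have A: "0 < A t" "A t ^ 3 = \<Phi> t" if "0 < t" for t
    using \<Phi>pos[OF that] by (simp_all add: A_def odd_real_root_pow)
  have dA: "(A has_real_derivative (- 2 * (w t)\<^sup>2 / (3 * (A t)\<^sup>2))) (at t)" if "0 < t" for t
  proof -
    have "(root 3 has_real_derivative inverse (real 3 * root 3 (\<Phi> t) ^ (3 - Suc 0))) (at (\<Phi> t))"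
      using \<Phi>pos[OF that] by (intro DERIV_real_root) auto
    from DERIV_chain2[OF this d\<Phi>'[OF that]]
    have "((\<lambda>t. root 3 (\<Phi> t)) has_real_derivative - 2 * (w t)\<^sup>2 / (3 * (root 3 (\<Phi> t))\<^sup>2)) (at t)"
      by (simp add: field_simps)
    then show ?thesis by (simp add: A_def[abs_def])
  qed
  have Aw: "A t \<le> c * w t" if "0 < t" "u t \<in> ball q r" for t
  proof -
    have "\<Phi> t \<le> C * (U (u t) * sqrt (U (u t)))" using that by (intro B) (auto simp: T)
    also have "\<dots> = C * ((w t)\<^sup>2 * w t)" using w(2)[of t] that by (simp add: w_def)
    also have "\<dots> = (c * w t) ^ 3" by (simp add: c(2)[symmetric] power3_eq_cube power2_eq_square)
    finally have "A t ^ Suc 2 \<le> (c * w t) ^ Suc 2" using A(2)[OF that(1)] by simp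
    then show ?thesis by (rule power_le_imp_le_base) (use c w(1)[of t] that in simp)
  qed
  have Arate: "- 2 * (w t)\<^sup>2 / (3 * (A t)\<^sup>2) \<le> - (2 / (3 * c\<^sup>2))" if "0 < t" "u t \<in> ball q r" for t
  proof -
    have "(A t)\<^sup>2 \<le> (c * w t)\<^sup>2" using Aw[OF that] A(1)[OF that(1)] by (intro power_mono) auto
    then show ?thesis using A(1)[OF that(1)] c by (simp add: field_simps power_mult_distrib)
  qed
  \<comment> \<open>Chosen so that the derivative of \<open>- \<beta> * A\<^sup>2\<close> is
    \<open>c * sqrt 2 * w\<^sup>2 / A\<close>, which dominates the speed \<open>sqrt 2 * w\<close>
    by \<open>A \<le> c * w\<close>.\<close>
  define \<beta> where "\<beta> = 3 * c * sqrt 2 / 4"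
  have \<beta>: "0 < \<beta>" using c by (simp add: \<beta>_def)
  have vel: "norm (v t) \<le> - (\<beta> * (2 * A t * (- 2 * (w t)\<^sup>2 / (3 * (A t)\<^sup>2))))"
    if "0 < t" "u t \<in> ball q r" for t
  proof -
    have "(norm (v t))\<^sup>2 = 2 * (w t)\<^sup>2" using energy0[of t] w(2)[of t] that by (simp add: T)
    then have "norm (v t) = sqrt (2 * (w t)\<^sup>2)" by (metis norm_ge_zero real_sqrt_unique)
    then have nv: "norm (v t) = sqrt 2 * w t" using w(1)[of t] that by (simp add: real_sqrt_mult)
    have a: "0 < A t" "A t \<le> c * w t" "0 < w t" using A Aw w that by auto
    have "A t * (sqrt 2 * w t) \<le> c * w t * (sqrt 2 * w t)" using a by (intro mult_right_mono) auto
    then have "sqrt 2 * w t \<le> c * sqrt 2 * (w t)\<^sup>2 / A t"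
      using a by (simp add: field_simps power2_eq_square)
    also have "\<dots> = - (\<beta> * (2 * A t * (- 2 * (w t)\<^sup>2 / (3 * (A t)\<^sup>2))))"
      using a by (simp add: \<beta>_def field_simps power2_eq_square)
    finally show ?thesis unfolding nv .
  qed
  have dA2: "((\<lambda>t. - (\<beta> * (A t)\<^sup>2)) has_real_derivative - (\<beta> * (2 * A t * (- 2 * (w t)\<^sup>2 / (3 * (A t)\<^sup>2))))) (at t)"
    if "0 < t" for t
    by (auto intro!: derivative_eq_intros dA[OF that])
  have False if freq: "\<exists>\<^sub>F t in at_top. u t \<in> ball q (r / 2)"
  proof -
    \<comment> \<open>\<open>U < e\<^sup>2\<close> gives
      \<open>A < sqrt (r / (2 * \<beta>))\<close>, so the length \<open>\<beta> * A\<^sup>2\<close>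
      available for travel is below \<open>r / 2\<close>.\<close>
    define e where "e = sqrt (r / (2 * \<beta>)) / c"
    have e: "0 < e" using r \<beta> c by (simp add: e_def)
    have eU: "\<forall>\<^sub>F t in at_top. U (u t) < e\<^sup>2" by (rule order_tendstoD(2)[OF U_tends_0[OF T]]) (use e in simp)
    have "\<exists>\<^sub>F t in at_top. u t \<in> ball q (r / 2) \<and> U (u t) < e\<^sup>2 \<and> 1 \<le> t"
      by (rule frequently_eventually_frequently[OF freq eventually_conj[OF eU eventually_ge_at_top]])
    then obtain t1 where t1: "u t1 \<in> ball q (r / 2)" "U (u t1) < e\<^sup>2" "1 \<le> t1"
      using frequently_ex by blast
    have t1r: "u t1 \<in> ball q r" using t1 r by simp
    have "w t1 < e" unfolding w_def using t1(2) e by (intro real_less_lsqrt) auto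
    then have "A t1 < sqrt (r / (2 * \<beta>))"
      using Aw[OF _ t1r] t1 c unfolding e_def by (fastforce simp: field_simps)
    then have "(A t1)\<^sup>2 < (sqrt (r / (2 * \<beta>)))\<^sup>2" using A(1)[of t1] t1 by (intro power_strict_mono) auto
    then have A1: "\<beta> * (A t1)\<^sup>2 < r / 2" using r \<beta> by (simp add: field_simps)
    have inside: "u t \<in> ball q r" if t: "t1 \<le> t" for t
    proof (rule ccontr)
      assume t_out: "u t \<notin> ball q r"
      \<comment> \<open>The least element of \<open>S\<close> is the first exit time from the ball;
        up to it the speed estimate holds, and the distance covered is too short for an
        exit.\<close>
      define S where "S = {s \<in> {t1..t}. r \<le> dist (u s) q}"
      have cont: "continuous_on {t1..t} u"
        by (rule continuous_on_subset[OF u_continuous[of t]]) (use t1 in \<open>auto simp: T\<close>)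
      have "compact S"
        unfolding S_def using continuous_closed_preimage[OF continuous_on_dist[OF cont continuous_on_const] closed_atLeastAtMost closed_atLeast, of q r]
        by (intro compact_eq_bounded_closed[THEN iffD2] conjI bounded_subset[OF bounded_closed_interval])
           (auto simp: vimage_def Int_def conj_commute)
      moreover have "t \<in> S" using t t_out by (simp add: S_def dist_commute)
      ultimately obtain s where s: "s \<in> S" "\<And>z. z \<in> S \<Longrightarrow> s \<le> z"
        using compact_attains_inf[of S] by blast
      have st: "t1 \<le> s" "s \<le> t" "r \<le> dist (u s) q" using s by (auto simp: S_def)
      have "s \<noteq> t1" using st(3) t1r by (auto simp: dist_commute)
      then have ts: "t1 < s" using st by simp
      have before: "u z \<in> ball q r" if "t1 \<le> z" "z < s" for z
        using s(2)[of z] that st by (fastforce simp: S_def dist_commute)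
      have "norm (u s - u t1) \<le> - (\<beta> * (A s)\<^sup>2) - - (\<beta> * (A t1)\<^sup>2)"
      proof (rule differentiable_bound_general[OF ts])
        show "continuous_on {t1..s} u" by (rule continuous_on_subset[OF cont]) (use st in auto)
        show "continuous_on {t1..s} (\<lambda>t. - (\<beta> * (A t)\<^sup>2))"
          using t1 by (intro continuous_at_imp_continuous_on ballI DERIV_isCont[OF dA2]) auto
        fix z assume z: "t1 < z" "z < s"
        show "(u has_vector_derivative v z) (at z)" using z t1 by (intro du) (auto simp: T)
        show "((\<lambda>t. - (\<beta> * (A t)\<^sup>2)) has_vector_derivative - (\<beta> * (2 * A z * (- 2 * (w z)\<^sup>2 / (3 * (A z)\<^sup>2))))) (at z)"
          unfolding has_real_derivative_iff_has_vector_derivative[symmetric] using z t1 by (intro dA2) auto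
        show "norm (v z) \<le> - (\<beta> * (2 * A z * (- 2 * (w z)\<^sup>2 / (3 * (A z)\<^sup>2))))"
          using z t1 by (intro vel before) auto
      qed
      also have "\<dots> \<le> \<beta> * (A t1)\<^sup>2" using \<beta> by simp
      finally have "dist (u s) (u t1) < r / 2" using A1 by (simp add: dist_norm)
      then show False using st(3) t1(1) dist_triangle[of "u s" q "u t1"] by (simp add: dist_commute)
    qed
    \<comment> \<open>\<open>A\<close> falls at rate at least \<open>2 / (3 * c\<^sup>2)\<close>, so
      starting from \<open>A t1\<close> it could not stay positive up to \<open>t2\<close>.\<close>
    define t2 where "t2 = t1 + A t1 * (3 * c\<^sup>2 / 2)"
    have At1: "0 < A t1" using A t1 by simp
    then have t2: "t1 \<le> t2" using c by (simp add: t2_def)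
    have "A t2 + 2 / (3 * c\<^sup>2) * t2 \<le> A t1 + 2 / (3 * c\<^sup>2) * t1"
    proof (rule DERIV_nonpos_imp_nonincreasing[OF t2])
      fix z assume z: "t1 \<le> z" "z \<le> t2"
      have "((\<lambda>t. A t + 2 / (3 * c\<^sup>2) * t) has_real_derivative (- 2 * (w z)\<^sup>2 / (3 * (A z)\<^sup>2) + 2 / (3 * c\<^sup>2))) (at z)"
        using DERIV_add[OF dA[of z] DERIV_cmult[OF DERIV_ident, of "2 / (3 * c\<^sup>2)" z]] z t1 by simp
      then show "\<exists>y. ((\<lambda>t. A t + 2 / (3 * c\<^sup>2) * t) has_real_derivative y) (at z) \<and> y \<le> 0"
        using Arate[of z] inside[of z] z t1 by (intro exI conjI) auto
    qed
    moreover have "2 / (3 * c\<^sup>2) * (t2 - t1) = A t1" using c by (simp add: t2_def)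
    ultimately have "A t2 \<le> 0" by (simp add: right_diff_distrib)
    then show False using A(1)[of t2] t2 t1 by simp
  qed
  then have "\<forall>\<^sub>F t in at_top. u t \<notin> ball q (r / 2)" by (auto simp: frequently_def)
  then show ?thesis using that[of "r / 2"] r by simp
qed

text \<open>Away from critical frontier points, the closure of \<Omega> is compact and each of its
  points has a ball that the trajectory eventually avoids: inside \<Omega> because \<open>U\<close>
  tends to zero along \<open>u\<close>, on the frontier by regularity. Finitely many such balls
  suffice.\<close>

lemma infinite_time_near_critical:
  assumes T: "T = \<infinity>" and e: "0 < e"
  shows "\<forall>\<^sub>F t in at_top. \<exists>p \<in> {p \<in> frontier \<Omega>. G p = 0}. u t \<in> ball p e"
proof -
  let ?P = "{p \<in> frontier \<Omega>. G p = 0}"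
  define S where "S = closure \<Omega> - (\<Union>p\<in>?P. ball p e)"
  have "compact (closure \<Omega>)"
    using bounded_subset[OF bounded_cball sub_ball] by (simp add: compact_closure)
  then have S: "compact S" unfolding S_def by (intro compact_diff open_UN) auto
  have "\<exists>r>0. \<forall>\<^sub>F t in at_top. u t \<notin> ball y r" if y: "y \<in> S" for y
  proof (cases "y \<in> \<Omega>")
    case True
    then have Uy: "0 < U y" by (rule pos)
    have "isCont U y" using dU has_derivative_continuous by blast
    moreover have "0 < U y / 2" using Uy by simp
    ultimately obtain r where r: "0 < r" "\<And>z. dist z y < r \<Longrightarrow> dist (U z) (U y) < U y / 2"
      unfolding continuous_at_eps_delta by blast
    have "\<forall>\<^sub>F t in at_top. U (u t) < U y / 2"
      by (rule order_tendstoD(2)[OF U_tends_0[OF T]]) (use Uy in simp)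
    then have "\<forall>\<^sub>F t in at_top. u t \<notin> ball y r"
    proof eventually_elim
      case (elim t)
      then show ?case using r(2)[of "u t"] by (auto simp: dist_real_def dist_commute abs_if split: if_splits)
    qed
    then show ?thesis using r by blast
  next
    case False
    then have yf: "y \<in> frontier \<Omega>" using y open_dom by (auto simp: S_def frontier_def interior_open)
    have "G y \<noteq> 0"
    proof
      assume "G y = 0"
      then have "y \<in> (\<Union>p\<in>?P. ball p e)" using yf e by (intro UN_I[of y]) auto
      then show False using y by (simp add: S_def)
    qed
    then show ?thesis using regular_not_limit[OF T yf] by blast
  qed
  then obtain \<rho> where \<rho>: "\<And>y. y \<in> S \<Longrightarrow> 0 < \<rho> y" "\<And>y. y \<in> S \<Longrightarrow> \<forall>\<^sub>F t in at_top. u t \<notin> ball y (\<rho> y)"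
    by metis
  obtain F where F: "F \<subseteq> S" "finite F" "S \<subseteq> (\<Union>y\<in>F. ball y (\<rho> y))"
  proof (rule compactE_image[OF S, of S "\<lambda>y. ball y (\<rho> y)"])
    show "S \<subseteq> (\<Union>y\<in>S. ball y (\<rho> y))" using \<rho>(1) by force
  qed auto
  have "\<forall>\<^sub>F t in at_top. \<forall>y\<in>F. u t \<notin> ball y (\<rho> y)"
    using F \<rho>(2) by (intro eventually_ball_finite) auto
  with eventually_ge_at_top[of 0] show ?thesis
  proof eventually_elim
    case (elim t)
    then have "u t \<notin> S" using F(3) by blast
    moreover have "u t \<in> closure \<Omega>" using u_closure[of t] elim(1) by (simp add: T)
    ultimately show ?case by (auto simp: S_def)
  qed
qed

lemma infinite_time_limit:
  assumes T: "T = \<infinity>" and fin: "finite {p \<in> frontier \<Omega>. G p = 0}"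
  obtains p where "p \<in> frontier \<Omega>" "G p = 0" "(u \<longlongrightarrow> p) at_top"
proof -
  let ?P = "{p \<in> frontier \<Omega>. G p = 0}"
  have "\<exists>d>0. \<forall>p'\<in>?P. p' \<noteq> p \<longrightarrow> d \<le> dist p p'" for p
    using finite_set_avoid[OF fin, of p] by metis
  then obtain d where d: "\<And>p. 0 < d p" "\<And>p p'. p' \<in> ?P \<Longrightarrow> p' \<noteq> p \<Longrightarrow> d p \<le> dist p p'" by metis
  \<comment> \<open>Half the least separation makes the balls around distinct critical points
    disjoint; inserting \<open>1\<close> keeps the minimum meaningful in every case.\<close>
  define \<delta> where "\<delta> = Min (insert 1 (d ` ?P)) / 2"
  have \<delta>: "0 < \<delta>" unfolding \<delta>_def using fin d(1) by simp
  have sep: "2 * \<delta> \<le> dist p p'" if "p \<in> ?P" "p' \<in> ?P" "p' \<noteq> p" for p p'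
  proof -
    have "2 * \<delta> \<le> d p" unfolding \<delta>_def using fin that by simp
    then show ?thesis using d(2)[of p' p] that by simp
  qed
  obtain t0 where t0: "\<And>t. t0 \<le> t \<Longrightarrow> \<exists>p\<in>?P. u t \<in> ball p \<delta>"
    using infinite_time_near_critical[OF T \<delta>] by (auto simp: eventually_at_top_linorder)
  define a where "a = max t0 0"
  obtain p where p: "p \<in> ?P" "u a \<in> ball p \<delta>" using t0[of a] by (auto simp: a_def)
  \<comment> \<open>Connectedness of the trajectory forbids passing from one of the disjoint balls
    to another.\<close>
  have stay: "u t \<in> ball p \<delta>" if t: "a \<le> t" for t
  proof (rule ccontr)
    assume out: "u t \<notin> ball p \<delta>"
    have "connected (u ` {a..t})"
      by (intro connected_continuous_image continuous_on_subset[OF u_continuous[of t]])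
         (auto simp: T a_def)
    moreover have "u ` {a..t} \<subseteq> ball p \<delta> \<union> (\<Union>p'\<in>?P - {p}. ball p' \<delta>)"
    proof
      fix y assume "y \<in> u ` {a..t}"
      then obtain z where "y = u z" "t0 \<le> z" by (auto simp: a_def)
      then show "y \<in> ball p \<delta> \<union> (\<Union>p'\<in>?P - {p}. ball p' \<delta>)" using t0[of z] by blast
    qed
    moreover have "ball p \<delta> \<inter> (\<Union>p'\<in>?P - {p}. ball p' \<delta>) \<inter> u ` {a..t} = {}"
    proof -
      have "False" if "dist p y < \<delta>" "dist p' y < \<delta>" "p' \<in> ?P - {p}" for p' y
        using sep[OF p(1), of p'] that dist_triangle2[of p p' y] by auto
      then show ?thesis by (fastforce simp: ball_def)
    qed
    ultimately have "ball p \<delta> \<inter> u ` {a..t} = {} \<or> (\<Union>p'\<in>?P - {p}. ball p' \<delta>) \<inter> u ` {a..t} = {}"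
      by (intro connectedD) auto
    moreover have "u a \<in> ball p \<delta> \<inter> u ` {a..t}" using p t by auto
    moreover have "u t \<in> (\<Union>p'\<in>?P - {p}. ball p' \<delta>) \<inter> u ` {a..t}"
    proof -
      obtain p' where p': "p' \<in> ?P" "u t \<in> ball p' \<delta>" using t0[of t] t by (auto simp: a_def)
      have "p' \<noteq> p" using out p' by auto
      moreover have "u t \<in> u ` {a..t}" using t by simp
      ultimately show ?thesis using p' by (intro IntI UN_I[of p']) auto
    qed
    ultimately show False by blast
  qed
  have "(u \<longlongrightarrow> p) at_top"
  proof (rule tendstoI)
    fix e :: real assume e: "0 < e"
    have "\<forall>\<^sub>F t in at_top. \<exists>p'\<in>?P. u t \<in> ball p' (min e \<delta>)"
      using e \<delta> by (intro infinite_time_near_critical[OF T]) auto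
    then show "\<forall>\<^sub>F t in at_top. dist (u t) p < e"
      using eventually_ge_at_top[of a]
    proof eventually_elim
      case (elim t)
      then obtain p' where p': "p' \<in> ?P" "dist p' (u t) < min e \<delta>" by auto
      have "dist p (u t) < \<delta>" using stay[OF elim(2)] by simp
      then have "p' = p" using sep[OF p(1) p'(1)] p'(2) dist_triangle2[of p p' "u t"] by fastforce
      then show ?case using p' by (simp add: dist_commute)
    qed
  qed
  then show ?thesis using that p(1) by blast
qed

text \<open>
  Letting the height \<open>\<epsilon> n\<close> of the tents tend to zero keeps the varied paths inside \<open>\<Omega>\<close>, although no
  uniform distance to the boundary is available.
\<close>

lemma no_concave_direction_at_limit:
  assumes T: "T = \<infinity>" and p: "(u \<longlongrightarrow> p) at_top"
    and e: "norm e = 1" and \<mu>: "0 < \<mu>" and r: "0 < r"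
    and conc: "\<And>y s. y \<in> ball p r \<Longrightarrow> 0 \<le> s \<Longrightarrow> s \<le> r \<Longrightarrow> U (y + s *\<^sub>R e) \<le> U y + s * (G y \<bullet> e) - \<mu> * s\<^sup>2"
  shows False
proof -
  \<comment> \<open>Then \<open>\<mu> * L\<^sup>2 = \<mu> + 2 + 1 / \<mu>\<close> exceeds
    \<open>1\<close>, contradicting the bound from the second variation for tents with
    \<open>h * M \<ge> L\<close>.\<close>
  define L where "L = 1 + 1 / \<mu>"
  have L: "0 < L" using \<mu> by (simp add: L_def add_pos_pos)
  have "1 < \<mu> * L\<^sup>2"
  proof -
    have "\<mu> * L\<^sup>2 = \<mu> + 2 + 1 / \<mu>" using \<mu> by (simp add: L_def power2_eq_square field_simps)
    moreover have "0 < 1 / \<mu>" using \<mu> by simp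
    ultimately show ?thesis using \<mu> by linarith
  qed
  obtain t0 where t0: "0 \<le> t0" "\<And>t. t0 \<le> t \<Longrightarrow> u t \<in> ball p r"
  proof -
    have "\<forall>\<^sub>F t in at_top. dist (u t) p < r" by (rule tendstoD[OF p r])
    then obtain t1 where "\<And>t. t1 \<le> t \<Longrightarrow> dist (u t) p < r" by (auto simp: eventually_at_top_linorder)
    then show ?thesis by (intro that[of "max t1 0"]) (auto simp: dist_commute)
  qed
  define a where "a n = nat \<lfloor>t0 / h n\<rfloor>" for n
  have a: "(\<lambda>n. h n * real (a n)) \<longlonglongrightarrow> t0" unfolding a_def by (rule grid_tendsto[OF h_pos h_lim t0(1)])
  define b where "b n = nat \<lceil>L / h n\<rceil>" for n
  have b_bounds: "L \<le> h n * real (b n)" "h n * real (b n) \<le> L + h n" for n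
  proof -
    have "0 < L / h n" using L h_pos[of n] by simp
    then have "real (b n) = of_int \<lceil>L / h n\<rceil>" by (simp add: b_def)
    then have "L / h n \<le> real (b n)" "real (b n) \<le> L / h n + 1" by linarith+
    then show "L \<le> h n * real (b n)" "h n * real (b n) \<le> L + h n"
      using h_pos[of n] by (simp_all add: field_simps)
  qed
  have b: "(\<lambda>n. h n * real (b n)) \<longlonglongrightarrow> L"
  proof (rule tendsto_sandwich[of "\<lambda>n. L" _ _ "\<lambda>n. L + h n"])
    show "(\<lambda>n. L + h n) \<longlonglongrightarrow> L" using tendsto_add[OF tendsto_const h_lim, of L] by simp
  qed (use b_bounds in auto)
  have b_pos: "0 < b n" for n using b_bounds(1)[of n] L by (cases "b n") auto
  have "(\<lambda>n. h n * real (a n) + 4 * (h n * real (b n))) \<longlonglongrightarrow> t0 + 4 * L"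
    by (intro tendsto_intros a b)
  then have ab: "(\<lambda>n. h n * real (a n + 4 * b n)) \<longlonglongrightarrow> t0 + 4 * L" by (simp add: algebra_simps)
  define \<epsilon> where "\<epsilon> n = 1 / real (Suc n)" for n
  have \<epsilon>: "0 < \<epsilon> n" for n by (simp add: \<epsilon>_def)
  have "\<forall>\<^sub>F n in sequentially. a n + 4 * b n < m n" by (rule before_exit[OF _ ab]) (simp add: T)
  then obtain n0 where n0: "\<And>n. n0 \<le> n \<Longrightarrow> a n + 4 * b n < m n" by (auto simp: eventually_sequentially)
  \<comment> \<open>The tents are wide enough to contradict minimality, so for each large
    \<open>n\<close> the containment and concavity hypothesis must fail at some index
    \<open>k\<close> and height \<open>s\<close>.\<close>
  have "\<exists>k s. a n \<le> k \<and> k \<le> a n + 4 * b n \<and> 0 \<le> s \<and> s \<le> 2 * \<epsilon> n * (h n * real (b n)) \<and>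
      \<not> (x n k + s *\<^sub>R e \<in> \<Omega> \<and> U (x n k + s *\<^sub>R e) \<le> U (x n k) + s * (G (x n k) \<bullet> e) - \<mu> * s\<^sup>2)"
    if n: "n0 \<le> n" for n
  proof (rule ccontr)
    assume "\<not> ?thesis"
    then have "\<mu> * (h n * real (b n))\<^sup>2 \<le> 1"
      by (intro tent_variation[OF min exit b_pos n0[OF n] e \<epsilon>[of n] _ \<mu>]) blast
    moreover have "\<mu> * L\<^sup>2 \<le> \<mu> * (h n * real (b n))\<^sup>2"
      using \<mu> L b_bounds(1)[of n] by (intro mult_left_mono power_mono) auto
    ultimately show False using \<open>1 < \<mu> * L\<^sup>2\<close> by linarith
  qed
  then obtain k s where k: "\<And>n. n0 \<le> n \<Longrightarrow> a n \<le> k n" "\<And>n. n0 \<le> n \<Longrightarrow> k n \<le> a n + 4 * b n"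
    and s: "\<And>n. n0 \<le> n \<Longrightarrow> 0 \<le> s n" "\<And>n. n0 \<le> n \<Longrightarrow> s n \<le> 2 * \<epsilon> n * (h n * real (b n))"
    and bad: "\<And>n. n0 \<le> n \<Longrightarrow> \<not> (x n (k n) + s n *\<^sub>R e \<in> \<Omega> \<and>
        U (x n (k n) + s n *\<^sub>R e) \<le> U (x n (k n)) + s n * (G (x n (k n)) \<bullet> e) - \<mu> * (s n)\<^sup>2)"
    by metis
  have hk: "h n * real (a n) \<le> h n * real (k n)" "h n * real (k n) \<le> h n * real (a n + 4 * b n)" if "n0 \<le> n" for n
    using k[OF that] h_pos[of n] by (simp_all del: of_nat_add)
  obtain H where H: "\<And>n. norm (h n * real (a n + 4 * b n)) \<le> H"
    using convergent_imp_Bseq[OF convergentI[OF ab]] by (auto simp: Bseq_def)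
  have Icc: "\<forall>n. h (n + n0) * real (k (n + n0)) \<in> {0..H}"
  proof
    fix n
    have "h (n + n0) * real (k (n + n0)) \<le> H"
      using hk(2)[of "n + n0"] H[of "n + n0"] unfolding real_norm_def by linarith
    then show "h (n + n0) * real (k (n + n0)) \<in> {0..H}" using h_pos[of "n + n0"] by simp
  qed
  \<comment> \<open>The times of the failures accumulate at some finite \<open>t \<ge> t0\<close>.
    There the paths converge to \<open>u t\<close>, an interior point of \<Omega> near
    \<open>p\<close>, while the heights tend to zero; hence neither part of the hypothesis can fail
    in the limit.\<close>
  obtain t \<sigma> where \<sigma>: "strict_mono (\<sigma> :: nat \<Rightarrow> nat)"
      "((\<lambda>n. h (n + n0) * real (k (n + n0))) \<circ> \<sigma>) \<longlonglongrightarrow> t"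
    using seq_compactE[OF compact_imp_seq_compact[OF compact_Icc] Icc] by blast
  define \<rho> where "\<rho> n = \<sigma> n + n0" for n
  have \<rho>: "strict_mono \<rho>" "\<And>n. n0 \<le> \<rho> n" using \<sigma>(1) by (auto simp: \<rho>_def strict_mono_def)
  have sub: "(\<lambda>n. f (\<rho> n)) \<longlonglongrightarrow> (l::real)" if "f \<longlonglongrightarrow> l" for f l
    using LIMSEQ_subseq_LIMSEQ[OF that \<rho>(1)] by (simp add: o_def)
  have kt: "(\<lambda>n. h (\<rho> n) * real (k (\<rho> n))) \<longlonglongrightarrow> t" using \<sigma>(2) by (simp add: o_def \<rho>_def)
  have t: "t0 \<le> t"
    by (rule LIMSEQ_le[OF sub[OF a] kt]) (use hk \<rho>(2) in blast)
  have tT: "0 \<le> t" "ereal t < T" using t t0 by (auto simp: T)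
  have "k (\<rho> n) < m (\<rho> n)" for n using n0[OF \<rho>(2)] k(2)[OF \<rho>(2)] by (rule order_le_less_trans[rotated])
  then have xl: "(\<lambda>n. x (\<rho> n) (k (\<rho> n))) \<longlonglongrightarrow> u t" by (intro conv_x_subseq \<rho> tT kt)
  have "(\<lambda>n. 2 * \<epsilon> n * (h n * real (b n))) \<longlonglongrightarrow> 2 * 0 * L"
    unfolding \<epsilon>_def by (intro tendsto_intros b LIMSEQ_Suc lim_1_over_n)
  then have up: "(\<lambda>n. 2 * \<epsilon> (\<rho> n) * (h (\<rho> n) * real (b (\<rho> n)))) \<longlonglongrightarrow> 0"
    using sub by fastforce
  have sl: "(\<lambda>n. s (\<rho> n)) \<longlonglongrightarrow> 0"
    by (rule tendsto_sandwich[OF _ _ tendsto_const up]) (use s \<rho>(2) in auto)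
  have "(\<lambda>n. x (\<rho> n) (k (\<rho> n)) + s (\<rho> n) *\<^sub>R e) \<longlonglongrightarrow> u t + 0 *\<^sub>R e"
    by (intro tendsto_intros xl sl)
  then have "\<forall>\<^sub>F n in sequentially. x (\<rho> n) (k (\<rho> n)) + s (\<rho> n) *\<^sub>R e \<in> \<Omega>"
    by (rule topological_tendstoD) (use open_dom u_in_dom[OF tT] in auto)
  moreover have "\<forall>\<^sub>F n in sequentially. x (\<rho> n) (k (\<rho> n)) \<in> ball p r"
    by (rule topological_tendstoD[OF xl open_ball t0(2)[OF t]])
  moreover have "\<forall>\<^sub>F n in sequentially. s (\<rho> n) < r" by (rule order_tendstoD(2)[OF sl r])
  ultimately have "\<forall>\<^sub>F n in sequentially. False"
  proof eventually_elim
    case (elim n)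
    then show False using bad[OF \<rho>(2)[of n]] conc[OF elim(2) s(1)[OF \<rho>(2)]] by auto
  qed
  then show False by simp
qed

end

section \<open>Functions of class C2\<close>

lemma has_real_derivative_along_line:
  fixes U :: "'a::euclidean_space \<Rightarrow> real"
  assumes dU: "\<And>x. (U has_derivative (\<lambda>w. G x \<bullet> w)) (at x)"
  shows "((\<lambda>t. U (p + t *\<^sub>R a)) has_real_derivative (G (p + t *\<^sub>R a) \<bullet> a)) (at t)"
proof -
  have "((\<lambda>t. p + t *\<^sub>R a) has_derivative (\<lambda>t. t *\<^sub>R a)) (at t)"
    by (auto intro!: derivative_eq_intros)
  from has_derivative_compose[OF this dU] show ?thesis
    by (simp add: has_field_derivative_def mult.commute[of _ "G (p + t *\<^sub>R a) \<bullet> a"])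
qed

text \<open>The increment in direction \<open>b\<close> is treated as a function of the displacement
  along \<open>a\<close>. The mean value theorem leaves a difference of two gradients, and
  differentiability of \<open>G\<close> at the single point \<open>p\<close> evaluates it; the two
  expansions produce the error factor \<open>2 * norm a + norm b\<close>.\<close>

lemma mixed_difference_quotient:
  fixes U :: "'a::euclidean_space \<Rightarrow> real" and G H :: "'a \<Rightarrow> 'a"
  assumes dU: "\<And>x. (U has_derivative (\<lambda>w. G x \<bullet> w)) (at x)"
    and dG: "(G has_derivative H) (at p)" and \<epsilon>: "0 < \<epsilon>"
  obtains s0 where "0 < s0" "\<And>s. 0 < s \<Longrightarrow> s < s0 \<Longrightarrow>
    \<bar>U (p + s *\<^sub>R a + s *\<^sub>R b) - U (p + s *\<^sub>R a) - U (p + s *\<^sub>R b) + U p - s\<^sup>2 * (a \<bullet> H b)\<bar>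
      \<le> s\<^sup>2 * (\<epsilon> * (norm a * (2 * norm a + norm b)))"
proof -
  interpret H: bounded_linear H using dG by (rule has_derivative_bounded_linear)
  obtain d where d: "0 < d" "\<And>y. norm (y - p) < d \<Longrightarrow> norm (G y - G p - H (y - p)) \<le> \<epsilon> * norm (y - p)"
    using dG \<epsilon> unfolding has_derivative_at_alt by blast
  define s0 where "s0 = d / (norm a + norm b + 1)"
  have n1: "0 < norm a + norm b + 1" by (simp add: add_nonneg_pos)
  show ?thesis
  proof (rule that)
    show "0 < s0" using d n1 by (simp add: s0_def)
    fix s assume s: "0 < s" "s < s0"
    have sd: "s * norm a + s * norm b < d"
    proof -
      have "s * (norm a + norm b + 1) < d" using s n1 by (simp add: s0_def pos_less_divide_eq)
      then show ?thesis using s by (simp add: algebra_simps)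
    qed
    define \<phi> where "\<phi> t = U (p + t *\<^sub>R a + s *\<^sub>R b) - U (p + t *\<^sub>R a)" for t
    have "(\<phi> has_real_derivative (G (p + t *\<^sub>R a + s *\<^sub>R b) \<bullet> a - G (p + t *\<^sub>R a) \<bullet> a)) (at t)" for t
      unfolding has_field_derivative_def \<phi>_def
      by (rule derivative_eq_intros has_derivative_compose[OF _ dU] refl)+ (auto simp: algebra_simps)
    then obtain t where t: "0 < t" "t < s"
      "\<phi> s - \<phi> 0 = (s - 0) * (G (p + t *\<^sub>R a + s *\<^sub>R b) \<bullet> a - G (p + t *\<^sub>R a) \<bullet> a)"
      using MVT2[OF s(1), of \<phi> "\<lambda>t. G (p + t *\<^sub>R a + s *\<^sub>R b) \<bullet> a - G (p + t *\<^sub>R a) \<bullet> a"] by blast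
    define z where "z = p + t *\<^sub>R a"
    define y where "y = z + s *\<^sub>R b"
    have ta: "t * norm a \<le> s * norm a" using t by (intro mult_right_mono) auto
    have ny: "norm (y - p) \<le> s * norm a + s * norm b"
      using norm_triangle_ineq[of "t *\<^sub>R a" "s *\<^sub>R b"] ta s t by (simp add: y_def z_def add.assoc)
    have nz: "norm (z - p) \<le> s * norm a" using ta t by (simp add: z_def)
    have "0 \<le> s * norm b" using s by simp
    then have "norm (z - p) < d" using nz sd by linarith
    then have 1: "norm (G z - G p - H (z - p)) \<le> \<epsilon> * (s * norm a)"
      using d(2)[of z] mult_left_mono[OF nz, of \<epsilon>] \<epsilon> by linarith
    have "norm (y - p) < d" using ny sd by linarith
    then have 2: "norm (G y - G p - H (y - p)) \<le> \<epsilon> * (s * norm a + s * norm b)"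
      using d(2)[of y] mult_left_mono[OF ny, of \<epsilon>] \<epsilon> by linarith
    have Hd: "H (y - p) - H (z - p) = s *\<^sub>R H b"
      by (simp add: H.diff[symmetric] H.scaleR[symmetric] y_def z_def)
    have "G y - G z - s *\<^sub>R H b = (G y - G p - H (y - p)) - (G z - G p - H (z - p))"
      unfolding Hd[symmetric] by simp
    also have "norm \<dots> \<le> \<epsilon> * (s * norm a + s * norm b) + \<epsilon> * (s * norm a)"
      by (intro order_trans[OF norm_triangle_ineq4] add_mono 1 2)
    also have "\<dots> = s * (\<epsilon> * (2 * norm a + norm b))" by (simp add: algebra_simps)
    finally have 3: "norm (G y - G z - s *\<^sub>R H b) \<le> s * (\<epsilon> * (2 * norm a + norm b))" .
    have "U (p + s *\<^sub>R a + s *\<^sub>R b) - U (p + s *\<^sub>R a) - U (p + s *\<^sub>R b) + U p - s\<^sup>2 * (a \<bullet> H b)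
        = \<phi> s - \<phi> 0 - s\<^sup>2 * (a \<bullet> H b)" by (simp add: \<phi>_def)
    also have "\<dots> = s * ((G y - G z - s *\<^sub>R H b) \<bullet> a)"
      unfolding t(3) z_def[symmetric] unfolding y_def[symmetric]
      by (simp add: inner_diff_left inner_commute power2_eq_square algebra_simps)
    also have "\<bar>\<dots>\<bar> \<le> s * (s * (\<epsilon> * (2 * norm a + norm b)) * norm a)"
      unfolding abs_mult using s order_trans[OF Cauchy_Schwarz_ineq2 mult_right_mono[OF 3 norm_ge_zero]]
      by (simp add: mult_left_mono)
    finally show "\<bar>U (p + s *\<^sub>R a + s *\<^sub>R b) - U (p + s *\<^sub>R a) - U (p + s *\<^sub>R b) + U p - s\<^sup>2 * (a \<bullet> H b)\<bar>
      \<le> s\<^sup>2 * (\<epsilon> * (norm a * (2 * norm a + norm b)))" by (simp add: power2_eq_square mult_ac)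
  qed
qed

text \<open>The mixed second difference is symmetric in \<open>a\<close> and \<open>b\<close>, so
  both bilinear expressions approximate the same quantity.\<close>

lemma second_derivative_symmetric:
  fixes U :: "'a::euclidean_space \<Rightarrow> real" and G H :: "'a \<Rightarrow> 'a"
  assumes dU: "\<And>x. (U has_derivative (\<lambda>w. G x \<bullet> w)) (at x)"
    and dG: "(G has_derivative H) (at p)"
  shows "a \<bullet> H b = b \<bullet> H a"
proof (rule ccontr)
  assume ne: "a \<bullet> H b \<noteq> b \<bullet> H a"
  \<comment> \<open>The sum of the two error factors plus one, so that the total error is strictly
    below the supposed gap.\<close>
  define c where "c = norm a * (2 * norm a + norm b) + norm b * (2 * norm b + norm a) + 1"
  have c: "0 < c" unfolding c_def by (intro add_nonneg_pos add_nonneg_nonneg mult_nonneg_nonneg) auto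
  define \<epsilon> where "\<epsilon> = \<bar>a \<bullet> H b - b \<bullet> H a\<bar> / c"
  have \<epsilon>: "0 < \<epsilon>" using ne c by (simp add: \<epsilon>_def)
  obtain s1 where s1: "0 < s1" "\<And>s. 0 < s \<Longrightarrow> s < s1 \<Longrightarrow>
    \<bar>U (p + s *\<^sub>R a + s *\<^sub>R b) - U (p + s *\<^sub>R a) - U (p + s *\<^sub>R b) + U p - s\<^sup>2 * (a \<bullet> H b)\<bar>
      \<le> s\<^sup>2 * (\<epsilon> * (norm a * (2 * norm a + norm b)))"
    using mixed_difference_quotient[OF dU dG \<epsilon>] by blast
  obtain s2 where s2: "0 < s2" "\<And>s. 0 < s \<Longrightarrow> s < s2 \<Longrightarrow>
    \<bar>U (p + s *\<^sub>R b + s *\<^sub>R a) - U (p + s *\<^sub>R b) - U (p + s *\<^sub>R a) + U p - s\<^sup>2 * (b \<bullet> H a)\<bar>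
      \<le> s\<^sup>2 * (\<epsilon> * (norm b * (2 * norm b + norm a)))"
    using mixed_difference_quotient[OF dU dG \<epsilon>] by blast
  define s where "s = min s1 s2 / 2"
  have s: "0 < s" "s < s1" "s < s2" using s1 s2 by (auto simp: s_def)
  have comm: "p + s *\<^sub>R b + s *\<^sub>R a = p + s *\<^sub>R a + s *\<^sub>R b" by simp
  have "\<bar>s\<^sup>2 * (a \<bullet> H b) - s\<^sup>2 * (b \<bullet> H a)\<bar> \<le>
      s\<^sup>2 * (\<epsilon> * (norm a * (2 * norm a + norm b))) + s\<^sup>2 * (\<epsilon> * (norm b * (2 * norm b + norm a)))"
    using s1(2)[OF s(1,2)] s2(2)[OF s(1,3)] unfolding comm by linarith
  also have "\<dots> < s\<^sup>2 * (\<epsilon> * c)" using s \<epsilon> by (simp add: c_def algebra_simps)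
  also have "\<epsilon> * c = \<bar>a \<bullet> H b - b \<bullet> H a\<bar>" using c by (simp add: \<epsilon>_def)
  finally show False by (simp add: abs_mult flip: right_diff_distrib)
qed

lemma strict_local_minimum:
  fixes U :: "'a::euclidean_space \<Rightarrow> real" and G H :: "'a \<Rightarrow> 'a"
  assumes dU: "\<And>x. (U has_derivative (\<lambda>w. G x \<bullet> w)) (at x)"
    and dG: "(G has_derivative H) (at p)" and Gp: "G p = 0"
    and psd: "\<And>w. 0 \<le> w \<bullet> H w" and inj: "\<And>w. H w = 0 \<Longrightarrow> w = 0"
  obtains r where "0 < r" "\<And>x. x \<in> ball p r \<Longrightarrow> x \<noteq> p \<Longrightarrow> U p < U x"
proof -
  interpret H: bounded_linear H using dG by (rule has_derivative_bounded_linear)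
  \<comment> \<open>A null vector \<open>w\<close> of a semidefinite symmetric form lies in its
    kernel: otherwise the form becomes negative on moving from \<open>w\<close> slightly along
    \<open>- H w\<close>. Injectivity then forces \<open>w = 0\<close>.\<close>
  have pd: "0 < w \<bullet> H w" if "w \<noteq> 0" for w
  proof (rule ccontr)
    assume "\<not> 0 < w \<bullet> H w"
    then have w0: "w \<bullet> H w = 0" using psd[of w] by simp
    define y where "y = H w"
    define \<beta> where "\<beta> = y \<bullet> H y"
    have yy: "0 < y \<bullet> y" using inj[of w] that by (auto simp: y_def)
    have ineq: "0 \<le> 2 * t * (y \<bullet> y) + t\<^sup>2 * \<beta>" for t
    proof -
      have "w \<bullet> H y = y \<bullet> y" using second_derivative_symmetric[OF dU dG, of w y] by (simp add: y_def)
      then have "(w + t *\<^sub>R y) \<bullet> H (w + t *\<^sub>R y) = 2 * t * (y \<bullet> y) + t\<^sup>2 * \<beta>"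
        using w0 by (simp add: H.add H.scaleR inner_add_left inner_add_right \<beta>_def
            y_def[symmetric] power2_eq_square algebra_simps)
      then show ?thesis using psd by metis
    qed
    have \<beta>: "0 \<le> \<beta>" using psd[of y] by (simp add: \<beta>_def)
    \<comment> \<open>This gives \<open>t * \<beta> \<le> y \<bullet> y\<close>, so at
      \<open>- t\<close> the linear term outweighs the quadratic one; \<open>\<beta> + 1\<close>
      avoids a zero denominator.\<close>
    define t where "t = (y \<bullet> y) / (\<beta> + 1)"
    have t: "0 < t" using yy \<beta> by (simp add: t_def)
    have "t * \<beta> \<le> t * (\<beta> + 1)" using t by simp
    also have "t * (\<beta> + 1) = y \<bullet> y" using \<beta> by (simp add: t_def)
    finally have "t * (t * \<beta>) \<le> t * (y \<bullet> y)" using t by simp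
    moreover have "0 < t * (y \<bullet> y)" using t yy by simp
    ultimately show False using ineq[of "- t"] by (simp add: power2_eq_square)
  qed
  have cont: "continuous_on (sphere 0 1) (\<lambda>w. w \<bullet> H w)"
    by (intro continuous_intros H.continuous_on)
  have "sphere (0::'a) 1 \<noteq> {}" by simp
  then obtain w0 where w0: "w0 \<in> sphere 0 1" "\<And>w. w \<in> sphere 0 1 \<Longrightarrow> w0 \<bullet> H w0 \<le> w \<bullet> H w"
    using continuous_attains_inf[OF compact_sphere _ cont] by blast
  define c where "c = w0 \<bullet> H w0"
  have c: "0 < c" unfolding c_def using w0(1) by (intro pd) auto
  have coercive: "c * (norm w)\<^sup>2 \<le> w \<bullet> H w" for w
  proof (cases "w = 0")
    case False
    define y where "y = w /\<^sub>R norm w"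
    have w: "w = norm w *\<^sub>R y" using False by (simp add: y_def)
    have "c \<le> y \<bullet> H y" unfolding c_def using False by (intro w0(2)) (simp add: y_def)
    then have "(norm w)\<^sup>2 * c \<le> (norm w)\<^sup>2 * (y \<bullet> H y)" by (intro mult_left_mono) auto
    also have "\<dots> = (norm w *\<^sub>R y) \<bullet> H (norm w *\<^sub>R y)" by (simp add: H.scaleR power2_eq_square)
    finally show ?thesis unfolding w[symmetric] by (simp add: mult.commute)
  qed (simp add: H.zero)
  have "0 < c / 2" using c by simp
  then obtain r where r: "0 < r"
    "\<And>y. norm (y - p) < r \<Longrightarrow> norm (G y - G p - H (y - p)) \<le> c / 2 * norm (y - p)"
    using dG unfolding has_derivative_at_alt by blast
  \<comment> \<open>The linear part contributes at least \<open>c * |y - p|^2\<close> and the error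
    at most half of that, so \<open>U\<close> increases radially.\<close>
  have push: "0 < G y \<bullet> (y - p)" if "y \<in> ball p r" "y \<noteq> p" for y
  proof -
    have "norm (G y - H (y - p)) \<le> c / 2 * norm (y - p)"
      using r(2)[of y] that Gp by (simp add: dist_norm norm_minus_commute)
    then have "norm (G y - H (y - p)) * norm (y - p) \<le> c / 2 * norm (y - p) * norm (y - p)"
      by (rule mult_right_mono) simp
    then have "\<bar>(G y - H (y - p)) \<bullet> (y - p)\<bar> \<le> c / 2 * (norm (y - p))\<^sup>2"
      using Cauchy_Schwarz_ineq2[of "G y - H (y - p)" "y - p"] by (simp add: power2_eq_square)
    moreover have "(G y - H (y - p)) \<bullet> (y - p) = G y \<bullet> (y - p) - (y - p) \<bullet> H (y - p)"
      by (simp add: inner_diff_left inner_commute[of "H (y - p)"])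
    moreover have "0 < c / 2 * (norm (y - p))\<^sup>2" using c that by simp
    ultimately show ?thesis using coercive[of "y - p"] by linarith
  qed
  show ?thesis
  proof (rule that[OF r(1)])
    fix x assume x: "x \<in> ball p r" "x \<noteq> p"
    define \<phi> where "\<phi> t = U (p + t *\<^sub>R (x - p))" for t
    have "(\<phi> has_real_derivative (G (p + t *\<^sub>R (x - p)) \<bullet> (x - p))) (at t)" for t
      unfolding \<phi>_def by (rule has_real_derivative_along_line[OF dU])
    then obtain t where t: "0 < t" "t < 1" "\<phi> 1 - \<phi> 0 = (1 - 0) * (G (p + t *\<^sub>R (x - p)) \<bullet> (x - p))"
      using MVT2[of 0 1 \<phi> "\<lambda>t. G (p + t *\<^sub>R (x - p)) \<bullet> (x - p)"] by auto
    have "t * norm (x - p) \<le> 1 * norm (x - p)" using t by (intro mult_right_mono) auto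
    also have "\<dots> < r" using x by (simp add: dist_norm norm_minus_commute)
    finally have "p + t *\<^sub>R (x - p) \<in> ball p r" using t by (simp add: dist_norm)
    then have "0 < G (p + t *\<^sub>R (x - p)) \<bullet> (t *\<^sub>R (x - p))" using push[of "p + t *\<^sub>R (x - p)"] x t by simp
    then have "0 < G (p + t *\<^sub>R (x - p)) \<bullet> (x - p)" using t by (simp add: zero_less_mult_iff)
    then show "U p < U x" using t by (simp add: \<phi>_def)
  qed
qed

lemma uniformly_concave_direction:
  fixes U :: "'a::euclidean_space \<Rightarrow> real" and G :: "'a \<Rightarrow> 'a" and H :: "'a \<Rightarrow> 'a \<Rightarrow> 'a"
  assumes dU: "\<And>x. (U has_derivative (\<lambda>w. G x \<bullet> w)) (at x)"
    and dG: "\<And>x. (G has_derivative H x) (at x)"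
    and cont: "\<And>w. continuous_on UNIV (\<lambda>x. H x w)"
    and e: "norm e = 1" and neg: "e \<bullet> H p e < 0"
  obtains \<mu> r where "0 < \<mu>" "0 < r"
    "\<And>y s. y \<in> ball p r \<Longrightarrow> 0 \<le> s \<Longrightarrow> s \<le> r \<Longrightarrow> U (y + s *\<^sub>R e) \<le> U y + s * (G y \<bullet> e) - \<mu> * s\<^sup>2"
proof -
  \<comment> \<open>The second derivative is \<open>- 4 * \<mu>\<close> at \<open>p\<close> and by
    continuity at most \<open>- 2 * \<mu>\<close> nearby; integrating twice leaves
    \<open>- \<mu> * s\<^sup>2\<close>.\<close>
  define \<mu> where "\<mu> = - (e \<bullet> H p e) / 4"
  have \<mu>: "0 < \<mu>" using neg by (simp add: \<mu>_def)
  have "isCont (\<lambda>y. e \<bullet> H y e) p"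
    using cont[of e] by (intro continuous_intros) (simp add: continuous_on_eq_continuous_at)
  then obtain d where d: "0 < d" "\<And>y. dist y p < d \<Longrightarrow> dist (e \<bullet> H y e) (e \<bullet> H p e) < 2 * \<mu>"
    unfolding continuous_at_eps_delta using \<mu> by (meson mult_pos_pos zero_less_numeral)
  have curv: "e \<bullet> H y e \<le> - 2 * \<mu>" if "dist y p < d" for y
    using d(2)[OF that] by (simp add: dist_real_def \<mu>_def abs_less_iff)
  show ?thesis
  proof (rule that[OF \<mu>, of "d / 2"])
    show "0 < d / 2" using d by simp
    fix y s assume y: "y \<in> ball p (d / 2)" and s: "0 \<le> s" "s \<le> d / 2"
    have near: "dist (y + t *\<^sub>R e) p < d" if "0 \<le> t" "t \<le> s" for t
    proof -
      have "norm (y + t *\<^sub>R e - p) \<le> norm (y - p) + norm (t *\<^sub>R e)"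
        using norm_triangle_ineq[of "y - p" "t *\<^sub>R e"] by (simp add: algebra_simps)
      then show ?thesis using y s that e by (simp add: dist_norm norm_minus_commute)
    qed
    have slope: "G (y + t *\<^sub>R e) \<bullet> e + 2 * \<mu> * t \<le> G y \<bullet> e" if t: "0 \<le> t" "t \<le> s" for t
    proof -
      have "G (y + t *\<^sub>R e) \<bullet> e + 2 * \<mu> * t \<le> G (y + 0 *\<^sub>R e) \<bullet> e + 2 * \<mu> * 0"
      proof (rule DERIV_nonpos_imp_nonincreasing[OF t(1)])
        fix z assume z: "0 \<le> z" "z \<le> t"
        have lin: "linear (H (y + z *\<^sub>R e))" using dG has_derivative_linear by blast
        have "((\<lambda>t. G (y + t *\<^sub>R e) \<bullet> e + 2 * \<mu> * t) has_real_derivative (e \<bullet> H (y + z *\<^sub>R e) e + 2 * \<mu>)) (at z)"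
          unfolding has_field_derivative_def
          by (rule derivative_eq_intros has_derivative_compose[OF _ dG] refl)+
             (auto simp: linear_scale[OF lin] inner_commute algebra_simps)
        then show "\<exists>l. ((\<lambda>t. G (y + t *\<^sub>R e) \<bullet> e + 2 * \<mu> * t) has_real_derivative l) (at z) \<and> l \<le> 0"
          using curv[OF near[of z]] z t by (intro exI conjI) auto
      qed
      then show ?thesis by simp
    qed
    have "U (y + s *\<^sub>R e) - s * (G y \<bullet> e) + \<mu> * s\<^sup>2 \<le> U (y + 0 *\<^sub>R e) - 0 * (G y \<bullet> e) + \<mu> * 0\<^sup>2"
    proof (rule DERIV_nonpos_imp_nonincreasing[OF s(1)])
      fix z assume z: "0 \<le> z" "z \<le> s"
      have "((\<lambda>t. U (y + t *\<^sub>R e) - t * (G y \<bullet> e) + \<mu> * t\<^sup>2) has_real_derivative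
          (G (y + z *\<^sub>R e) \<bullet> e - G y \<bullet> e + \<mu> * (2 * z))) (at z)"
        unfolding has_field_derivative_def
        by (rule derivative_eq_intros has_derivative_compose[OF _ dU] refl)+ (auto simp: algebra_simps)
      then show "\<exists>l. ((\<lambda>t. U (y + t *\<^sub>R e) - t * (G y \<bullet> e) + \<mu> * t\<^sup>2) has_real_derivative l) (at z) \<and> l \<le> 0"
        using slope[OF z] by (intro exI conjI) auto
    qed
    then show "U (y + s *\<^sub>R e) \<le> U y + s * (G y \<bullet> e) - \<mu> * s\<^sup>2" by simp
  qed
qed

section \<open>Gradient and Hessian in coordinates\<close>

lemma class_C2_grad:
  assumes "class_C2 U"
  shows "(U has_derivative (\<lambda>w. grad U x \<bullet> w)) (at x)"
proof -
  have d: "(U has_derivative frechet_derivative U (at x)) (at x)"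
    using assms by (simp add: class_C2_def frechet_derivative_works)
  interpret D: bounded_linear "frechet_derivative U (at x)"
    using d by (rule has_derivative_bounded_linear)
  have "frechet_derivative U (at x) w = grad U x \<bullet> w" for w
  proof -
    have "frechet_derivative U (at x) w = frechet_derivative U (at x) (\<Sum>i\<in>UNIV. w $ i *\<^sub>R axis i 1)"
      using basis_expansion[of w] by (simp add: scalar_mult_eq_scaleR)
    also have "\<dots> = (\<Sum>i\<in>UNIV. w $ i * frechet_derivative U (at x) (axis i 1))"
      by (simp add: D.sum D.scaleR)
    also have "\<dots> = grad U x \<bullet> w" by (simp add: inner_vec_def grad_def mult.commute)
    finally show ?thesis .
  qed
  then show ?thesis using d by (metis ext)
qed

lemma class_C2_hessian:
  "class_C2 U \<Longrightarrow> (grad U has_derivative (\<lambda>w. hessian U x *v w)) (at x)"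
  unfolding class_C2_def hessian_def using jacobian_works by blast

lemma class_C2_hessian_continuous:
  assumes "class_C2 U"
  shows "continuous_on UNIV (\<lambda>x. hessian U x *v w)"
  using assms unfolding class_C2_def matrix_vector_mult_def by (auto intro!: continuous_intros)

lemma class_C2_grad_lipschitz_on_ball:
  fixes U :: "real ^ 'n \<Rightarrow> real"
  assumes C2: "class_C2 U"
  obtains K where "0 < K" "\<And>x. x \<in> cball 0 R \<Longrightarrow> norm (grad U x) \<le> K"
    "\<And>x y. x \<in> cball 0 R \<Longrightarrow> y \<in> cball 0 R \<Longrightarrow> norm (grad U x - grad U y) \<le> K * norm (x - y)"
proof -
  have contG: "continuous_on (cball 0 R) (grad U)"
    using class_C2_hessian[OF C2] has_derivative_continuous by (metis continuous_at_imp_continuous_on)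
  then have "bounded (grad U ` cball 0 R)"
    by (intro compact_imp_bounded compact_continuous_image) auto
  then obtain K1 where K1: "\<And>x. x \<in> cball 0 R \<Longrightarrow> norm (grad U x) \<le> K1"
    unfolding bounded_iff by blast
  \<comment> \<open>The sum of the absolute entries bounds the operator norm and inherits continuity
    from the entries.\<close>
  define f where "f x = (\<Sum>i\<in>UNIV. \<Sum>j\<in>UNIV. \<bar>hessian U x $ i $ j\<bar>)" for x
  have "continuous_on (cball 0 R) f"
    unfolding f_def using C2 unfolding class_C2_def
    by (auto intro!: continuous_intros intro: continuous_on_subset)
  then have "bounded (f ` cball 0 R)"
    by (intro compact_imp_bounded compact_continuous_image) auto
  then obtain K2 where K2: "\<And>x. x \<in> cball 0 R \<Longrightarrow> norm (f x) \<le> K2"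
    unfolding bounded_iff by blast
  define K where "K = max 1 (max K1 K2)"
  show ?thesis
  proof (rule that[of K])
    show "0 < K" by (simp add: K_def)
    show "norm (grad U x) \<le> K" if "x \<in> cball 0 R" for x using K1[OF that] by (simp add: K_def)
    show "norm (grad U x - grad U y) \<le> K * norm (x - y)" if "x \<in> cball 0 R" "y \<in> cball 0 R" for x y
    proof (rule differentiable_bound[OF convex_cball _ _ that])
      fix z assume z: "z \<in> cball (0 :: real ^ 'n) R"
      show "(grad U has_derivative (\<lambda>w. hessian U z *v w)) (at z within cball 0 R)"
        using class_C2_hessian[OF C2] by (rule has_derivative_at_withinI)
      have "onorm (\<lambda>w. hessian U z *v w) \<le> f z"
        unfolding f_def by (rule onorm_le_matrix_component_sum)
      also have "\<dots> \<le> K" using K2[OF z] unfolding K_def real_norm_def by linarith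
      finally show "onorm (\<lambda>w. hessian U z *v w) \<le> K" .
    qed
  qed
qed

section \<open>Components of the positivity set and of its frontier\<close>

lemma component_positive_set:
  fixes U :: "'a::euclidean_space \<Rightarrow> real"
  assumes cont: "continuous_on UNIV U" and comp: "\<Omega> \<in> components {x. U x > 0}"
  shows "open \<Omega>" "x \<in> \<Omega> \<Longrightarrow> U x > 0" "x \<in> frontier \<Omega> \<Longrightarrow> U x = 0"
proof -
  have "open {x. U x > 0}" using open_Collect_less[OF continuous_on_const cont] .
  then show op: "open \<Omega>" using comp by (rule open_components)
  show pos: "x \<in> \<Omega> \<Longrightarrow> U x > 0" for x using in_components_subset[OF comp] by auto
  show "x \<in> frontier \<Omega> \<Longrightarrow> U x = 0"
  proof -
    assume x: "x \<in> frontier \<Omega>"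
    then have xc: "x \<in> closure \<Omega>" "x \<notin> \<Omega>" using op by (auto simp: frontier_def interior_open)
    have "closed {x. 0 \<le> U x}" using closed_Collect_le[OF continuous_on_const cont] .
    then have "closure \<Omega> \<subseteq> {x. 0 \<le> U x}" using pos by (intro closure_minimal) force+
    then have "0 \<le> U x" using xc by auto
    \<comment> \<open>A component is relatively closed in the positivity set, so a frontier point
      with \<open>U x > 0\<close> would belong to the open set \<Omega>.\<close>
    moreover have "\<not> 0 < U x"
    proof
      assume "0 < U x"
      moreover have "x islimpt \<Omega>" using xc by (auto simp: closure_def)
      moreover have "closedin (top_of_set {x. U x > 0}) \<Omega>" using comp by (rule closedin_component)
      ultimately show False using xc by (auto simp: closedin_limpt)
    qed
    ultimately show "U x = 0" by simp
  qed
qed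

text \<open>A connected set with more than one point has no isolated points.\<close>

lemma frontier_component_singleton:
  fixes \<Omega> :: "'a::euclidean_space set"
  assumes "C \<in> components (frontier \<Omega>)" "p \<in> C" "0 < r"
    and iso: "\<And>x. x \<in> frontier \<Omega> \<Longrightarrow> x \<in> ball p r \<Longrightarrow> x = p"
  shows "C = {p}"
proof (rule ccontr)
  assume ne: "C \<noteq> {p}"
  then have "p islimpt C"
    using assms by (intro connected_imp_perfect in_components_connected[of C]) auto
  then obtain y where "y \<in> C" "y \<noteq> p" "y \<in> ball p r"
    using \<open>0 < r\<close> unfolding islimpt_approachable by (auto simp: dist_commute)
  then show False using iso in_components_subset[OF assms(1)] by blast
qed

theorem theorem1p2:
  fixes U :: "real ^ 'n \<Rightarrow> real"
    and \<Omega> P :: "(real ^ 'n) set"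
    and N :: nat
    and \<Gamma> :: "nat \<Rightarrow> (real ^ 'n) set"
  assumes C2: "class_C2 U"
    and comp: "\<Omega> \<in> components {x. U x > 0}"
    and compact_bd: "compact (frontier \<Omega>)"
    and N: "N \<ge> 1"
    and \<Gamma>: "bij_betw \<Gamma> {1..N} (components (frontier \<Omega>))"
    and bdd: "bounded \<Omega>"
    and zero: "0 \<in> \<Omega>"
    and even: "\<forall>x\<in>\<Omega>. U (- x) = U x"
    and P: "P = {p \<in> frontier \<Omega>. critical_point U p}"
    and finP: "finite P"
    and single: "\<forall>j\<in>{1..N}. \<forall>p. \<Gamma> j = {p} \<longrightarrow> p \<in> P"
    and hyp: "\<forall>j\<in>{1..N}. diameter (\<Gamma> j) > 0 \<longrightarrow>
                (\<forall>p\<in>P \<inter> \<Gamma> j. hyperbolic_critical_point U p)"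
  shows "\<exists>j\<in>{1..N}. \<exists>(T::ereal) (u :: real \<Rightarrow> real ^ 'n) (v :: real \<Rightarrow> real ^ 'n).
     0 < T \<and>
     (\<forall>t. 0 < t \<and> ereal t < T \<longrightarrow>
        u t \<in> \<Omega> \<and>
        (u has_vector_derivative v t) (at t) \<and>
        (v has_vector_derivative grad U (u t)) (at t) \<and>
        1 / 2 * (norm (v t))\<^sup>2 - U (u t) = 0) \<and>
     (u \<longlongrightarrow> 0) (at_right 0) \<and>
     tends_at_endpoint (\<lambda>t. infdist (u t) (\<Gamma> j)) 0 T \<and>
     (T < \<infinity> \<longleftrightarrow> diameter (\<Gamma> j) > 0) \<and>
     (T < \<infinity> \<longrightarrow>
        (\<exists>x\<in>\<Gamma> j - P. tends_at_endpoint u x T) \<and>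
        tends_at_endpoint v 0 T)"
proof -
  note dU = class_C2_grad[OF C2] and dG = class_C2_hessian[OF C2]
  have "continuous_on UNIV U"
    using dU has_derivative_continuous by (metis continuous_at_imp_continuous_on)
  note \<Omega> = component_positive_set[OF this comp]
  obtain R where R: "closure \<Omega> \<subseteq> ball 0 R"
    using bounded_subset_ballD[OF bounded_closure[OF bdd], of 0] by blast
  obtain K where K: "0 < K" "\<And>x. x \<in> cball 0 R \<Longrightarrow> norm (grad U x) \<le> K"
    "\<And>x y. x \<in> cball 0 R \<Longrightarrow> y \<in> cball 0 R \<Longrightarrow> norm (grad U x - grad U y) \<le> K * norm (x - y)"
    using class_C2_grad_lipschitz_on_ball[OF C2, where R = R] by blast
  interpret potential_well U "grad U" \<Omega> R K
    by unfold_locales (use dU \<Omega> R zero K in auto)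
  obtain h n x m T u v \<Phi> M where "limit_trajectory U (grad U) \<Omega> R K h n x m T u v \<Phi> M"
    by (rule limit_trajectory_exists)
  then interpret limit_trajectory U "grad U" \<Omega> R K h n x m T u v \<Phi> M .
  have P': "P = {p \<in> frontier \<Omega>. grad U p = 0}" by (simp add: P critical_point_def)
  have component: "\<exists>j\<in>{1..N}. \<Gamma> j \<in> components (frontier \<Omega>) \<and> p \<in> \<Gamma> j" if "p \<in> frontier \<Omega>" for p
  proof -
    have "connected_component_set (frontier \<Omega>) p \<in> components (frontier \<Omega>)"
      using that by (rule componentsI)
    then obtain j where "j \<in> {1..N}" "\<Gamma> j = connected_component_set (frontier \<Omega>) p"
      using \<Gamma> unfolding bij_betw_def by (metis imageE)
    then show ?thesis using that \<open>connected_component_set (frontier \<Omega>) p \<in> _\<close>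
      by (intro bexI[of _ j]) (auto simp: connected_component_refl)
  qed
  have motion: "\<forall>t. 0 < t \<and> ereal t < T \<longrightarrow>
        u t \<in> \<Omega> \<and> (u has_vector_derivative v t) (at t) \<and>
        (v has_vector_derivative grad U (u t)) (at t) \<and> 1 / 2 * (norm (v t))\<^sup>2 - U (u t) = 0"
    using u_in_dom du dv energy0 by simp
  have start: "(u \<longlongrightarrow> 0) (at_right 0)"
  proof -
    obtain b where b: "0 < b" "ereal b < T" using ereal_dense2[OF T_pos] by auto
    have "((\<lambda>t. M * t) \<longlongrightarrow> M * 0) (at_right 0)" by (intro tendsto_intros)
    then have "((\<lambda>t. M * t) \<longlongrightarrow> 0) (at_right 0)" by simp
    moreover have "\<forall>\<^sub>F t in at_right 0. norm (u t) \<le> M * t"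
      using eventually_at_right_real[OF b(1)]
    proof eventually_elim
      case (elim t)
      have "ereal t < T" by (rule less_trans[OF _ b(2)]) (use elim in simp)
      then show ?case using lip[of 0 t] elim by (simp add: u0)
    qed
    ultimately show ?thesis by (rule Lim_null_comparison[rotated])
  qed
  have near_component: "((\<lambda>t. infdist (u t) C) \<longlongrightarrow> 0) F" if "(u \<longlongrightarrow> p) F" "p \<in> C" for p C F
    using tendsto_infdist[OF that(1), of C] that(2) by simp
  \<comment> \<open>Infinite travel time will lead to a component of zero diameter and finite travel
    time to one of positive diameter. In both cases \<open>u\<close> converges to a single point of
    the component, which settles the distance limit.\<close>
  have "T = \<infinity> \<or> (\<exists>\<tau>. T = ereal \<tau>)" using T_pos by (cases T) auto
  then show ?thesis
  proof
    assume T: "T = \<infinity>"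
    obtain p where p: "p \<in> frontier \<Omega>" "grad U p = 0" "(u \<longlongrightarrow> p) at_top"
      using infinite_time_limit[OF T] finP P' by blast
    obtain j where j: "j \<in> {1..N}" "\<Gamma> j \<in> components (frontier \<Omega>)" "p \<in> \<Gamma> j"
      using component[OF p(1)] by blast
    have "\<not> diameter (\<Gamma> j) > 0"
    proof
      assume diam: "diameter (\<Gamma> j) > 0"
      then have "hyperbolic_critical_point U p" using hyp j p by (auto simp: P')
      then have "invertible (hessian U p)" by (simp add: hyperbolic_critical_point_def)
      then have inj: "w = 0" if "hessian U p *v w = 0" for w
        using that matrix_left_invertible_ker[of "hessian U p"] by (auto simp: invertible_def)
      \<comment> \<open>A negative direction, normalised, persists near \<open>p\<close> by
        continuity of the Hessian and is ruled out for limits of minimisers.\<close>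
      have psd: "0 \<le> w \<bullet> (hessian U p *v w)" for w
      proof (rule ccontr)
        assume neg: "\<not> 0 \<le> w \<bullet> (hessian U p *v w)"
        then have "w \<noteq> 0" by auto
        define e where "e = w /\<^sub>R norm w"
        have e: "norm e = 1" using \<open>w \<noteq> 0\<close> by (simp add: e_def)
        have "e \<bullet> (hessian U p *v e) = (w \<bullet> (hessian U p *v w)) / (norm w)\<^sup>2"
          by (simp add: e_def matrix_vector_mult_scaleR power2_eq_square field_simps)
        also have "\<dots> < 0" using neg \<open>w \<noteq> 0\<close> by (simp add: divide_less_0_iff)
        finally have "e \<bullet> (hessian U p *v e) < 0" .
        then obtain \<mu> r where "0 < \<mu>" "0 < r" "\<And>y s. y \<in> ball p r \<Longrightarrow> 0 \<le> s \<Longrightarrow> s \<le> r \<Longrightarrow>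
            U (y + s *\<^sub>R e) \<le> U y + s * (grad U y \<bullet> e) - \<mu> * s\<^sup>2"
          using uniformly_concave_direction[OF dU dG class_C2_hessian_continuous[OF C2] e] by blast
        then show False by (rule no_concave_direction_at_limit[OF T p(3) e])
      qed
      obtain r where r: "0 < r" "\<And>x. x \<in> ball p r \<Longrightarrow> x \<noteq> p \<Longrightarrow> U p < U x"
        using strict_local_minimum[OF dU dG p(2) psd inj] by blast
      \<comment> \<open>\<open>U\<close> vanishes on the frontier but is positive near
        \<open>p\<close> except at \<open>p\<close> itself, so no other frontier point is close to
        \<open>p\<close>.\<close>
      have "\<Gamma> j = {p}"
      proof (rule frontier_component_singleton[OF j(2,3) r(1)])
        show "y = p" if "y \<in> frontier \<Omega>" "y \<in> ball p r" for y
          using r(2)[OF that(2)] zero_frontier[OF that(1)] zero_frontier[OF p(1)] by auto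
      qed
      then show False using diam by simp
    qed
    then show ?thesis
      using j(1) T_pos motion start near_component[OF p(3) j(3)]
      by (intro bexI[of _ j] exI[of _ T] exI[of _ u] exI[of _ v])
         (auto simp: T tends_at_endpoint_infinity)
  next
    assume "\<exists>\<tau>. T = ereal \<tau>"
    then obtain \<tau> where T: "T = ereal \<tau>" by blast
    obtain l where l: "(u \<longlongrightarrow> l) (at_left \<tau>)" "l \<in> frontier \<Omega>" "grad U l \<noteq> 0" "(v \<longlongrightarrow> 0) (at_left \<tau>)"
      by (rule finite_time_limit[OF T])
    obtain j where j: "j \<in> {1..N}" "\<Gamma> j \<in> components (frontier \<Omega>)" "l \<in> \<Gamma> j"
      using component[OF l(2)] by blast
    have lP: "l \<notin> P" using l(3) by (simp add: P')
    have "diameter (\<Gamma> j) > 0"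
    proof -
      have "bounded (\<Gamma> j)"
        using bounded_subset[OF compact_imp_bounded[OF compact_bd] in_components_subset[OF j(2)]] .
      \<comment> \<open>A one-point component would have to be a critical point, but
        \<open>l\<close> is regular. A second point, together with boundedness of the component,
        makes the diameter positive.\<close>
      moreover have "\<Gamma> j \<noteq> {l}" using single j(1) lP by blast
      then obtain y where "y \<in> \<Gamma> j" "y \<noteq> l" using j(3) by blast
      ultimately have "dist y l \<le> diameter (\<Gamma> j)" using j(3) by (intro diameter_bounded_bound) auto
      then show ?thesis using \<open>y \<noteq> l\<close> by (simp add: order_less_le_trans[OF _ \<open>dist y l \<le> _\<close>])
    qed
    then show ?thesis
      using j T_pos motion start near_component[OF l(1) j(3)] l lP
      by (intro bexI[of _ j] exI[of _ T] exI[of _ u] exI[of _ v])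
         (auto simp: T tends_at_endpoint_finite)
  qed
qed

end
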